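(* Let $\theta>1$, $\lambda>0$, $\sigma>0$ and $0\le\alpha<2$, and let $\Lambda(x)=\lambda/|x|^{\alpha}$. The unique probability density $p$ on $\mathbb{R}$ which is $C^2$ and which solves the non-local ordinary differential equation $$\sigma^2\frac{d^2p(x)}{dx^2}=2\Lambda(x)p(x)-2\theta\Lambda(\theta x)p(\theta x)$$ is $$p(x)=2\phi(2-\alpha)\sum_{n=0}^{\infty}\frac{a_n}{\theta^n}\sqrt{\left(\frac{2\lambda}{\sigma^2(2-\alpha)^2}\right)^{\frac{1}{2-\alpha}}\theta^n|x|}\;\mathrm{BesselK}\left(\frac{1}{2-\alpha},\,2\sqrt{\frac{2\lambda\theta^{n(2-\alpha)}|x|^{2-\alpha}}{\sigma^2(2-\alpha)^2}}\right),$$ where $$a_0=1,\qquad a_n=\prod_{k=1}^{n}\frac{\theta^{2-\alpha}}{1-\theta^{k(2-\alpha)}},\qquad \phi=\frac{\left(\frac{2\lambda}{\sigma^2(2-\alpha)^2}\right)^{\frac{1}{2-\alpha}}}{2\,\Gamma\left(\frac{1}{2-\alpha}\right)\Gamma\left(\frac{2}{2-\alpha}\right)}\left(\prod_{k=0}^{\infty}\left(1-\frac{1}{\theta^{2+k(2-\alpha)}}\right)\right)^{-1}.$$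
   Context: $\Gamma$ is the Euler Gamma function, and $$\mathrm{BesselK}(\nu,z)=\frac{\Gamma\left(\nu+\frac12\right)(2z)^{\nu}}{\sqrt{\pi}}\int_0^\infty\frac{\cos t}{(t^2+z^2)^{\nu+\frac12}}\,dt$$ is the modified Bessel function of the second kind. The differential equation is read at points $x$ where $\Lambda$ is finite (that is, $x\neq 0$ when $\alpha>0$), and the value of the series terms at $x=0$ is understood as the limit $x\to0$. Background: the equation is the stationary Fokker-Planck equation (with zero drift) of the opinion $X(t)$ of a regular agent interacting with a stubborn agent of opinion $0$, $dX(t)=\sigma\,dW(t)-\frac{X(t-)}{\theta'}N(dt)$ with $\frac1\theta+\frac1{\theta'}=1$, $W$ a standard Brownian motion and $N$ a point process with stochastic intensity $\Lambda(X(t-))$.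
   Formalization: For α>0 the stated p is not C² at x=0 (p'' is unbounded there or, for α=1, p has a corner), so "C²" is read as: continuous on ℝ and C² at the points where Λ is finite (x≠0 if α>0); for α=0 it is C² on all of ℝ. *)

theory Defs
  imports "HOL-Probability.Probability"
begin

text \<open>
  Basset's integral, for real \<open>\<nu> > -1/2\<close> and \<open>z > 0\<close>.  The Henstock-Kurzweil integral over
  \<open>{0..}\<close> agrees with the Lebesgue integral when \<open>\<nu> > 0\<close> and also covers the conditionally
  convergent range.
\<close>

definition BesselK :: "real \<Rightarrow> real \<Rightarrow> real" where
  "BesselK \<nu> z = Gamma (\<nu> + 1/2) * (2 * z) powr \<nu> / sqrt pi *
     integral {0..} (\<lambda>t. cos t / (t\<^sup>2 + z\<^sup>2) powr (\<nu> + 1/2))"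

text \<open>
  The intensity \<open>l / \<bar>x\<bar> powr \<alpha>\<close>.  The case \<open>\<alpha> = 0\<close> is separate because \<open>0 powr 0 = 0\<close> in the
  library, whereas the intensity is the constant \<open>l\<close> there, also at \<open>x = 0\<close>.
\<close>

definition intensity :: "real \<Rightarrow> real \<Rightarrow> real \<Rightarrow> real" where
  "intensity l \<alpha> x = (if \<alpha> = 0 then l else l / \<bar>x\<bar> powr \<alpha>)"

text \<open>The points at which the intensity is finite (in HOL, \<open>l / 0 = 0\<close> hides the pole).\<close>

definition regular_points :: "real \<Rightarrow> real set" where
  "regular_points \<alpha> = {x. \<alpha> = 0 \<or> x \<noteq> 0}"

definition probability_density :: "(real \<Rightarrow> real) \<Rightarrow> bool" where
  "probability_density p \<longleftrightarrow>
     p \<in> borel_measurable borel \<and> (\<forall>x. 0 \<le> p x) \<and> prob_space (density lborel (\<lambda>x. ennreal (p x)))"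

text \<open>Intended for open \<open>S\<close>, since derivatives are two-sided.\<close>

definition C2_on :: "real set \<Rightarrow> (real \<Rightarrow> real) \<Rightarrow> bool" where
  "C2_on S p \<longleftrightarrow>
     (\<forall>x\<in>S. p differentiable at x) \<and> (\<forall>x\<in>S. deriv p differentiable at x) \<and>
     continuous_on S (deriv (deriv p))"

text \<open>
  For \<open>\<alpha> > 0\<close> the intensity has a pole at \<open>0\<close>: neither the equation nor a second derivative makes
  sense there, and smoothness is required where the equation is read, together with continuity on
  the whole line.  (A solution with nonzero value at \<open>0\<close> has an unbounded second derivative near
  \<open>0\<close> or, for \<open>\<alpha> = 1\<close>, a corner; without continuity at \<open>0\<close> the two half-lines would decouple.)
  For \<open>\<alpha> = 0\<close> this is \<open>C\<^sup>2\<close> on the whole line.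
\<close>

definition C2_density :: "real \<Rightarrow> (real \<Rightarrow> real) \<Rightarrow> bool" where
  "C2_density \<alpha> p \<longleftrightarrow>
     probability_density p \<and> continuous_on UNIV p \<and> C2_on (regular_points \<alpha>) p"

definition solves_equation :: "real \<Rightarrow> real \<Rightarrow> real \<Rightarrow> real \<Rightarrow> (real \<Rightarrow> real) \<Rightarrow> bool" where
  "solves_equation \<theta> l \<sigma> \<alpha> p \<longleftrightarrow>
     (\<forall>x \<in> regular_points \<alpha>.
        \<sigma>\<^sup>2 * deriv (deriv p) x =
          2 * intensity l \<alpha> x * p x - 2 * \<theta> * intensity l \<alpha> (\<theta> * x) * p (\<theta> * x))"

definition coeff_a :: "real \<Rightarrow> real \<Rightarrow> nat \<Rightarrow> real" where
  "coeff_a \<theta> \<alpha> n = (\<Prod>k=1..n. \<theta> powr (2 - \<alpha>) / (1 - \<theta> powr (real k * (2 - \<alpha>))))"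

definition scale_c :: "real \<Rightarrow> real \<Rightarrow> real \<Rightarrow> real" where
  "scale_c l \<sigma> \<alpha> = (2 * l / (\<sigma>\<^sup>2 * (2 - \<alpha>)\<^sup>2)) powr (1 / (2 - \<alpha>))"

definition const_phi :: "real \<Rightarrow> real \<Rightarrow> real \<Rightarrow> real \<Rightarrow> real" where
  "const_phi \<theta> l \<sigma> \<alpha> =
     scale_c l \<sigma> \<alpha> / (2 * Gamma (1 / (2 - \<alpha>)) * Gamma (2 / (2 - \<alpha>))) *
     inverse (prodinf (\<lambda>k. 1 - 1 / \<theta> powr (2 + real k * (2 - \<alpha>))))"

definition bessel_term :: "real \<Rightarrow> real \<Rightarrow> real \<Rightarrow> real \<Rightarrow> nat \<Rightarrow> real \<Rightarrow> real" where
  "bessel_term \<theta> l \<sigma> \<alpha> n x =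
     coeff_a \<theta> \<alpha> n / \<theta> ^ n * sqrt (scale_c l \<sigma> \<alpha> * \<theta> ^ n * \<bar>x\<bar>) *
     BesselK (1 / (2 - \<alpha>))
       (2 * sqrt (2 * l * \<theta> powr (real n * (2 - \<alpha>)) * \<bar>x\<bar> powr (2 - \<alpha>) / (\<sigma>\<^sup>2 * (2 - \<alpha>)\<^sup>2)))"

text \<open>At \<open>x = 0\<close>, where \<open>BesselK\<close> has a pole, the terms are given by their limits.\<close>

definition series_term :: "real \<Rightarrow> real \<Rightarrow> real \<Rightarrow> real \<Rightarrow> nat \<Rightarrow> real \<Rightarrow> real" where
  "series_term \<theta> l \<sigma> \<alpha> n x =
     (if x = 0 then Lim (at 0) (bessel_term \<theta> l \<sigma> \<alpha> n) else bessel_term \<theta> l \<sigma> \<alpha> n x)"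

definition stationary_density :: "real \<Rightarrow> real \<Rightarrow> real \<Rightarrow> real \<Rightarrow> real \<Rightarrow> real" where
  "stationary_density \<theta> l \<sigma> \<alpha> x =
     2 * const_phi \<theta> l \<sigma> \<alpha> * (2 - \<alpha>) * (\<Sum>n. series_term \<theta> l \<sigma> \<alpha> n x)"

end

theory Submission
  imports Defs
begin

text \<open>
  Put \<open>\<beta> = 2 - \<alpha>\<close> and \<open>\<nu> = 1/\<beta>\<close>.  Basset's integral turns the \<open>n\<close>-th term of the series into
  \<open>a\<^sub>n \<theta>\<^sup>-\<^sup>n u(\<theta>\<^sup>n \<bar>x\<bar>)\<close>, where \<open>u(s)\<close> is half of
  \<open>\<integral> t powr (\<nu> - 1) exp (- t - A s powr \<beta> / t) dt\<close> over \<open>t > 0\<close>, with \<open>A = 2\<lambda> / (\<sigma>\<^sup>2 \<beta>\<^sup>2)\<close>.  This \<open>u\<close> solves the local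
  equation \<open>\<sigma>\<^sup>2 u'' = 2 \<Lambda> u\<close>, and the recurrence of \<open>a\<^sub>n\<close> makes the series solve the non-local one.
  Euler's identity \<open>\<Sum> a\<^sub>n z\<^sup>n = \<Prod> (1 - z \<theta> powr (- k \<beta>))\<close> evaluates the series at \<open>0\<close> and its integrals.

  Positivity and uniqueness both come from a maximum principle.  For an integrable solution \<open>f\<close> on
  the half-line, continuous at \<open>0\<close>, put \<open>D(s) = \<integral> y powr (-\<alpha>) f(y) dy\<close> over \<open>y > s\<close>; then
  \<open>f' = K (D(\<theta> s) - D(s))\<close> with \<open>K = 2\<lambda>/\<sigma>\<^sup>2\<close>, and both \<open>f\<close> and \<open>D\<close> vanish at infinity.  If \<open>\<alpha> \<ge> 1\<close>, a negative minimum of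
  \<open>f\<close> at \<open>s\<close> would be repeated at \<open>\<theta> s, \<theta>\<^sup>2 s, \<dots>\<close>, so \<open>f(0) \<ge> 0\<close> implies \<open>f \<ge> 0\<close>.  If \<open>\<alpha> < 1\<close>, the
  same argument applies to \<open>D\<close>, and to the largest increment \<open>D(s) - D(t)\<close> with \<open>t \<le> s\<close>: thus
  \<open>D(0) \<ge> 0\<close> implies that \<open>D\<close> decreases, that is, \<open>f \<ge> 0\<close>.  Hence the solutions on a half-line
  form a line, and continuity at \<open>0\<close> together with the total mass fixes the density.
\<close>

section \<open>The generating function of the coefficients\<close>

context
  fixes \<theta> \<alpha> :: real
  assumes \<theta>: "\<theta> > 1" and \<alpha>: "\<alpha> < 2"
begin

lemma coeff_a_0 [simp]: "coeff_a \<theta> \<alpha> 0 = 1"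
  by (simp add: coeff_a_def)

lemma powr_gt_1: "0 < r \<Longrightarrow> \<theta> powr r > 1"
  using \<theta> powr_less_mono[of 0 r \<theta>] by simp

lemma coeff_a_Suc:
  "coeff_a \<theta> \<alpha> (Suc n) = coeff_a \<theta> \<alpha> n * (\<theta> powr (2 - \<alpha>) / (1 - \<theta> powr (real (Suc n) * (2 - \<alpha>))))"
  by (simp add: coeff_a_def)

text \<open>The defining factor \<open>\<theta> powr (2 - \<alpha>) / (1 - Y)\<close> is cleared of
  its denominator and the result divided by \<open>Y\<close>. With
  \<open>q = \<theta> powr - (2 - \<alpha>)\<close> this compares the coefficients of the generating
  function at \<open>z\<close> and at \<open>q * z\<close>.\<close>

lemma coeff_a_recurrence:
  "coeff_a \<theta> \<alpha> (Suc n) * \<theta> powr - (real (Suc n) * (2 - \<alpha>)) =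
     coeff_a \<theta> \<alpha> (Suc n) + coeff_a \<theta> \<alpha> n * \<theta> powr - (real n * (2 - \<alpha>))"
proof -
  define Y where "Y = \<theta> powr (real (Suc n) * (2 - \<alpha>))"
  have Y: "Y > 1" unfolding Y_def by (rule powr_gt_1) (use \<alpha> in auto)
  have 1: "\<theta> powr - (real (Suc n) * (2 - \<alpha>)) = 1 / Y"
    by (simp add: Y_def powr_minus_divide)
  have 2: "\<theta> powr - (real n * (2 - \<alpha>)) = \<theta> powr (2 - \<alpha>) / Y"
    by (simp add: Y_def powr_diff[symmetric] algebra_simps)
  have 3: "coeff_a \<theta> \<alpha> n * \<theta> powr (2 - \<alpha>) = coeff_a \<theta> \<alpha> (Suc n) * (1 - Y)"
    using Y by (simp add: coeff_a_Suc Y_def)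
  show ?thesis using Y unfolding 1 2 
    by (simp add: 3 field_simps)
qed

text \<open>Ratio test: the denominators grow geometrically, so the ratios fall below 1/2 whatever
  \<open>R\<close> is. The generating function is thus entire, and the weight \<open>R ^ n\<close>
  absorbs the powers of \<theta> that arise on differentiating the series.\<close>

lemma summable_coeff_a: "summable (\<lambda>n. \<bar>coeff_a \<theta> \<alpha> n\<bar> * R ^ n)" if "R \<ge> 0"
proof -
  have "filterlim (\<lambda>n. \<theta> powr (real (Suc n) * (2 - \<alpha>))) at_top sequentially"
    using \<theta> \<alpha> by real_asymp
  hence "eventually (\<lambda>n. \<theta> powr (real (Suc n) * (2 - \<alpha>)) \<ge> 1 + 2 * R * \<theta> powr (2 - \<alpha>)) sequentially"
    by (simp add: filterlim_at_top)
  then obtain N where N: "\<And>n. n \<ge> N \<Longrightarrow> \<theta> powr (real (Suc n) * (2 - \<alpha>)) \<ge> 1 + 2 * R * \<theta> powr (2 - \<alpha>)"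
    by (auto simp: eventually_sequentially)
  show ?thesis
  proof (rule summable_ratio_test[of "1/2" N])
    fix n assume n: "n \<ge> N"
    define Y where "Y = \<theta> powr (real (Suc n) * (2 - \<alpha>))"
    have Y: "Y > 1" unfolding Y_def by (rule powr_gt_1) (use \<alpha> in auto)
    have "R * \<theta> powr (2 - \<alpha>) / (Y - 1) \<le> 1 / 2"
      using N[OF n] Y by (simp add: Y_def field_simps)
    hence "\<bar>coeff_a \<theta> \<alpha> n\<bar> * R ^ n * (R * \<theta> powr (2 - \<alpha>) / (Y - 1)) \<le> \<bar>coeff_a \<theta> \<alpha> n\<bar> * R ^ n * (1 / 2)"
      using that by (intro mult_left_mono) auto
    thus "norm (\<bar>coeff_a \<theta> \<alpha> (Suc n)\<bar> * R ^ Suc n) \<le> 1 / 2 * norm (\<bar>coeff_a \<theta> \<alpha> n\<bar> * R ^ n)"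
      using that Y unfolding coeff_a_Suc Y_def[symmetric] by (simp add: abs_mult mult_ac)
  qed simp
qed

definition coeff_gf :: "real \<Rightarrow> real" where
  "coeff_gf z = (\<Sum>n. coeff_a \<theta> \<alpha> n * z ^ n)"

lemma summable_coeff_a': "summable (\<lambda>n. coeff_a \<theta> \<alpha> n * z ^ n)"
  by (rule summable_norm_cancel) (use summable_coeff_a[of "\<bar>z\<bar>"] in \<open>simp add: abs_mult power_abs\<close>)

text \<open>By \<open>coeff_a_recurrence\<close> the series at \<open>q * z\<close> is the series at
  \<open>z\<close> plus \<open>z\<close> times the series at \<open>q * z\<close>; this identity is
  solved for \<open>coeff_gf z\<close>.\<close>

lemma coeff_gf_eq: "coeff_gf z = (1 - z) * coeff_gf (\<theta> powr - (2 - \<alpha>) * z)"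
proof -
  define q where "q = \<theta> powr - (2 - \<alpha>)"
  have q: "q ^ n = \<theta> powr - (real n * (2 - \<alpha>))" for n
    using \<theta> by (simp add: q_def powr_realpow[symmetric] powr_powr algebra_simps)
  have s: "coeff_gf z = 1 + (\<Sum>n. coeff_a \<theta> \<alpha> (Suc n) * z ^ Suc n)" for z
    unfolding coeff_gf_def by (subst suminf_split_head[OF summable_coeff_a']) auto
  have sm: "summable (\<lambda>n. coeff_a \<theta> \<alpha> (Suc n) * z ^ Suc n)" for z
    by (subst summable_Suc_iff) (rule summable_coeff_a')
  have "coeff_gf (q * z) = 1 + (\<Sum>n. coeff_a \<theta> \<alpha> (Suc n) * z ^ Suc n + z * (coeff_a \<theta> \<alpha> n * (q * z) ^ n))"
    unfolding s power_mult_distrib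
  proof (intro arg_cong[where f = "\<lambda>x. 1 + suminf x"] ext)
    fix n
    have "coeff_a \<theta> \<alpha> (Suc n) * (q ^ Suc n * z ^ Suc n) = (coeff_a \<theta> \<alpha> (Suc n) * q ^ Suc n) * z ^ Suc n" by simp
    also have "coeff_a \<theta> \<alpha> (Suc n) * q ^ Suc n = coeff_a \<theta> \<alpha> (Suc n) + coeff_a \<theta> \<alpha> n * q ^ n"
      unfolding q by (rule coeff_a_recurrence)
    finally show "coeff_a \<theta> \<alpha> (Suc n) * (q ^ Suc n * z ^ Suc n) =
         coeff_a \<theta> \<alpha> (Suc n) * z ^ Suc n + z * (coeff_a \<theta> \<alpha> n * (q ^ n * z ^ n))"
      by (simp add: algebra_simps)
  qed
  also have "\<dots> = coeff_gf z + z * coeff_gf (q * z)"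
    by (subst suminf_add[symmetric, OF sm summable_mult[OF summable_coeff_a']])
       (simp add: s[of z] suminf_mult[OF summable_coeff_a'] coeff_gf_def[symmetric])
  finally show ?thesis by (simp add: q_def algebra_simps)
qed

lemma isCont_coeff_gf: "isCont coeff_gf z"
  unfolding coeff_gf_def
  by (rule isCont_powser[OF summable_coeff_a', of _ "\<bar>z\<bar> + 1"]) auto

text \<open>The functional equation is iterated along \<open>z * q ^ n\<close>, which tends to 0,
  where the generating function is continuous with value 1. For \<open>z < 1\<close> every factor of
  the convergent product is positive, hence so is the product.\<close>

lemma coeff_gf_prodinf:
  assumes "0 < z" "z < 1"
  shows "coeff_gf z = (\<Prod>k. 1 - z * \<theta> powr - (real k * (2 - \<alpha>)))" "coeff_gf z > 0"
proof -
  define q where "q = \<theta> powr - (2 - \<alpha>)"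
  have q: "\<theta> powr - (real n * (2 - \<alpha>)) = q ^ n" for n
    using \<theta> by (simp add: q_def powr_realpow[symmetric] powr_powr algebra_simps)
  have q01: "0 < q" "q < 1"
    using \<theta> \<alpha> powr_less_mono[of "- (2 - \<alpha>)" 0 \<theta>] by (auto simp: q_def)
  have prod: "coeff_gf z = (\<Prod>k<n. 1 - z * q ^ k) * coeff_gf (z * q ^ n)" for n
  proof (induction n)
    case (Suc n)
    thus ?case using coeff_gf_eq[of "z * q ^ n"] by (simp add: q_def mult_ac)
  qed simp
  have lim: "(\<lambda>n. coeff_gf (z * q ^ n)) \<longlonglongrightarrow> coeff_gf (z * 0)"
    by (rule isCont_tendsto_compose[OF isCont_coeff_gf]) 
       (intro tendsto_intros LIMSEQ_realpow_zero; use q01 in simp)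
  have gf0: "coeff_gf (z * 0) = 1" unfolding coeff_gf_def by (simp add: powser_zero)
  have "summable (\<lambda>k. norm ((1 - z * q ^ k) - 1))"
    using q01 assms by (auto simp: abs_mult intro!: summable_mult summable_geometric)
  hence conv: "convergent_prod (\<lambda>k. 1 - z * q ^ k)"
    by (intro abs_convergent_prod_imp_convergent_prod summable_imp_abs_convergent_prod)
  have "(\<lambda>n. \<Prod>k\<le>n. 1 - z * q ^ k) \<longlonglongrightarrow> (\<Prod>k. 1 - z * q ^ k)"
    by (rule convergent_prod_LIMSEQ[OF conv])
  hence "(\<lambda>n. \<Prod>k<n. 1 - z * q ^ k) \<longlonglongrightarrow> (\<Prod>k. 1 - z * q ^ k)"
    by (subst LIMSEQ_lessThan_iff_atMost)
  from tendsto_mult[OF this lim] have "(\<lambda>n. coeff_gf z) \<longlonglongrightarrow> (\<Prod>k. 1 - z * q ^ k) * 1"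
    unfolding prod[symmetric] gf0 .
  hence eq: "coeff_gf z = (\<Prod>k. 1 - z * q ^ k)" by (simp add: LIMSEQ_const_iff)
  thus "coeff_gf z = (\<Prod>k. 1 - z * \<theta> powr - (real k * (2 - \<alpha>)))" by (simp add: q)
  have "z * q ^ k < 1" for k
  proof -
    have "z * q ^ k \<le> z * 1" using q01 assms by (intro mult_left_mono power_le_one) auto
    also have "\<dots> < 1" using assms by simp
    finally show ?thesis .
  qed
  hence pos: "1 - z * q ^ k > 0" for k by (simp add: algebra_simps)
  thus "coeff_gf z > 0" unfolding eq using conv
    by (metis less_0_prodinf)
qed

end

section \<open>The integral representation of the Bessel function\<close>

lemma has_bochner_integral_Gamma:
  fixes \<mu> B :: real
  assumes "\<mu> > 0" "B > 0"
  shows "has_bochner_integral lborel (\<lambda>t. indicator {0<..} t * (t powr (\<mu> - 1) * exp (- (B * t)))) (Gamma \<mu> * B powr - \<mu>)"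
proof -
  have "has_bochner_integral lborel (\<lambda>t. indicator {0..} t * t powr (\<mu> - 1) / exp t) (Gamma \<mu>)"
    by (rule has_bochner_integral_nn_integral)
       (use assms in \<open>auto simp: Gamma_conv_nn_integral_real Gamma_real_nonneg\<close>)
  also have "(\<lambda>t. indicator {0..} t * t powr (\<mu> - 1) / exp t) = (\<lambda>t. indicator {0<..} t * (t powr (\<mu> - 1) * exp (- t)))"
    by (auto simp: fun_eq_iff indicator_def exp_minus field_simps)
  finally have "has_bochner_integral lborel (\<lambda>t. indicator {0<..} (0 + B * t) * ((0 + B * t) powr (\<mu> - 1) * exp (- (0 + B * t)))) (Gamma \<mu> /\<^sub>R \<bar>B\<bar>)"
    using assms by (subst (asm) lborel_has_bochner_integral_real_affine_iff[of B _ _ 0]) auto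
  hence "has_bochner_integral lborel (\<lambda>t. B powr (1 - \<mu>) * (indicator {0<..} (0 + B * t) * ((0 + B * t) powr (\<mu> - 1) * exp (- (0 + B * t)))))
           (B powr (1 - \<mu>) * (Gamma \<mu> /\<^sub>R \<bar>B\<bar>))"
    by (intro has_bochner_integral_mult_right)
  moreover have "B powr (1 - \<mu>) * (indicator {0<..} (0 + B * t) * ((0 + B * t) powr (\<mu> - 1) * exp (- (0 + B * t)))) =
     indicator {0<..} t * (t powr (\<mu> - 1) * exp (- (B * t)))" for t
    using assms by (auto simp: indicator_def powr_mult zero_less_mult_iff mult_ac powr_diff)
  moreover have "B powr (1 - \<mu>) * (Gamma \<mu> /\<^sub>R \<bar>B\<bar>) = Gamma \<mu> * B powr - \<mu>"
    using assms by (simp add: powr_diff powr_minus field_simps)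
  ultimately show ?thesis by (simp only:)
qed

lemma even_integral:
  fixes g :: "real \<Rightarrow> real"
  assumes g: "integrable lborel g" and even: "\<And>t. g (- t) = g t"
  shows "(LBINT t. g t) = 2 * (LBINT t:{0..}. g t)"
proof -
  have int: "set_integrable lborel S g" if "S \<in> sets borel" for S
    using g that unfolding set_integrable_def by (intro integrable_mult_indicator) auto
  have "(LBINT t. g t) = (LBINT t:{..0} \<union> {0..}. g t)"
    by (simp add: set_lebesgue_integral_def indicator_def)
       (auto intro!: Bochner_Integration.integral_cong)
  also have "\<dots> = (LBINT t:{..0}. g t) + (LBINT t:{0..}. g t)"
  proof (rule set_integral_Un_AE)
    show "AE t in lborel. \<not> (t \<in> {..0} \<and> t \<in> {0::real..})"
      using AE_lborel_singleton[of "0::real"] by eventually_elim auto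
  qed (auto intro: int)
  also have "(LBINT t:{..0}. g t) = (LBINT t. indicator {..0} (0 + (-1) * t) *\<^sub>R g (0 + (-1) * t))"
    unfolding set_lebesgue_integral_def
    by (subst lborel_integral_real_affine[of "-1" _ 0]) auto
  also have "\<dots> = (LBINT t:{0..}. g t)"
    unfolding set_lebesgue_integral_def by (auto intro!: Bochner_Integration.integral_cong simp: even indicator_def)
  finally show ?thesis by simp
qed

text \<open>For \<open>x > 0\<close> the integral over \<open>t\<close> is
  \<open>2 * x powr (\<mu> / 2)\<close> times the Bessel function K of order \<mu> at
  \<open>2 * sqrt x\<close>; at \<open>x = 0\<close> it is Euler's integral. The indicator belongs
  to the integrand, so that integrals extend over the whole line.\<close>

definition bessel_integrand :: "real \<Rightarrow> real \<Rightarrow> real \<Rightarrow> real" where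
  "bessel_integrand \<mu> x t = indicator {0<..} t * (t powr (\<mu> - 1) * exp (- t - x / t))"

definition bessel_integral :: "real \<Rightarrow> real \<Rightarrow> real" where "bessel_integral \<mu> x = (LBINT t. bessel_integrand \<mu> x t)"

section \<open>Integrability, continuity, derivative and recurrence of
  \<open>bessel_integral\<close>\<close>

lemma bessel_integrand_measurable [measurable]: "bessel_integrand \<mu> x \<in> borel_measurable borel"
  unfolding bessel_integrand_def by measurable

lemma integrable_bessel_integral_0: "\<mu> > 0 \<Longrightarrow> integrable lborel (bessel_integrand \<mu> 0)"
  and bessel_integral_0: "\<mu> > 0 \<Longrightarrow> bessel_integral \<mu> 0 = Gamma \<mu>"
proof -
  assume "\<mu> > 0"
  hence "has_bochner_integral lborel (bessel_integrand \<mu> 0) (Gamma \<mu>)"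
    using has_bochner_integral_Gamma[of \<mu> 1] by (simp add: bessel_integrand_def[abs_def])
  thus "integrable lborel (bessel_integrand \<mu> 0)" "bessel_integral \<mu> 0 = Gamma \<mu>"
    by (auto simp: has_bochner_integral_iff bessel_integral_def)
qed

lemma bessel_integrand_nonneg: "bessel_integrand \<mu> x t \<ge> 0"
  by (simp add: bessel_integrand_def)

lemma bessel_integrand_le: "x \<ge> 0 \<Longrightarrow> bessel_integrand \<mu> x t \<le> bessel_integrand \<mu> 0 t"
  by (auto simp: bessel_integrand_def indicator_def)

lemma power_div_fact_le_exp:
  fixes x :: real
  assumes "x \<ge> 0" shows "x ^ n / fact n \<le> exp x"
proof -
  have "(\<Sum>k\<in>{n}. x ^ k /\<^sub>R fact k) \<le> (\<Sum>k. x ^ k /\<^sub>R fact k)"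
    by (intro sum_le_suminf summable_exp_generic) (use assms in auto)
  thus ?thesis by (simp add: exp_def divide_inverse mult.commute)
qed

text \<open>Near \<open>t = 0\<close> the exponential beats every power: bounded by a multiple of
  \<open>t ^ n\<close>, it lifts the order to \<open>\<mu> + n > 0\<close>, where Euler's integral
  is a majorant. All real orders are needed, since differentiation lowers the order.\<close>

lemma integrable_bessel_integral_pos: 
  assumes "x > 0" shows "integrable lborel (bessel_integrand \<mu> x)"
proof -
  obtain n :: nat where n: "\<mu> + real n > 0"
    using reals_Archimedean2[of "-\<mu>"] by (metis add.commute neg_less_iff_less minus_less_iff less_minus_iff add_0 diff_less_eq diff_0)
  have "integrable lborel (\<lambda>t. fact n / x ^ n * bessel_integrand (\<mu> + n) 0 t)"
    by (intro integrable_mult_right integrable_bessel_integral_0 n)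
  thus ?thesis
  proof (rule Bochner_Integration.integrable_bound)
    show "AE t in lborel. norm (bessel_integrand \<mu> x t) \<le> norm (fact n / x ^ n * bessel_integrand (\<mu> + n) 0 t)"
    proof (intro AE_I2)
      fix t :: real
      show "norm (bessel_integrand \<mu> x t) \<le> norm (fact n / x ^ n * bessel_integrand (\<mu> + n) 0 t)"
      proof (cases "t > 0")
        case True
        have "(x / t) ^ n / fact n \<le> exp (x / t)"
          using True assms by (intro power_div_fact_le_exp) auto
        hence "exp (- (x / t)) \<le> fact n / x ^ n * t ^ n"
          using True assms by (simp add: exp_minus field_simps)
        hence "t powr (\<mu> - 1) * exp (- t) * exp (- (x / t)) \<le> t powr (\<mu> - 1) * exp (- t) * (fact n / x ^ n * t ^ n)"
          by (intro mult_left_mono) auto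
        also have "\<dots> = fact n / x ^ n * (t powr (\<mu> + n - 1) * exp (- t))"
          using True by (simp add: powr_realpow[symmetric] powr_add[symmetric] algebra_simps)
        also have "t powr (\<mu> - 1) * exp (- t) * exp (- (x / t)) = t powr (\<mu> - 1) * exp (- t - x / t)"
          by (simp add: exp_diff exp_minus field_simps)
        finally show ?thesis using True assms by (simp add: bessel_integrand_def abs_mult)
      qed (simp add: bessel_integrand_def)
    qed
  qed simp
qed

lemma integrable_bessel_integral: "x \<ge> 0 \<Longrightarrow> \<mu> > 0 \<Longrightarrow> integrable lborel (bessel_integrand \<mu> x)"
  using integrable_bessel_integral_0[of \<mu>] integrable_bessel_integral_pos[of x \<mu>] by (cases "x = 0") auto

lemma bessel_integral_nonneg: "bessel_integral \<mu> x \<ge> 0"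
  unfolding bessel_integral_def by (intro Bochner_Integration.integral_nonneg bessel_integrand_nonneg)

lemma bessel_integral_le_Gamma: "x \<ge> 0 \<Longrightarrow> \<mu> > 0 \<Longrightarrow> bessel_integral \<mu> x \<le> Gamma \<mu>"
  unfolding bessel_integral_0[symmetric] bessel_integral_def
  by (intro integral_mono integrable_bessel_integral bessel_integrand_le) auto

text \<open>Dominated convergence, with the integrand at \<open>x = 0\<close> as majorant. The point
  0 is included, which later gives the value of the series at the origin.\<close>

lemma continuous_on_bessel_integral:
  assumes "\<mu> > 0" shows "continuous_on {0..} (bessel_integral \<mu>)"
  unfolding continuous_on_sequentially
proof (intro ballI allI impI)
  fix X :: "nat \<Rightarrow> real" and x assume x: "x \<in> {0..}" and X: "(\<forall>n. X n \<in> {0..}) \<and> X \<longlonglongrightarrow> x"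
  have "(\<lambda>n. LBINT t. bessel_integrand \<mu> (X n) t) \<longlonglongrightarrow> (LBINT t. bessel_integrand \<mu> x t)"
  proof (rule integral_dominated_convergence[where w = "bessel_integrand \<mu> 0"])
    show "AE t in lborel. (\<lambda>n. bessel_integrand \<mu> (X n) t) \<longlonglongrightarrow> bessel_integrand \<mu> x t"
    proof (intro AE_I2)
      fix t :: real
      show "(\<lambda>n. bessel_integrand \<mu> (X n) t) \<longlonglongrightarrow> bessel_integrand \<mu> x t"
        unfolding bessel_integrand_def using X by (cases "t = 0") (auto intro!: tendsto_intros)
    qed
    show "AE t in lborel. norm (bessel_integrand \<mu> (X n) t) \<le> bessel_integrand \<mu> 0 t" for n
      using X by (intro AE_I2) (auto simp: bessel_integrand_nonneg bessel_integrand_le)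
  qed (use assms in \<open>auto intro: integrable_bessel_integral_0\<close>)
  thus "(bessel_integral \<mu> \<circ> X) \<longlonglongrightarrow> bessel_integral \<mu> x" by (simp add: bessel_integral_def o_def)
qed

text \<open>The exponential lies above its tangents, so the error is between 0 and
  \<open>(b - a) * (exp b - exp a)\<close>, and the mean slope is at most \<open>exp m\<close>. A
  free common bound \<open>m\<close> makes the estimate usable for exponents that depend on an
  integration variable.\<close>

lemma exp_first_order_error:
  fixes a b m :: real
  assumes "a \<le> m" "b \<le> m"
  shows "\<bar>exp b - exp a - (b - a) * exp a\<bar> \<le> (b - a)\<^sup>2 * exp m"
proof -
  have *: "exp y - exp x \<ge> (y - x) * exp x" for x y :: real
  proof -
    have "exp x * (1 + (y - x)) \<le> exp x * exp (y - x)"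
      by (intro mult_left_mono exp_ge_add_one_self) auto
    thus ?thesis by (simp add: exp_diff algebra_simps)
  qed
  have "\<bar>exp b - exp a\<bar> \<le> \<bar>b - a\<bar> * exp m"
  proof -
    have e: "exp a \<le> exp m" "exp b \<le> exp m" using assms by auto
    show ?thesis
    proof (cases "a \<le> b")
      case True
      have "exp b - exp a \<le> (b - a) * exp b" using *[of a b] by (simp add: algebra_simps)
      also have "\<dots> \<le> (b - a) * exp m" using True e by (intro mult_left_mono) auto
      finally show ?thesis using True by simp
    next
      case False
      have "exp a - exp b \<le> (a - b) * exp a" using *[of b a] by (simp add: algebra_simps)
      also have "\<dots> \<le> (a - b) * exp m" using False e by (intro mult_left_mono) auto
      finally show ?thesis using False by simp
    qed
  qed
  hence "\<bar>b - a\<bar> * \<bar>exp b - exp a\<bar> \<le> \<bar>b - a\<bar> * (\<bar>b - a\<bar> * exp m)" by (intro mult_left_mono) auto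
  hence "(b - a) * (exp b - exp a) \<le> (b - a)\<^sup>2 * exp m"
    by (simp add: abs_mult[symmetric] power2_eq_square mult.assoc[symmetric])
  moreover have "exp b - exp a - (b - a) * exp a \<le> (b - a) * (exp b - exp a)"
    using *[of a b] by (simp add: algebra_simps)
  ultimately show ?thesis using *[of b a] by simp
qed

text \<open>The difference quotient is off by at most \<open>C * \<bar>y - x\<bar>\<close>. In this
  form an estimate integrated over \<open>t\<close> yields the derivative of an integral without a
  separate interchange of limits.\<close>

lemma DERIV_quadratic_error:
  fixes f :: "real \<Rightarrow> real"
  assumes "d > 0" and bound: "\<And>y. \<bar>y - x\<bar> < d \<Longrightarrow> \<bar>f y - f x - (y - x) * D\<bar> \<le> C * (y - x)\<^sup>2"
  shows "(f has_real_derivative D) (at x)"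
  unfolding has_field_derivative_iff
proof (rule Lim_transform[where g = "\<lambda>_. D"])
  have "((\<lambda>y. (f y - f x) / (y - x) - D) \<longlongrightarrow> 0) (at x)"
  proof (rule Lim_null_comparison)
    show "((\<lambda>y. C * \<bar>y - x\<bar>) \<longlongrightarrow> 0) (at x)" by (auto intro!: tendsto_eq_intros)
    show "eventually (\<lambda>y. norm ((f y - f x) / (y - x) - D) \<le> C * \<bar>y - x\<bar>) (at x)"
    proof -
      have "eventually (\<lambda>y. \<bar>y - x\<bar> < d \<and> y \<noteq> x) (at x)"
        using \<open>d > 0\<close> by (auto simp: eventually_at dist_real_def)
      thus ?thesis
      proof eventually_elim
      case (elim y)
      hence y: "\<bar>y - x\<bar> < d" "y \<noteq> x" by auto
      have "norm ((f y - f x) / (y - x) - D) = \<bar>f y - f x - (y - x) * D\<bar> / \<bar>y - x\<bar>"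
      proof -
        have "f y - f x - (y - x) * D = ((f y - f x) / (y - x) - D) * (y - x)"
          using y by (simp add: field_simps)
        thus ?thesis using y by (simp add: abs_mult)
      qed
      also have "\<dots> \<le> C * (y - x)\<^sup>2 / \<bar>y - x\<bar>"
        using bound[OF y(1)] by (intro divide_right_mono) auto
      also have "\<dots> = C * \<bar>y - x\<bar>"
      proof -
        have sq: "(y - x)\<^sup>2 = \<bar>y - x\<bar> * \<bar>y - x\<bar>" by (simp add: power2_eq_square)
        show ?thesis unfolding sq using y by (simp add: field_simps)
      qed
      finally show ?case .
      qed
    qed
  qed
  thus "((\<lambda>y. (f y - f x) / (y - x) - D) \<longlongrightarrow> 0) (at x)" .
qed simp

text \<open>Differentiation under the integral: \<open>exp_first_order_error\<close> is applied to
  the exponents \<open>- (x / t)\<close> and \<open>- (y / t)\<close> with the common bound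
  \<open>- (x / 2 / t)\<close>. The squared increment \<open>(y - x)\<^sup>2 / t\<^sup>2\<close>
  lowers the order of the remainder by 2.\<close>

lemma DERIV_bessel_integral:
  assumes x: "x > 0"
  shows "(bessel_integral \<mu> has_real_derivative - bessel_integral (\<mu> - 1) x) (at x)"
proof (rule DERIV_quadratic_error[of "x / 2"])
  \<comment> \<open>Staying within \<open>x / 2\<close> of \<open>x\<close> keeps \<open>y\<close>
    above \<open>x / 2\<close>, which bounds both exponents at once.\<close>
  fix y assume "\<bar>y - x\<bar> < x / 2"
  hence y: "y > x / 2" by linarith
  hence "y > 0" using x by auto
  note int = integrable_bessel_integral_pos[OF \<open>y > 0\<close>] integrable_bessel_integral_pos[OF x] integrable_bessel_integral_pos[of "x / 2"]
  have "\<bar>bessel_integral \<mu> y - bessel_integral \<mu> x - (y - x) * - bessel_integral (\<mu> - 1) x\<bar> =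
    \<bar>LBINT t. (bessel_integrand \<mu> y t - bessel_integrand \<mu> x t + (y - x) * bessel_integrand (\<mu> - 1) x t)\<bar>"
    unfolding bessel_integral_def using int by simp
  also have "\<dots> \<le> (LBINT t. (y - x)\<^sup>2 * bessel_integrand (\<mu> - 2) (x / 2) t)"
  proof (rule integral_abs_bound_integral)
    fix t :: real
    show "\<bar>bessel_integrand \<mu> y t - bessel_integrand \<mu> x t + (y - x) * bessel_integrand (\<mu> - 1) x t\<bar> \<le> (y - x)\<^sup>2 * bessel_integrand (\<mu> - 2) (x / 2) t"
    proof (cases "t > 0")
      case True
      have "\<bar>exp (- (y / t)) - exp (- (x / t)) - (- (y / t) - - (x / t)) * exp (- (x / t))\<bar> \<le>
             (- (y / t) - - (x / t))\<^sup>2 * exp (- (x / 2 / t))"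
        using True x y by (intro exp_first_order_error) (auto simp: field_simps)
      hence "t powr (\<mu> - 1) * exp (- t) * \<bar>exp (- (y / t)) - exp (- (x / t)) - (- (y / t) - - (x / t)) * exp (- (x / t))\<bar> \<le>
            t powr (\<mu> - 1) * exp (- t) * ((- (y / t) - - (x / t))\<^sup>2 * exp (- (x / 2 / t)))"
        by (intro mult_left_mono) auto
      hence "\<bar>t powr (\<mu> - 1) * exp (- t) * (exp (- (y / t)) - exp (- (x / t)) - (- (y / t) - - (x / t)) * exp (- (x / t)))\<bar> \<le>
            t powr (\<mu> - 1) * exp (- t) * ((- (y / t) - - (x / t))\<^sup>2 * exp (- (x / 2 / t)))"
        by (simp add: abs_mult)
      moreover have e: "exp (- t - v / t) = exp (- t) * exp (- (v / t))" for v
        by (simp add: exp_diff exp_minus field_simps)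
      have p: "t powr (\<mu> - 2) = t powr (\<mu> - 1) / t" "t powr (\<mu> - 3) = t powr (\<mu> - 1) / t\<^sup>2"
        using True by (simp_all add: powr_diff field_simps power2_eq_square power3_eq_cube)
      have "t powr (\<mu> - 1) * exp (- t) * (exp (- (y / t)) - exp (- (x / t)) - (- (y / t) - - (x / t)) * exp (- (x / t)))
          = bessel_integrand \<mu> y t - bessel_integrand \<mu> x t + (y - x) * bessel_integrand (\<mu> - 1) x t"
      proof -
        define P E X Y where "P = t powr (\<mu> - 1)" "E = exp (- t)" "X = exp (- (x / t))" "Y = exp (- (y / t))"
        have "P * E * (Y - X - (- (y / t) - - (x / t)) * X) = P * (E * Y) - P * (E * X) + (y - x) * (P / t * (E * X))"
          using True by (simp add: field_simps)
        thus ?thesis using True by (simp add: bessel_integrand_def e p P_E_X_Y_def)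
      qed
      moreover have "t powr (\<mu> - 1) * exp (- t) * ((- (y / t) - - (x / t))\<^sup>2 * exp (- (x / 2 / t))) =
          (y - x)\<^sup>2 * bessel_integrand (\<mu> - 2) (x / 2) t"
      proof -
        have "- (y / t) - - (x / t) = (x - y) / t" by (simp add: diff_divide_distrib)
        moreover have "(x - y)\<^sup>2 = (y - x)\<^sup>2" by (simp add: power2_commute)
        ultimately show ?thesis
          using True e[of "x / 2"] by (simp add: bessel_integrand_def p power_divide)
      qed
      ultimately show ?thesis by simp
    qed (simp add: bessel_integrand_def)
  qed (use int x in auto)
  also have "\<dots> = bessel_integral (\<mu> - 2) (x / 2) * (y - x)\<^sup>2" by (simp add: bessel_integral_def)
  finally show "\<bar>bessel_integral \<mu> y - bessel_integral \<mu> x - (y - x) * - bessel_integral (\<mu> - 1) x\<bar> \<le> bessel_integral (\<mu> - 2) (x / 2) * (y - x)\<^sup>2" .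
qed (use x in auto)

text \<open>The derivative of \<open>t powr (\<mu> - 1) * exp (- t - x / t)\<close> is integrated
  over the half-line; the function vanishes at both ends because \<open>x > 0\<close>. This is the
  three-term recurrence of the Bessel functions.\<close>

lemma bessel_integral_recurrence:
  assumes x: "x > 0"
  shows "x * bessel_integral (\<mu> - 2) x = bessel_integral \<mu> x - (\<mu> - 1) * bessel_integral (\<mu> - 1) x"
proof -
  define h where "h = (\<lambda>t::real. t powr (\<mu> - 1) * exp (- t - x / t))"
  \<comment> \<open>The exponents are left as \<open>\<mu> - 1 - 1\<close> and
    \<open>\<mu> - 2 - 1\<close> so that the summands are visibly integrands of the orders \<mu> -
    1, \<mu> and \<mu> - 2.\<close>
  define h' where "h' = (\<lambda>t::real. (\<mu> - 1) * (t powr (\<mu> - 1 - 1) * exp (- t - x / t)) - t powr (\<mu> - 1) * exp (- t - x / t)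
      + x * (t powr (\<mu> - 2 - 1) * exp (- t - x / t)))"
  have eq: "indicator {0<..} t *\<^sub>R h' t = (\<mu> - 1) * bessel_integrand (\<mu> - 1) x t - bessel_integrand \<mu> x t + x * bessel_integrand (\<mu> - 2) x t" for t
    by (simp add: bessel_integrand_def h'_def algebra_simps)
  note int = integrable_bessel_integral_pos[OF x]
  have "(LBINT t=ereal 0..\<infinity>. h' t) = 0 - 0"
  proof (rule interval_integral_FTC_integrable)
    fix t :: real assume "ereal 0 < ereal t"
    hence t: "t > 0" by simp
    have "(h has_real_derivative (t powr (\<mu> - 1) * (exp (- t - x / t) * (- 1 + x / t\<^sup>2)) + 
            (\<mu> - 1) * t powr (\<mu> - 1 - 1) * exp (- t - x / t))) (at t)"
      unfolding h_def
    proof (rule DERIV_mult')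
      show "((\<lambda>t. t powr (\<mu> - 1)) has_real_derivative (\<mu> - 1) * t powr (\<mu> - 1 - 1)) (at t)"
        by (rule has_real_derivative_powr) fact
      show "((\<lambda>t. exp (- t - x / t)) has_real_derivative exp (- t - x / t) * (- 1 + x / t\<^sup>2)) (at t)"
        using t by (auto intro!: derivative_eq_intros simp: field_simps power2_eq_square)
    qed
    also have "t powr (\<mu> - 1) * (exp (- t - x / t) * (- 1 + x / t\<^sup>2)) + 
            (\<mu> - 1) * t powr (\<mu> - 1 - 1) * exp (- t - x / t) = h' t"
      using t by (simp add: h'_def powr_diff field_simps power2_eq_square power3_eq_cube)
    finally show "(h has_vector_derivative h' t) (at t)"
      by (simp add: has_real_derivative_iff_has_vector_derivative)
    show "isCont h' t" unfolding h'_def using t by (auto intro!: continuous_intros)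
  next
    have "(h \<longlongrightarrow> 0) (at_right 0)" unfolding h_def using x by real_asymp
    thus "((h \<circ> real_of_ereal) \<longlongrightarrow> 0) (at_right (ereal 0))"
      by (simp add: ereal_tendsto_simps)
    have "(h \<longlongrightarrow> 0) at_top" unfolding h_def using x by real_asymp
    thus "((h \<circ> real_of_ereal) \<longlongrightarrow> 0) (at_left \<infinity>)"
      by (simp add: ereal_tendsto_simps)
    show "set_integrable lborel (einterval (ereal 0) \<infinity>) h'"
      unfolding einterval_eq set_integrable_def eq using int by auto
  qed auto
  hence "(LBINT t. (\<mu> - 1) * bessel_integrand (\<mu> - 1) x t - bessel_integrand \<mu> x t + x * bessel_integrand (\<mu> - 2) x t) = 0"
    unfolding interval_integral_to_infinity_eq set_lebesgue_integral_def eq by simp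
  hence "(\<mu> - 1) * bessel_integral (\<mu> - 1) x - bessel_integral \<mu> x + x * bessel_integral (\<mu> - 2) x = 0"
    unfolding bessel_integral_def using int by simp
  thus ?thesis by simp
qed


text \<open>Substituting \<open>r = B * s powr (1 / \<nu>)\<close> gives Euler's integral. The
  nonnegative integral is the form that Tonelli's theorem calls for in
  \<open>nn_integral_bessel_base\<close>.\<close>

lemma integral_exp_powr:
  assumes "\<nu> > 0" "B > 0"
  shows "(\<integral>\<^sup>+s. ennreal (indicator {0<..} s * exp (- (B * s powr (1 / \<nu>)))) \<partial>lborel) = ennreal (\<nu> * Gamma \<nu> * B powr - \<nu>)"
proof -
  define g where "g = (\<lambda>r::real. (r / B) powr \<nu>)"
  define g' where "g' = (\<lambda>r::real. \<nu> * (r / B) powr (\<nu> - 1) / B)"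
  define h where "h = (\<lambda>s::real. exp (- (B * s powr (1 / \<nu>))))"
  have inv: "B * g r powr (1 / \<nu>) = r" if "r > 0" for r
    using that assms by (simp add: g_def powr_powr)
  have "inj_on g {0<..}"
    by (rule inj_onI) (metis inv greaterThan_iff)
  moreover have "(g has_field_derivative g' r) (at r within {0<..})" if "r \<in> {0<..}" for r
  proof -
    have "((\<lambda>r. r / B) has_real_derivative 1 / B) (at r)"
      using assms by (auto intro!: derivative_eq_intros)
    from DERIV_fun_powr[OF this, of \<nu>] that assms
    have "(g has_real_derivative g' r) (at r)" by (simp add: g_def g'_def)
    thus ?thesis by (rule has_field_derivative_at_within)
  qed
  \<comment> \<open>The substitution theorem is an equivalence, so integrability and value are
    established for Euler's integral and carried back.\<close>
  ultimately have "h absolutely_integrable_on g ` {0<..} \<and> integral (g ` {0<..}) h = \<nu> * Gamma \<nu> * B powr - \<nu>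
     \<longleftrightarrow> (\<lambda>r. \<bar>g' r\<bar> * h (g r)) absolutely_integrable_on {0<..} \<and>
         integral {0<..} (\<lambda>r. \<bar>g' r\<bar> * h (g r)) = \<nu> * Gamma \<nu> * B powr - \<nu>"
    by (intro has_absolute_integral_change_of_variables_1'[symmetric]) auto
  moreover have "g ` {0<..} = {0<..}"
  proof (intro equalityI subsetI)
    fix s :: real assume s: "s \<in> {0<..}"
    have "s = g (B * s powr (1 / \<nu>))" using s assms by (simp add: g_def powr_powr)
    moreover have "B * s powr (1 / \<nu>) \<in> {0<..}" using s assms by simp
    ultimately show "s \<in> g ` {0<..}" by blast
  qed (use assms in \<open>auto simp: g_def\<close>)
  moreover have "(\<lambda>r. \<bar>g' r\<bar> * h (g r)) absolutely_integrable_on {0<..} \<and>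
         integral {0<..} (\<lambda>r. \<bar>g' r\<bar> * h (g r)) = \<nu> * Gamma \<nu> * B powr - \<nu>"
  proof -
    have "has_bochner_integral lborel (\<lambda>r. (\<nu> * B powr - \<nu>) * (indicator {0<..} r * (r powr (\<nu> - 1) * exp (- (1 * r))))) ((\<nu> * B powr - \<nu>) * (Gamma \<nu> * 1 powr - \<nu>))"
      using assms by (intro has_bochner_integral_mult_right has_bochner_integral_Gamma) auto
    moreover have "(\<nu> * B powr - \<nu>) * (indicator {0<..} r * (r powr (\<nu> - 1) * exp (- (1 * r)))) = indicator {0<..} r *\<^sub>R (\<bar>g' r\<bar> * h (g r))" for r
    proof (cases "r > 0")
      case True
      have "\<bar>g' r\<bar> = \<nu> * B powr - \<nu> * r powr (\<nu> - 1)"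
        using assms True by (simp add: g'_def abs_mult powr_divide powr_diff powr_minus field_simps)
      thus ?thesis using True by (simp add: h_def inv)
    qed auto
    ultimately have *: "has_bochner_integral lborel (\<lambda>r. indicator {0<..} r *\<^sub>R (\<bar>g' r\<bar> * h (g r))) (\<nu> * Gamma \<nu> * B powr - \<nu>)"
      using assms by (simp only:) (simp add: mult_ac)
    hence si: "set_integrable lborel {0<..} (\<lambda>r. \<bar>g' r\<bar> * h (g r))"
      by (auto simp: set_integrable_def has_bochner_integral_iff)
    have "integral {0<..} (\<lambda>r. \<bar>g' r\<bar> * h (g r)) = \<nu> * Gamma \<nu> * B powr - \<nu>"
      using * set_borel_integral_eq_integral(2)[OF si] 
      by (simp add: set_lebesgue_integral_def has_bochner_integral_iff)
    moreover have "(\<lambda>r. \<bar>g' r\<bar> * h (g r)) absolutely_integrable_on {0<..}"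
      using si unfolding set_integrable_def by (subst integrable_completion) (auto dest: borel_measurable_integrable)
    ultimately show ?thesis by blast
  qed
  ultimately have "h absolutely_integrable_on {0<..}" "integral {0<..} h = \<nu> * Gamma \<nu> * B powr - \<nu>" by auto
  hence "(h has_integral \<nu> * Gamma \<nu> * B powr - \<nu>) {0<..}"
    by (metis absolutely_integrable_on_def set_lebesgue_integral_eq_integral(1) has_integral_integral)
  from nn_integral_has_integral_lebesgue[OF _ this]
  show ?thesis by (simp add: h_def)
qed

text \<open>This is the characteristic function of the standard normal law, rescaled.\<close>

lemma integral_gaussian_cos:
  assumes "y > 0"
  shows "has_bochner_integral lborel (\<lambda>t. cos t * exp (- (y * t\<^sup>2))) (sqrt (pi / y) * exp (- 1 / (4 * y)))"
proof -
  \<comment> \<open>With this \<open>s\<close> the substitution \<open>x = t / s\<close> turns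
    \<open>exp (- x\<^sup>2 / 2)\<close> into \<open>exp (- (y * t\<^sup>2))\<close> and
    \<open>cos (s * x)\<close> into \<open>cos t\<close>.\<close>
  define s where "s = 1 / sqrt (2 * y)"
  have s: "s > 0" "s\<^sup>2 = 1 / (2 * y)" using assms by (auto simp: s_def power_divide)
  interpret N: real_distribution std_normal_distribution by (rule real_dist_normal_dist)
  have int: "integrable std_normal_distribution (\<lambda>x. iexp (s * x))" by (rule N.integrable_iexp) auto
  have "Re (char std_normal_distribution s) = (LINT x|std_normal_distribution. Re (iexp (s * x)))"
    unfolding char_def using int by (rule integral_Re[symmetric])
  also have "\<dots> = (LINT x|std_normal_distribution. cos (s * x))"
    by (simp add: Re_exp)
  also have "\<dots> = (LBINT x. std_normal_density x * cos (s * x))"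
    by (subst integral_density) (auto simp: normal_density_nonneg)
  finally have 1: "(LBINT x. std_normal_density x * cos (s * x)) = exp (- (s\<^sup>2) / 2)"
    by (simp add: char_std_normal_distribution)
  have "integrable std_normal_distribution (\<lambda>x. cos (s * x))"
    by (rule N.integrable_const_bound[of _ 1]) auto
  hence 2: "integrable lborel (\<lambda>x. std_normal_density x * cos (s * x))"
    by (subst (asm) integrable_density) (auto simp: normal_density_nonneg)
  have "has_bochner_integral lborel (\<lambda>x. std_normal_density x * cos (s * x)) (exp (- (s\<^sup>2) / 2))"
    using 1 2 by (simp add: has_bochner_integral_iff)
  hence "has_bochner_integral lborel (\<lambda>t. std_normal_density (0 + (1 / s) * t) * cos (s * (0 + (1 / s) * t))) (exp (- (s\<^sup>2) / 2) /\<^sub>R \<bar>1 / s\<bar>)"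
    using s by (subst (asm) lborel_has_bochner_integral_real_affine_iff[of "1 / s" _ _ 0]) auto
  hence "has_bochner_integral lborel (\<lambda>t. sqrt (2 * pi) * (std_normal_density (0 + (1 / s) * t) * cos (s * (0 + (1 / s) * t)))) (sqrt (2 * pi) * (exp (- (s\<^sup>2) / 2) /\<^sub>R \<bar>1 / s\<bar>))"
    by (intro has_bochner_integral_mult_right)
  moreover have "sqrt (2 * pi) * (std_normal_density (0 + (1 / s) * t) * cos (s * (0 + (1 / s) * t))) = cos t * exp (- (y * t\<^sup>2))" for t
    using s assms by (simp add: normal_density_def power_divide)
  moreover have "sqrt (2 * pi) * (exp (- (s\<^sup>2) / 2) /\<^sub>R \<bar>1 / s\<bar>) = sqrt (pi / y) * exp (- 1 / (4 * y))"
  proof -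
    have "sqrt (2 * pi) * s = sqrt (pi / y)" by (simp add: s_def real_sqrt_divide real_sqrt_mult)
    thus ?thesis using s by (simp add: mult_ac)
  qed
  ultimately show ?thesis by (simp only:)
qed

text \<open>The power is written as a Gamma integral in \<open>r\<close> with rate
  \<open>1 + t\<^sup>2 / z\<^sup>2\<close>. After exchanging the integrals, the one over
  \<open>t\<close> is Gaussian and contributes \<open>r powr - (1 / 2)\<close>, which shifts the
  order by one half.\<close>

lemma integral_cos_resolvent:
  assumes \<mu>: "\<mu> \<ge> 1" and z: "z > 0"
  shows "integrable lborel (\<lambda>t. cos t * (1 + t\<^sup>2 / z\<^sup>2) powr - \<mu>)"
    and "Gamma \<mu> * (LBINT t. cos t * (1 + t\<^sup>2 / z\<^sup>2) powr - \<mu>) = sqrt pi * z * bessel_integral (\<mu> - 1 / 2) (z\<^sup>2 / 4)"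
proof -
  define F where "F = (\<lambda>(t, r). indicator {0<..} r * (r powr (\<mu> - 1) * exp (- ((1 + t\<^sup>2 / z\<^sup>2) * r))) * cos t)"
  have F_meas [measurable]: "F \<in> borel_measurable (lborel \<Otimes>\<^sub>M lborel)"
    unfolding F_def by measurable
  have pos: "1 + t\<^sup>2 / z\<^sup>2 > 0" for t by (intro add_pos_nonneg) auto
  have inner: "has_bochner_integral lborel (\<lambda>r. F (t, r)) (Gamma \<mu> * (1 + t\<^sup>2 / z\<^sup>2) powr - \<mu> * cos t)" for t
    unfolding F_def prod.case using \<mu> pos
    by (intro has_bochner_integral_mult_left has_bochner_integral_Gamma) auto
  have innern: "has_bochner_integral lborel (\<lambda>r. norm (F (t, r))) (Gamma \<mu> * (1 + t\<^sup>2 / z\<^sup>2) powr - \<mu> * \<bar>cos t\<bar>)" for t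
  proof -
    have "norm (F (t, r)) = indicator {0<..} r * (r powr (\<mu> - 1) * exp (- ((1 + t\<^sup>2 / z\<^sup>2) * r))) * \<bar>cos t\<bar>" for r
      by (simp add: F_def abs_mult)
    thus ?thesis using \<mu> pos
      by (simp only:) (intro has_bochner_integral_mult_left has_bochner_integral_Gamma, auto)
  qed
  \<comment> \<open>Because \<mu> \<ge> 1, a multiple of a Cauchy density dominates, which gives the
    absolute integrability that Fubini's theorem requires.\<close>
  have dom: "integrable lborel (\<lambda>t. inverse (1 + (0 + (1 / z) * t)\<^sup>2))"
    using integrable_inverse_1_plus_square z
    by (intro lborel_integrable_real_affine) (auto simp: set_integrable_def)
  have bnd: "(1 + t\<^sup>2 / z\<^sup>2) powr - \<mu> \<le> inverse (1 + (0 + (1 / z) * t)\<^sup>2)" for t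
  proof -
    have "(1 + t\<^sup>2 / z\<^sup>2) powr - \<mu> \<le> (1 + t\<^sup>2 / z\<^sup>2) powr - 1"
      using \<mu> by (intro powr_mono) auto
    thus ?thesis using pos[of t] by (simp add: powr_minus power_divide)
  qed
  have bnd': "norm ((1 + t\<^sup>2 / z\<^sup>2) powr - \<mu> * c) \<le> norm (inverse (1 + (0 + (1 / z) * t)\<^sup>2))" if "\<bar>c\<bar> \<le> 1" for t c
  proof -
    have "norm ((1 + t\<^sup>2 / z\<^sup>2) powr - \<mu> * c) \<le> (1 + t\<^sup>2 / z\<^sup>2) powr - \<mu> * 1"
      using that by (simp only: real_norm_def abs_mult) (intro mult_mono, auto)
    also note bnd
    also have "inverse (1 + (0 + 1 / z * t)\<^sup>2) \<le> norm (inverse (1 + (0 + (1 / z) * t)\<^sup>2))" by simp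
    finally show ?thesis by simp
  qed
  have i1: "integrable lborel (\<lambda>t. (1 + t\<^sup>2 / z\<^sup>2) powr - \<mu> * cos t)"
    by (rule Bochner_Integration.integrable_bound[OF dom _ AE_I2[OF bnd']]) auto
  have i2: "integrable lborel (\<lambda>t. (1 + t\<^sup>2 / z\<^sup>2) powr - \<mu> * \<bar>cos t\<bar>)"
    by (rule Bochner_Integration.integrable_bound[OF dom _ AE_I2[OF bnd']]) auto
  show "integrable lborel (\<lambda>t. cos t * (1 + t\<^sup>2 / z\<^sup>2) powr - \<mu>)"
    using i1 by (simp add: mult.commute)
  have "integrable (lborel \<Otimes>\<^sub>M lborel) F"
  proof (rule lborel_pair.Fubini_integrable)
    show "integrable lborel (\<lambda>t. LBINT r. norm (F (t, r)))"
      using i2 innern by (simp add: has_bochner_integral_iff mult.assoc)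
    show "AE t in lborel. integrable lborel (\<lambda>r. F (t, r))"
      using inner by (simp add: has_bochner_integral_iff)
  qed simp
  hence "(LBINT r. LBINT t. F (t, r)) = (LBINT t. LBINT r. F (t, r))"
    using lborel_pair.Fubini_integral[of "\<lambda>t r. F (t, r)"] by simp
  also have "\<dots> = Gamma \<mu> * (LBINT t. cos t * (1 + t\<^sup>2 / z\<^sup>2) powr - \<mu>)"
    using inner by (simp add: has_bochner_integral_iff mult_ac)
  \<comment> \<open>The inner integral is \<open>integral_gaussian_cos\<close> with
    \<open>y = r / z\<^sup>2\<close>.\<close>
  also have "(LBINT r. LBINT t. F (t, r)) = (LBINT r. sqrt pi * z * bessel_integrand (\<mu> - 1 / 2) (z\<^sup>2 / 4) r)"
  proof (rule Bochner_Integration.integral_cong)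
    fix r :: real
    show "(LBINT t. F (t, r)) = sqrt pi * z * bessel_integrand (\<mu> - 1 / 2) (z\<^sup>2 / 4) r"
    proof (cases "r > 0")
      case True
      have "F (t, r) = (r powr (\<mu> - 1) * exp (- r)) * (cos t * exp (- ((r / z\<^sup>2) * t\<^sup>2)))" for t
        using True by (simp add: F_def ring_distribs exp_add[symmetric] mult_ac exp_diff exp_minus divide_inverse)
      hence "(LBINT t. F (t, r)) = (r powr (\<mu> - 1) * exp (- r)) * (sqrt (pi / (r / z\<^sup>2)) * exp (- 1 / (4 * (r / z\<^sup>2))))"
        using integral_gaussian_cos[of "r / z\<^sup>2"] True z by (simp add: has_bochner_integral_iff)
      also have "sqrt (pi / (r / z\<^sup>2)) = sqrt pi * z * r powr (- (1 / 2))"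
      proof -
        have "pi / (r / z\<^sup>2) = pi * z\<^sup>2 * inverse r" using True z by (simp add: field_simps)
        hence "sqrt (pi / (r / z\<^sup>2)) = sqrt pi * z * inverse (sqrt r)"
          using z by (simp add: real_sqrt_mult real_sqrt_inverse)
        thus ?thesis using True by (simp add: powr_minus powr_half_sqrt)
      qed
      also have "r powr (\<mu> - 1) * exp (- r) * (sqrt pi * z * r powr - (1 / 2) * exp (- 1 / (4 * (r / z\<^sup>2)))) =
          sqrt pi * z * (r powr (\<mu> - 1 + - (1 / 2)) * (exp (- r) * exp (- 1 / (4 * (r / z\<^sup>2)))))"
        by (simp only: powr_add mult_ac)
      also have "exp (- r) * exp (- 1 / (4 * (r / z\<^sup>2))) = exp (- r - z\<^sup>2 / 4 / r)"
        using True z by (simp add: exp_add[symmetric])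
      finally show ?thesis using True by (simp add: bessel_integrand_def algebra_simps)
    qed (simp add: F_def bessel_integrand_def)
  qed simp
  also have "\<dots> = sqrt pi * z * bessel_integral (\<mu> - 1 / 2) (z\<^sup>2 / 4)" by (simp add: bessel_integral_def)
  finally show "Gamma \<mu> * (LBINT t. cos t * (1 + t\<^sup>2 / z\<^sup>2) powr - \<mu>) = sqrt pi * z * bessel_integral (\<mu> - 1 / 2) (z\<^sup>2 / 4)"
    by simp
qed

text \<open>Factoring \<open>z powr (- 2 * \<mu>)\<close> out of Basset's integrand leaves an even
  function, whose integral over the half-line is half of the one just computed. The bound on \<nu>
  holds for \<nu> = 1 / (2 - \<alpha>), with equality at \<alpha> = 0.\<close>

lemma BesselK_eq_bessel_integral:
  assumes \<nu>: "\<nu> \<ge> 1 / 2" and z: "z > 0"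
  shows "BesselK \<nu> z = (z / 2) powr - \<nu> * bessel_integral \<nu> (z\<^sup>2 / 4) / 2"
proof -
  define \<mu> where "\<mu> = \<nu> + 1 / 2"
  have \<mu>: "\<mu> \<ge> 1" using \<nu> by (simp add: \<mu>_def)
  define g where "g = (\<lambda>t. cos t * (1 + t\<^sup>2 / z\<^sup>2) powr - \<mu>)"
  note g = integral_cos_resolvent[OF \<mu> z, folded g_def]
  have eq: "cos t / (t\<^sup>2 + z\<^sup>2) powr \<mu> = z powr (- 2 * \<mu>) * g t" for t
  proof -
    have "t\<^sup>2 + z\<^sup>2 = z\<^sup>2 * (1 + t\<^sup>2 / z\<^sup>2)" using z by (simp add: field_simps)
    hence "(t\<^sup>2 + z\<^sup>2) powr \<mu> = (z\<^sup>2) powr \<mu> * (1 + t\<^sup>2 / z\<^sup>2) powr \<mu>"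
      by (simp add: powr_mult)
    also have "(z\<^sup>2) powr \<mu> = z powr (2 * \<mu>)" using z by (simp add: powr_powr flip: powr_numeral)
    finally show ?thesis by (simp add: g_def powr_minus field_simps)
  qed
  have "set_integrable lborel {0..} g"
    unfolding set_integrable_def using g(1) by (intro integrable_mult_indicator) auto
  from set_borel_integral_eq_integral(2)[OF this] even_integral[OF g(1)]
  have "2 * integral {0..} g = (LBINT t. g t)" by (simp add: g_def)
  with g(2) have "Gamma \<mu> * (2 * integral {0..} g) = sqrt pi * z * bessel_integral (\<mu> - 1 / 2) (z\<^sup>2 / 4)"
    by simp
  hence G: "Gamma \<mu> * integral {0..} g = sqrt pi * z * bessel_integral \<nu> (z\<^sup>2 / 4) / 2" 
    by (simp add: \<mu>_def)
  have "BesselK \<nu> z = (2 * z) powr \<nu> / sqrt pi * z powr (- 2 * \<mu>) * (Gamma \<mu> * integral {0..} g)"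
    unfolding BesselK_def \<mu>_def[symmetric] eq by (simp add: mult_ac)
  also have "\<dots> = (2 powr \<nu> * (z powr \<nu> * z powr (- 2 * \<mu>) * z powr 1)) * bessel_integral \<nu> (z\<^sup>2 / 4) / 2"
    unfolding G using z by (simp add: powr_mult)
  also have "z powr \<nu> * z powr (- 2 * \<mu>) * z powr 1 = z powr - \<nu>"
    by (simp only: powr_add[symmetric]) (simp add: \<mu>_def)
  also have "2 powr \<nu> * z powr - \<nu> = (z / 2) powr - \<nu>"
    using z by (simp add: powr_divide powr_minus field_simps)
  finally show ?thesis .
qed

section \<open>Half-line solutions and the maximum principle\<close>

text \<open>A value below \<open>m\<close> forces an interior global minimum, since the limit and
  the boundary value are at least \<open>m\<close>. By \<open>step\<close> the minimum recurs along
  \<open>\<theta> ^ n * s\<close>, so its value equals the limit \<open>L\<close>, which is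
  impossible.\<close>

lemma advanced_minimum_principle:
  fixes u :: "real \<Rightarrow> real"
  assumes cont: "continuous_on {0..} u" and lim: "(u \<longlongrightarrow> L) at_top"
    and bd: "m \<le> L" "m \<le> u 0" and \<theta>: "\<theta> > 1"
    and step: "\<And>s. s > 0 \<Longrightarrow> (\<And>y. y \<ge> 0 \<Longrightarrow> u s \<le> u y) \<Longrightarrow> u s < m \<Longrightarrow> u (\<theta> * s) \<le> u s"
    and "x \<ge> 0"
  shows "m \<le> u x"
proof (rule ccontr)
  assume "\<not> m \<le> u x"
  hence less: "u x < m" by simp
  have "eventually (\<lambda>y. u y > u x) at_top"
    using lim bd(1) less by (intro order_tendstoD(1)[of u L]) auto
  then obtain R where R: "\<And>y. y \<ge> R \<Longrightarrow> u y > u x"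
    by (auto simp: eventually_at_top_linorder)
  \<comment> \<open>Beyond \<open>R'\<close> the function exceeds \<open>u x\<close>, and
    \<open>x\<close> lies in the compact interval, so the minimum found there is global.\<close>
  define R' where "R' = max R x"
  have "continuous_on {0..R'} u" using cont by (rule continuous_on_subset) auto
  moreover have "{0..R'} \<noteq> {}" using \<open>x \<ge> 0\<close> by (auto simp: R'_def)
  ultimately obtain s where s: "s \<in> {0..R'}" "\<And>y. y \<in> {0..R'} \<Longrightarrow> u s \<le> u y"
    using continuous_attains_inf[of "{0..R'}" u] by auto
  have sx: "u s \<le> u x" using s(2)[of x] \<open>x \<ge> 0\<close> by (auto simp: R'_def)
  have glob: "u s \<le> u y" if "y \<ge> 0" for y
  proof (cases "y \<le> R'")
    case False
    with R[of y] sx show ?thesis by (simp add: R'_def not_le)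
  qed (use s(2)[of y] that in auto)
  have "s \<noteq> 0" using sx less bd by auto
  hence "s > 0" using s(1) by auto
  have iter: "u (\<theta> ^ n * s) = u s" for n
  proof (induction n)
    case (Suc n)
    have pos: "\<theta> ^ n * s > 0" using \<open>s > 0\<close> \<theta> by simp
    have "u (\<theta> * (\<theta> ^ n * s)) \<le> u (\<theta> ^ n * s)"
      by (rule step[OF pos]) (use Suc glob sx less in auto)
    moreover have "u s \<le> u (\<theta> * (\<theta> ^ n * s))" using pos \<theta> by (intro glob) auto
    ultimately show ?case using Suc by (simp add: mult.assoc)
  qed simp
  have "filterlim (\<lambda>n. \<theta> ^ n * s) at_top sequentially"
    using \<theta> \<open>s > 0\<close> by real_asymp
  from filterlim_compose[OF lim this] have "(\<lambda>n. u s) \<longlonglongrightarrow> L" by (simp add: iter)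
  hence "u s = L" by (simp add: tendsto_const_iff LIMSEQ_const_iff)
  with sx less bd show False by simp
qed

section \<open>Tails of integrals and behaviour at infinity\<close>

definition tail :: "(real \<Rightarrow> real) \<Rightarrow> real \<Rightarrow> real" where
  "tail g s = (LBINT y:{s..}. g y)"

text \<open>Trades the tail for an indefinite integral from \<open>a\<close>, to which the
  fundamental theorem of calculus applies.\<close>

lemma tail_eq:
  fixes g :: "real \<Rightarrow> real"
  assumes g: "set_integrable lborel {a..} g" and "a \<le> s"
  shows "tail g s = tail g a - integral {a..s} g"
proof -
  have *: "set_integrable lborel {a..s} g" "set_integrable lborel {s..} g"
    by (rule set_integrable_subset[OF g]; use \<open>a \<le> s\<close> in auto)+
  have "AE y in lborel. \<not> (y \<in> {a..s} \<and> y \<in> {s..})"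
    using AE_lborel_singleton[of s] by eventually_elim auto
  from set_integral_Un_AE[OF this _ _ *]
  have "(LBINT y:{a..s} \<union> {s..}. g y) = (LBINT y:{a..s}. g y) + tail g s"
    by (simp add: tail_def)
  moreover have "{a..s} \<union> {s..} = {a..}" using \<open>a \<le> s\<close> by auto
  ultimately show ?thesis
    using set_borel_integral_eq_integral(2)[OF *(1)] by (simp add: tail_def)
qed

lemma continuous_on_tail:
  fixes g :: "real \<Rightarrow> real"
  assumes g: "set_integrable lborel {a..} g"
  shows "continuous_on {a..} (tail g)"
proof -
  have "continuous (at s within {a..}) (tail g)" if "s \<ge> a" for s
  proof -
    have "set_integrable lborel {a..s+1} g" by (rule set_integrable_subset[OF g]) auto
    hence "g integrable_on {a..s+1}" by (rule set_borel_integral_eq_integral)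
    hence "continuous_on {a..s+1} (\<lambda>x. tail g a - integral {a..x} g)"
      by (intro continuous_intros indefinite_integral_continuous_1)
    hence "continuous_on {a..s+1} (tail g)"
      by (rule continuous_on_eq) (rule tail_eq[OF g, symmetric], simp)
    hence "continuous (at s within {a..s+1}) (tail g)"
      using that by (auto simp: continuous_on_eq_continuous_within)
    moreover have "at s within {a..s+1} = at s within {a..}"
      by (rule at_within_nhd[of _ "{..<s+1}"]) (use that in auto)
    ultimately show ?thesis by simp
  qed
  thus ?thesis by (auto simp: continuous_on_eq_continuous_within)
qed

lemma tail_tendsto_0:
  fixes g :: "real \<Rightarrow> real"
  assumes g: "set_integrable lborel {a..} g"
  shows "(tail g \<longlongrightarrow> 0) at_top"
proof -
  have "((\<lambda>s. LBINT x. indicator {..s} x *\<^sub>R (indicator {a..} x *\<^sub>R g x)) \<longlongrightarrow> 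
          (LBINT x. indicator {a..} x *\<^sub>R g x)) at_top"
    using g by (intro tendsto_integral_at_top) (auto simp: set_integrable_def)
  hence lim: "((\<lambda>s. tail g a - (LBINT x. indicator {..s} x *\<^sub>R (indicator {a..} x *\<^sub>R g x))) \<longlongrightarrow> 
          tail g a - tail g a) at_top"
    by (intro tendsto_intros) (auto simp: tail_def set_lebesgue_integral_def)
  have "eventually (\<lambda>s. tail g a - (LBINT x. indicator {..s} x *\<^sub>R (indicator {a..} x *\<^sub>R g x)) = tail g s) at_top"
    using eventually_ge_at_top[of a]
  proof eventually_elim
    case (elim s)
    have "set_integrable lborel {a..s} g" by (rule set_integrable_subset[OF g]) auto
    from set_borel_integral_eq_integral(2)[OF this]
    have "integral {a..s} g = (LBINT x. indicator {..s} x *\<^sub>R (indicator {a..} x *\<^sub>R g x))"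
      unfolding set_lebesgue_integral_def
      by (subst (asm) eq_commute) (auto intro!: Bochner_Integration.integral_cong simp: indicator_def)
    thus ?case by (simp add: tail_eq[OF g elim])
  qed
  from Lim_transform_eventually[OF lim this] show ?thesis by simp
qed

lemma has_real_derivative_tail:
  fixes g :: "real \<Rightarrow> real"
  assumes g: "set_integrable lborel {a..} g" and cont: "continuous_on {a..} g" and "s > a"
  shows "(tail g has_real_derivative - g s) (at s)"
proof -
  have "((\<lambda>x. integral {a..x} g) has_real_derivative g s) (at s within {a..s+1})"
    by (rule integral_has_real_derivative) (use \<open>s > a\<close> in \<open>auto intro: continuous_on_subset[OF cont]\<close>)
  hence "((\<lambda>x. tail g a - integral {a..x} g) has_real_derivative - g s) (at s within {a..s+1})"
    by (auto intro!: derivative_eq_intros)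
  hence "(tail g has_real_derivative - g s) (at s within {a..s+1})"
    by (rule has_field_derivative_transform_within[where d = 1])
       (use \<open>s > a\<close> in \<open>auto intro!: tail_eq[OF g, symmetric]\<close>)
  moreover have "at s within {a..s+1} = at s"
    by (rule at_within_interior) (use \<open>s > a\<close> in auto)
  ultimately show ?thesis by simp
qed

text \<open>Taylor expansion at \<open>s\<close> with increments 1 and 2: eliminating
  \<open>F' s\<close> gives \<open>F (s + 2) - 2 * F (s + 1) + F s = 2 * F'' (\<eta> s) - F'' (\<xi>
  s)\<close>, where the left side tends to 0 and the right side to \<open>k\<close>. It will be used
  with \<open>F\<close> the tail of a solution.\<close>

lemma second_derivative_limit_zero:
  fixes F F' F'' :: "real \<Rightarrow> real"
  assumes F: "(F \<longlongrightarrow> 0) at_top" and F'': "(F'' \<longlongrightarrow> k) at_top"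
    and d1: "\<And>s. s > 0 \<Longrightarrow> (F has_real_derivative F' s) (at s)"
    and d2: "\<And>s. s > 0 \<Longrightarrow> (F' has_real_derivative F'' s) (at s)"
  shows "k = 0" and "(F' \<longlongrightarrow> 0) at_top"
proof -
  have taylor: "\<exists>\<xi>. s < \<xi> \<and> \<xi> < s + h \<and> F (s + h) = F s + F' s * h + F'' \<xi> / 2 * h\<^sup>2"
    if "s > 0" "h > 0" for s h
  proof -
    define diff where "diff = (\<lambda>m::nat. if m = 0 then F else if m = 1 then F' else F'')"
    have "\<exists>t. s < t \<and> t < s + h \<and> F (s + h) = (\<Sum>m<2. diff m s / fact m * (s + h - s) ^ m) + 
            diff 2 t / fact 2 * (s + h - s) ^ 2"
    proof (rule Taylor_up[of 2 diff F s "s + h" s])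
      show "\<forall>m t. m < 2 \<and> s \<le> t \<and> t \<le> s + h \<longrightarrow> (diff m has_real_derivative diff (Suc m) t) (at t)"
        using d1 d2 that by (auto simp: diff_def less_2_cases_iff)
    qed (use that in \<open>auto simp: diff_def\<close>)
    thus ?thesis by (auto simp: diff_def numeral_2_eq_2)
  qed
  have "\<exists>\<xi>. \<forall>s>0. s < \<xi> s \<and> \<xi> s < s + h \<and> F (s + h) = F s + F' s * h + F'' (\<xi> s) / 2 * h\<^sup>2" if "h > 0" for h
    using taylor[OF _ that] by (intro choice allI) blast
  note ex = this
  obtain \<xi> where \<xi>: "\<And>s. s > 0 \<Longrightarrow> s < \<xi> s \<and> F (s + 1) = F s + F' s + F'' (\<xi> s) / 2"
    using ex[of 1] by auto
  obtain \<eta> where \<eta>: "\<And>s. s > 0 \<Longrightarrow> s < \<eta> s \<and> F (s + 2) = F s + F' s * 2 + F'' (\<eta> s) * 2"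
    using ex[of 2] by (auto simp: mult.commute)
  have top: "filterlim \<xi> at_top at_top" "filterlim \<eta> at_top at_top"
    by (rule filterlim_at_top_mono[OF filterlim_ident], 
        use eventually_gt_at_top[of 0] in eventually_elim, use \<xi> \<eta> in force)+
  have shift: "((\<lambda>s. F (s + h)) \<longlongrightarrow> 0) at_top" for h
    by (rule filterlim_compose[OF F]) real_asymp
  have lim: "((\<lambda>s. F'' (\<xi> s)) \<longlongrightarrow> k) at_top" "((\<lambda>s. F'' (\<eta> s)) \<longlongrightarrow> k) at_top"
    using top by (auto intro: filterlim_compose[OF F''])
  have "((\<lambda>s. 2 * F'' (\<eta> s) - F'' (\<xi> s)) \<longlongrightarrow> 2 * k - k) at_top"
    by (intro tendsto_intros lim)
  moreover have "((\<lambda>s. F (s + 2) - 2 * F (s + 1) + F s) \<longlongrightarrow> 0 - 2 * 0 + 0) at_top"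
    by (intro tendsto_intros shift F)
  hence "((\<lambda>s. 2 * F'' (\<eta> s) - F'' (\<xi> s)) \<longlongrightarrow> 0 - 2 * 0 + 0) at_top"
    by (rule Lim_transform_eventually) 
       (use eventually_gt_at_top[of 0] in eventually_elim, use \<xi> \<eta> in force)
  ultimately show k: "k = 0" using tendsto_unique[of "at_top :: real filter"] by force
  \<comment> \<open>The expansion with increment 1 now determines the limit of
    \<open>F'\<close>.\<close>
  have "((\<lambda>s. F (s + 1) - F s - F'' (\<xi> s) / 2) \<longlongrightarrow> 0 - 0 - k / 2) at_top"
    by (intro tendsto_intros shift F lim) auto
  hence "(F' \<longlongrightarrow> 0 - 0 - k / 2) at_top"
    by (rule Lim_transform_eventually) 
       (use eventually_gt_at_top[of 0] in eventually_elim, use \<xi> in force)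
  thus "(F' \<longlongrightarrow> 0) at_top" by (simp add: k)
qed

text \<open>Away from 0 the weight is bounded; near 0, reached only if \<alpha> < 1,
  \<open>f\<close> is bounded and the power is integrable.\<close>

lemma set_integrable_powr_weight:
  fixes f :: "real \<Rightarrow> real"
  assumes int: "set_integrable lborel {0..} f" and cont: "continuous_on {0..} f"
    and \<alpha>: "\<alpha> \<ge> 0" and a: "a > 0 \<or> a = 0 \<and> \<alpha> < 1"
  shows "set_integrable lborel {a..} (\<lambda>y. y powr - \<alpha> * f y)"
proof -
  define w where "w = (\<lambda>y. y powr - \<alpha> * f y)"
  \<comment> \<open>Continuity of \<open>f\<close> is given on the half-line only, so measurability
    is obtained after multiplication by an indicator.\<close>
  have meas: "(\<lambda>y. indicator S y *\<^sub>R w y) \<in> borel_measurable lborel" if "S \<in> sets borel" "S \<subseteq> {0..}" for S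
  proof -
    have [measurable]: "(\<lambda>y. indicator {0..} y *\<^sub>R f y) \<in> borel_measurable borel"
      by (rule borel_measurable_continuous_on_indicator[OF _ cont]) auto
    have [measurable]: "S \<in> sets borel" by fact
    have "(\<lambda>y. indicator S y * (y powr - \<alpha> * (indicator {0..} y *\<^sub>R f y))) \<in> borel_measurable lborel"
      by measurable
    also have "(\<lambda>y. indicator S y * (y powr - \<alpha> * (indicator {0..} y *\<^sub>R f y))) = (\<lambda>y. indicator S y *\<^sub>R w y)"
      using that(2) by (auto simp: fun_eq_iff w_def indicator_def)
    finally show ?thesis .
  qed
  have pos: "set_integrable lborel {b..} w" if "b > 0" for b
  proof -
    have f: "set_integrable lborel {b..} f"
      by (rule set_integrable_subset[OF int]) (use that in auto)
    have "integrable lborel (\<lambda>y. b powr - \<alpha> * (indicator {b..} y *\<^sub>R f y))"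
      using f by (auto simp: set_integrable_def)
    hence "integrable lborel (\<lambda>y. indicator {b..} y *\<^sub>R w y)"
    proof (rule Bochner_Integration.integrable_bound)
      have "y powr - \<alpha> \<le> b powr - \<alpha>" if "y \<ge> b" for y
        using that \<open>b > 0\<close> \<alpha> by (intro powr_mono2') auto
      thus "AE y in lborel. norm (indicator {b..} y *\<^sub>R w y) \<le> norm (b powr - \<alpha> * (indicator {b..} y *\<^sub>R f y))"
        by (auto simp: w_def indicator_def abs_mult intro!: mult_right_mono)
    qed (use that in \<open>intro meas; auto\<close>)
    thus ?thesis by (simp add: set_integrable_def)
  qed
  show ?thesis
  proof (cases "a > 0")
    case True
    thus ?thesis using pos by (simp add: w_def)
  next
    case False
    with a have "a = 0" "\<alpha> < 1" by auto
    have "compact (f ` {0..1})"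
      by (intro compact_continuous_image continuous_on_subset[OF cont]) auto
    then obtain B where B: "\<And>y. y \<in> {0..1} \<Longrightarrow> \<bar>f y\<bar> \<le> B"
      using compact_imp_bounded bounded_real by (metis imageI)
    have "(\<lambda>y::real. y powr - \<alpha>) absolutely_integrable_on {0..1}"
      using integrable_on_powr_from_0[of "-\<alpha>" 1] \<open>\<alpha> < 1\<close>
      by (intro nonnegative_absolutely_integrable_1) auto
    hence "integrable lebesgue (\<lambda>y. indicator {0..1} y *\<^sub>R (y::real) powr - \<alpha>)"
      by (simp add: set_integrable_def)
    hence "integrable lborel (\<lambda>y. indicator {0..1} y *\<^sub>R (y::real) powr - \<alpha>)"
      by (subst (asm) integrable_completion) auto
    hence "integrable lborel (\<lambda>y. B * (indicator {0..1} y *\<^sub>R (y::real) powr - \<alpha>))"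
      by auto
    hence "integrable lborel (\<lambda>y. indicator {0..1} y *\<^sub>R w y)"
    proof (rule Bochner_Integration.integrable_bound)
      show "AE y in lborel. norm (indicator {0..1} y *\<^sub>R w y) \<le> norm (B * (indicator {0..1} y *\<^sub>R y powr - \<alpha>))"
      proof (intro AE_I2)
        fix y :: real
        show "norm (indicator {0..1} y *\<^sub>R w y) \<le> norm (B * (indicator {0..1} y *\<^sub>R y powr - \<alpha>))"
          using B[of y] by (auto simp: w_def indicator_def abs_mult mult.commute intro!: mult_right_mono)
      qed
    qed (intro meas, auto)
    hence "set_integrable lborel {0..1} w" by (simp add: set_integrable_def)
    from set_integrable_Un[OF this pos[of 1]]
    have "set_integrable lborel ({0..1} \<union> {1..}) w" by simp
    moreover have "{0..1::real} \<union> {1..} = {0..}" by auto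
    ultimately show ?thesis using \<open>a = 0\<close> by (simp add: w_def)
  qed
qed

text \<open>The equation on one half-line, with \<open>K = 2 * l / \<sigma>\<^sup>2\<close>; the
  factor \<open>\<theta> powr (1 - \<alpha>)\<close> collects the \<theta> in front of the nonlocal
  term and the one inside its intensity. No sign is assumed, so that differences and negatives of
  solutions qualify.\<close>

locale halfline_solution =
  fixes K \<theta> \<alpha> :: real and f f' :: "real \<Rightarrow> real"
  assumes K: "K > 0" and \<theta>: "\<theta> > 1" and \<alpha>: "0 \<le> \<alpha>" "\<alpha> < 2"
    and integrable: "set_integrable lborel {0..} f"
    and cont: "continuous_on {0..} f"
    and deriv1: "\<And>s. s > 0 \<Longrightarrow> (f has_real_derivative f' s) (at s)"
    and deriv2: "\<And>s. s > 0 \<Longrightarrow>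
      (f' has_real_derivative K * s powr - \<alpha> * (f s - \<theta> powr (1 - \<alpha>) * f (\<theta> * s))) (at s)"
begin

definition weighted :: "real \<Rightarrow> real" where "weighted y = y powr - \<alpha> * f y"

lemma integrable_weighted: "set_integrable lborel {a..} weighted" if "a > 0"
  unfolding weighted_def[abs_def] using that \<alpha>
  by (intro set_integrable_powr_weight[OF integrable cont]) auto

lemma integrable_weighted_0: "\<alpha> < 1 \<Longrightarrow> set_integrable lborel {0..} weighted"
  unfolding weighted_def[abs_def] using \<alpha>
  by (intro set_integrable_powr_weight[OF integrable cont]) auto

text \<open>This is the function \<open>D\<close> of the introduction. Its value at 0 is relied on
  only for \<alpha> < 1, where the weight is integrable at 0.\<close>

definition weighted_tail :: "real \<Rightarrow> real" where "weighted_tail = tail weighted"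

text \<open>The base point \<open>s/2\<close> avoids the origin, where the weight may fail to be
  integrable.\<close>

lemma weighted_tail_deriv: "(weighted_tail has_real_derivative - weighted s) (at s)" if "s > 0"
  unfolding weighted_tail_def
proof (rule has_real_derivative_tail[of "s/2"])
  show "continuous_on {s/2..} weighted"
    unfolding weighted_def using that by (intro continuous_intros continuous_on_subset[OF cont]) auto
qed (use that in \<open>auto intro: integrable_weighted\<close>)

lemma weighted_tail_lim: "(weighted_tail \<longlongrightarrow> 0) at_top"
  unfolding weighted_tail_def by (rule tail_tendsto_0[OF integrable_weighted[of 1]]) auto

text \<open>The two sides have the same derivative, so they differ by a constant \<open>k\<close>,
  which is the limit of \<open>f'\<close>. Then \<open>second_derivative_limit_zero\<close> gives
  \<open>k = 0\<close> and the decay of \<open>f\<close> together.\<close>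

lemma f'_weighted_tail_and_lim: "(\<forall>s>0. f' s = K * (weighted_tail (\<theta> * s) - weighted_tail s)) \<and> (f \<longlongrightarrow> 0) at_top"
proof -
  have "((\<lambda>s. f' s - K * (weighted_tail (\<theta> * s) - weighted_tail s)) has_real_derivative 0) (at s)" if "s > 0" for s
  proof -
    have "((\<lambda>s. weighted_tail (\<theta> * s)) has_real_derivative (- weighted (\<theta> * s) * \<theta>)) (at s)"
      by (rule DERIV_chain2[OF weighted_tail_deriv]) (use that \<theta> in \<open>auto intro!: derivative_eq_intros\<close>)
    hence "((\<lambda>s. f' s - K * (weighted_tail (\<theta> * s) - weighted_tail s)) has_real_derivative 
       K * s powr - \<alpha> * (f s - \<theta> powr (1 - \<alpha>) * f (\<theta> * s)) - K * (- weighted (\<theta> * s) * \<theta> - - weighted s)) (at s)"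
      by (intro DERIV_diff deriv2 DERIV_cmult weighted_tail_deriv that)
    moreover have "(\<theta> * s) powr -\<alpha> * \<theta> = \<theta> powr (1 - \<alpha>) * s powr -\<alpha>"
      using \<theta> that by (simp add: powr_mult powr_diff powr_minus field_simps)
    hence "weighted (\<theta> * s) * \<theta> = \<theta> powr (1 - \<alpha>) * s powr -\<alpha> * f (\<theta> * s)"
      by (simp add: weighted_def mult_ac)
    hence "K * s powr - \<alpha> * (f s - \<theta> powr (1 - \<alpha>) * f (\<theta> * s)) - K * (- weighted (\<theta> * s) * \<theta> - - weighted s) = 0"
      by (simp add: weighted_def algebra_simps)
    ultimately show ?thesis by metis
  qed
  hence "\<exists>k. \<forall>s\<in>{0<..}. f' s - K * (weighted_tail (\<theta> * s) - weighted_tail s) = k"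
    by (intro has_field_derivative_zero_constant) (auto intro: has_field_derivative_at_within)
  then obtain k where "\<forall>s\<in>{0<..}. f' s - K * (weighted_tail (\<theta> * s) - weighted_tail s) = k"
    by blast
  hence k: "f' s = K * (weighted_tail (\<theta> * s) - weighted_tail s) + k" if "s > 0" for s
    using that by (metis add.commute diff_add_cancel greaterThan_iff)
  have weighted_tail2: "((\<lambda>s. weighted_tail (\<theta> * s)) \<longlongrightarrow> 0) at_top"
    by (rule filterlim_compose[OF weighted_tail_lim]) (use \<theta> in real_asymp)
  have "((\<lambda>s. K * (weighted_tail (\<theta> * s) - weighted_tail s) + k) \<longlongrightarrow> K * (0 - 0) + k) at_top"
    by (intro tendsto_intros weighted_tail2 weighted_tail_lim)
  hence "(f' \<longlongrightarrow> K * (0 - 0) + k) at_top"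
    by (rule Lim_transform_eventually)
       (use eventually_gt_at_top[of 0] in eventually_elim, use k in force)
  hence f'lim: "((\<lambda>s. - f' s) \<longlongrightarrow> - k) at_top" by (intro tendsto_minus) simp
  \<comment> \<open>The three functions here are the tail of \<open>f\<close>, then
    \<open>- f\<close>, then \<open>- f'\<close>.\<close>
  have "- k = 0" "((\<lambda>s. - f s) \<longlongrightarrow> 0) at_top"
    by (rule second_derivative_limit_zero[OF tail_tendsto_0[OF integrable] f'lim];
        use has_real_derivative_tail[OF integrable cont] deriv1 in \<open>auto intro: DERIV_minus\<close>)+
  thus ?thesis using k tendsto_minus_cancel_left[of f 0] by auto
qed

lemma f'_weighted_tail: "s > 0 \<Longrightarrow> f' s = K * (weighted_tail (\<theta> * s) - weighted_tail s)"
  and f_lim: "(f \<longlongrightarrow> 0) at_top"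
  using f'_weighted_tail_and_lim by auto

text \<open>At a negative minimum the second derivative is nonnegative, and the equation bounds
  \<open>\<theta> powr (1 - \<alpha>) * f (\<theta> * s)\<close> by \<open>f s\<close>. For \<alpha>
  \<ge> 1 the factor is at most 1, so \<open>f (\<theta> * s)\<close> is no larger than
  \<open>f s\<close>, as the minimum principle asks.\<close>

lemma nonneg_if_\<alpha>_ge_1:
  assumes "\<alpha> \<ge> 1" "f 0 \<ge> 0" "x \<ge> 0"
  shows "f x \<ge> 0"
proof (rule advanced_minimum_principle[OF cont f_lim _ _ \<theta> _ \<open>x \<ge> 0\<close>])
  fix s :: real assume s: "s > 0" "\<And>y. y \<ge> 0 \<Longrightarrow> f s \<le> f y" "f s < 0"
  have 0: "f' s = 0"
    by (rule DERIV_local_min[OF deriv1, of _ s]) (use s in auto)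
  define l where "l = K * s powr - \<alpha> * (f s - \<theta> powr (1 - \<alpha>) * f (\<theta> * s))"
  have d2: "(f' has_real_derivative l) (at s)" unfolding l_def by (rule deriv2) fact
  \<comment> \<open>Otherwise \<open>f'\<close> would be negative just to the right of
    \<open>s\<close>, and \<open>f\<close> would fall below its minimum.\<close>
  have "l \<ge> 0"
  proof (rule ccontr)
    assume "\<not> l \<ge> 0"
    then obtain d where d: "d > 0" "\<And>h. h > 0 \<Longrightarrow> h < d \<Longrightarrow> f' (s + h) < 0"
      using DERIV_neg_dec_right[OF d2] 0 by auto
    have "f (s + d/2) < f s"
    proof (rule DERIV_neg_imp_decreasing_open[of s _ f])
      show "\<exists>y. (f has_real_derivative y) (at x) \<and> y < 0" if "s < x" "x < s + d/2" for x
        using d(2)[of "x - s"] deriv1[of x] that s(1) by auto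
    qed (use d(1) s(1) in \<open>auto intro!: continuous_on_subset[OF cont]\<close>)
    with s(2)[of "s + d/2"] d(1) s(1) show False by auto
  qed
  moreover have "K * s powr - \<alpha> > 0" using K s(1) by simp
  ultimately have "f s - \<theta> powr (1 - \<alpha>) * f (\<theta> * s) \<ge> 0"
    unfolding l_def by (simp add: zero_le_mult_iff)
  hence le: "\<theta> powr (1 - \<alpha>) * f (\<theta> * s) \<le> f s" by simp
  hence neg: "f (\<theta> * s) < 0" using s(3) \<theta>
    by (smt (verit) mult_nonneg_nonneg powr_ge_zero)
  have "\<theta> powr (1 - \<alpha>) \<le> \<theta> powr 0" using \<theta> assms by (intro powr_mono) auto
  hence "\<theta> powr (1 - \<alpha>) \<le> 1" using \<theta> by simp
  hence "f (\<theta> * s) \<le> \<theta> powr (1 - \<alpha>) * f (\<theta> * s)" using neg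
    by (simp add: mult_le_cancel_right1)
  with le show "f (\<theta> * s) \<le> f s" by simp
qed (use assms in auto)


text \<open>A second-order argument: at a maximum \<open>f s = 0\<close>, and if the claim failed
  then \<open>f' s < 0\<close>. So \<open>f\<close> would be positive just before \<open>s\<close>,
  and \<open>weighted_tail\<close> would decrease towards \<open>s\<close>, against
  maximality.\<close>

lemma weighted_tail_local_max:
  assumes s: "s > 0" and d: "d > 0" "\<And>y. \<bar>y - s\<bar> < d \<Longrightarrow> weighted_tail y \<le> weighted_tail s"
  shows "weighted_tail s \<le> weighted_tail (\<theta> * s)"
proof (rule ccontr)
  assume "\<not> weighted_tail s \<le> weighted_tail (\<theta> * s)"
  hence neg: "f' s < 0" using f'_weighted_tail[OF s] K by (simp add: mult_pos_neg)
  have "- weighted s = 0"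
    by (rule DERIV_local_max[OF weighted_tail_deriv[OF s] d(1)]) (use d(2) in \<open>auto simp: abs_minus_commute\<close>)
  hence fs: "f s = 0" using s by (simp add: weighted_def)
  obtain e where e: "e > 0" "\<And>h. h > 0 \<Longrightarrow> h < e \<Longrightarrow> f s < f (s - h)"
    using DERIV_neg_dec_left[OF deriv1[OF s] neg] by auto
  define h where "h = min (min d e) s / 2"
  have h: "h > 0" "h < d" "h < e" "h < s" using d e s by (auto simp: h_def)
  have "weighted_tail s < weighted_tail (s - h)"
  proof (rule DERIV_neg_imp_decreasing_open[of _ _ weighted_tail])
    fix y assume y: "s - h < y" "y < s"
    have "f y > 0" using e(2)[of "s - y"] y h fs by auto
    hence "- weighted y < 0" using y h by (simp add: weighted_def)
    thus "\<exists>z. (weighted_tail has_real_derivative z) (at y) \<and> z < 0" using weighted_tail_deriv[of y] y h by auto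
  next
    show "continuous_on {s-h..s} weighted_tail" using h
      by (intro DERIV_atLeastAtMost_imp_continuous_on) (use weighted_tail_deriv h in \<open>meson add_less_cancel_left less_diff_eq diff_gt_0_iff_gt less_le_trans\<close>)
  qed (use h in auto)
  with d(2)[of "s - h"] h show False by auto
qed

lemma uminus: "halfline_solution K \<theta> \<alpha> (\<lambda>s. - f s) (\<lambda>s. - f' s)"
proof
  show "((\<lambda>s. - f' s) has_real_derivative K * s powr - \<alpha> * (- f s - \<theta> powr (1 - \<alpha>) * - f (\<theta> * s))) (at s)" 
    if "s > 0" for s
    using DERIV_minus[OF deriv2[OF that]] by (simp add: algebra_simps)
  show "set_integrable lborel {0..} (\<lambda>s. - f s)"
    using integrable by (simp add: set_integrable_def)
qed (use K \<theta> \<alpha> in \<open>auto intro: DERIV_minus deriv1 continuous_intros cont\<close>)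

lemma weighted_tail_uminus: "halfline_solution.weighted_tail \<alpha> (\<lambda>s. - f s) s = - weighted_tail s"
proof -
  interpret m: halfline_solution K \<theta> \<alpha> "\<lambda>s. - f s" "\<lambda>s. - f' s" by (rule uminus)
  show ?thesis by (simp add: weighted_tail_def m.weighted_tail_def tail_def weighted_def m.weighted_def set_lebesgue_integral_def)
qed

lemma weighted_tail_local_min:
  assumes s: "s > 0" and d: "d > 0" "\<And>y. \<bar>y - s\<bar> < d \<Longrightarrow> weighted_tail s \<le> weighted_tail y"
  shows "weighted_tail (\<theta> * s) \<le> weighted_tail s"
proof -
  interpret m: halfline_solution K \<theta> \<alpha> "\<lambda>s. - f s" "\<lambda>s. - f' s" by (rule uminus)
  show ?thesis using m.weighted_tail_local_max[OF s d(1)] d(2) by (simp add: weighted_tail_uminus)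
qed

text \<open>First \<open>weighted_tail\<close> is confined between 0 and its value at 0. A positive
  increment would have a largest one, attained between a local minimum and a local maximum; dilation
  by \<theta> preserves it, although increments ending far out are small. So
  \<open>weighted_tail\<close> is nonincreasing, which fixes the sign of its derivative
  \<open>- weighted\<close>.\<close>

lemma nonneg_if_\<alpha>_less_1:
  assumes "\<alpha> < 1" "weighted_tail 0 \<ge> 0" "x > 0"
  shows "f x \<ge> 0"
proof -
  have contD: "continuous_on {0..} weighted_tail"
    unfolding weighted_tail_def using continuous_on_tail[OF integrable_weighted_0[OF \<open>\<alpha> < 1\<close>]] .
  have lower: "0 \<le> weighted_tail y" if "y \<ge> 0" for y
  proof (rule advanced_minimum_principle[OF contD weighted_tail_lim _ _ \<theta> _ that])
    fix s :: real assume "s > 0" "\<And>y. y \<ge> 0 \<Longrightarrow> weighted_tail s \<le> weighted_tail y"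
    thus "weighted_tail (\<theta> * s) \<le> weighted_tail s" by (intro weighted_tail_local_min[of s s]) auto
  qed (use assms in auto)
  \<comment> \<open>The minimum principle for \<open>- weighted_tail\<close> at the level
    \<open>- weighted_tail 0\<close>, which is at most the limit 0 by assumption.\<close>
  have upper: "- weighted_tail 0 \<le> - weighted_tail y" if "y \<ge> 0" for y
  proof (rule advanced_minimum_principle[OF _ _ _ _ \<theta> _ that])
    show "continuous_on {0..} (\<lambda>y. - weighted_tail y)" by (intro continuous_intros contD)
    show "((\<lambda>y. - weighted_tail y) \<longlongrightarrow> - 0) at_top" by (intro tendsto_intros weighted_tail_lim)
    fix s :: real assume "s > 0" "\<And>y. y \<ge> 0 \<Longrightarrow> - weighted_tail s \<le> - weighted_tail y"
    thus "- weighted_tail (\<theta> * s) \<le> - weighted_tail s" using weighted_tail_local_max[of s s] by auto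
  qed (use assms in auto)
  have mono: "weighted_tail s \<le> weighted_tail t" if "0 \<le> t" "t \<le> s" for s t
  proof (rule ccontr)
    assume "\<not> weighted_tail s \<le> weighted_tail t"
    define m where "m = weighted_tail s - weighted_tail t"
    have m: "m > 0" using \<open>\<not> weighted_tail s \<le> weighted_tail t\<close> by (simp add: m_def)
    \<comment> \<open>Past \<open>R0\<close> the values are below \<open>m\<close>, and all values
      are nonnegative, so no increment ending there reaches \<open>m\<close>; the search is confined
      to the compact triangle \<open>C\<close>.\<close>
    obtain R0 where R0: "\<And>y. y \<ge> R0 \<Longrightarrow> weighted_tail y < m"
      using order_tendstoD(2)[OF weighted_tail_lim m] by (auto simp: eventually_at_top_linorder)
    define R where "R = max R0 s"
    define C where "C = {p. fst p \<in> {0..R} \<and> snd p \<in> {0..R} \<and> fst p \<le> snd p}"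
    have "C = ({0..R} \<times> {0..R}) \<inter> {p. fst p \<le> snd p}" by (auto simp: C_def)
    moreover have "closed {p :: real \<times> real. fst p \<le> snd p}"
      by (intro closed_Collect_le continuous_intros)
    ultimately have "compact C" by (auto intro!: compact_Int_closed compact_Times)
    moreover have ts: "(t, s) \<in> C" using that by (auto simp: C_def R_def)
    moreover have "continuous_on C (\<lambda>p. weighted_tail (snd p) - weighted_tail (fst p))"
      by (intro continuous_intros continuous_on_compose2[OF contD]) (auto simp: C_def)
    ultimately have "\<exists>p\<in>C. \<forall>p'\<in>C. weighted_tail (snd p') - weighted_tail (fst p') \<le> weighted_tail (snd p) - weighted_tail (fst p)"
      by (intro continuous_attains_sup) auto
    then obtain p where p: "p \<in> C" "\<And>p'. p' \<in> C \<Longrightarrow> weighted_tail (snd p') - weighted_tail (fst p') \<le> weighted_tail (snd p) - weighted_tail (fst p)"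
      by blast
    define M where "M = weighted_tail (snd p) - weighted_tail (fst p)"
    have mM: "m \<le> M" using p(2)[OF ts] by (simp add: M_def m_def)
    have glob: "weighted_tail s' - weighted_tail t' \<le> M" if "0 \<le> t'" "t' \<le> s'" for s' t'
    proof (cases "s' \<le> R")
      case True
      thus ?thesis using p(2)[of "(t', s')"] that by (auto simp: C_def M_def)
    next
      case False
      hence "weighted_tail s' < m" by (intro R0) (auto simp: R_def)
      thus ?thesis using lower[of t'] that mM by auto
    qed
    have iter: "0 \<le> \<theta> ^ n * fst p \<and> \<theta> ^ n * fst p \<le> \<theta> ^ n * snd p \<and> weighted_tail (\<theta> ^ n * snd p) - weighted_tail (\<theta> ^ n * fst p) = M" for n
    proof (induction n)
      case 0
      thus ?case using p(1) by (auto simp: C_def M_def)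
    next
      case (Suc n)
      define a b where "a = \<theta> ^ n * fst p" and "b = \<theta> ^ n * snd p"
      have ab: "0 \<le> a" "a \<le> b" "weighted_tail b - weighted_tail a = M" using Suc by (auto simp: a_def b_def)
      \<comment> \<open>By \<open>upper\<close> an increment starting at 0 is not positive, so both
        ends are interior and the local statements apply.\<close>
      have "a \<noteq> 0" using ab upper[of b] mM m by auto
      hence "a > 0" using ab by simp
      have "a \<noteq> b" using ab mM m by auto
      hence "a < b" using ab by simp
      \<comment> \<open>The radius \<open>b - a\<close> keeps \<open>y\<close> to the right of
        \<open>a\<close>, so that \<open>(a, y)\<close> competes with the extremal pair.\<close>
      have "weighted_tail b \<le> weighted_tail (\<theta> * b)"
      proof (rule weighted_tail_local_max[of _ "b - a"])
        fix y assume "\<bar>y - b\<bar> < b - a"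
        hence "a \<le> y" by auto
        thus "weighted_tail y \<le> weighted_tail b" using glob[of a y] ab by auto
      qed (use \<open>a > 0\<close> \<open>a < b\<close> in auto)
      moreover have "weighted_tail (\<theta> * a) \<le> weighted_tail a"
      proof (rule weighted_tail_local_min[of _ "min a (b - a)"])
        fix y assume "\<bar>y - a\<bar> < min a (b - a)"
        hence "0 \<le> y" "y \<le> b" by auto
        thus "weighted_tail a \<le> weighted_tail y" using glob[of y b] ab by auto
      qed (use \<open>a > 0\<close> \<open>a < b\<close> in auto)
      moreover have "\<theta> * a \<le> \<theta> * b" "0 \<le> \<theta> * a" using ab \<theta> by auto
      moreover from this have "weighted_tail (\<theta> * b) - weighted_tail (\<theta> * a) \<le> M" by (intro glob)
      ultimately show ?case using ab by (simp add: a_def b_def mult.assoc)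
    qed
    \<comment> \<open>The dilated right end runs to infinity, where the values are below
      \<open>m \<le> M\<close>, while the values at the left end stay nonnegative.\<close>
    have "snd p \<noteq> 0" using iter[of 0] upper[of 0] mM m by (auto simp: )
    hence "snd p > 0" using iter[of 0] by auto
    hence "filterlim (\<lambda>n. \<theta> ^ n * snd p) at_top sequentially"
      using \<theta> by real_asymp
    hence "eventually (\<lambda>n. \<theta> ^ n * snd p \<ge> R0) sequentially"
      by (simp add: filterlim_at_top)
    then obtain n where "\<theta> ^ n * snd p \<ge> R0" by (auto simp: eventually_sequentially)
    with R0 have "weighted_tail (\<theta> ^ n * snd p) < m" by blast
    with iter[of n] mM lower[of "\<theta> ^ n * fst p"] show False by auto
  qed
  show ?thesis
  proof (rule ccontr)
    assume "\<not> f x \<ge> 0"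
    hence "- weighted x > 0" using \<open>x > 0\<close> by (simp add: weighted_def mult_pos_neg)
    from DERIV_pos_inc_right[OF weighted_tail_deriv[OF \<open>x > 0\<close>] this]
    obtain d where d: "d > 0" "\<And>h. h > 0 \<Longrightarrow> h < d \<Longrightarrow> weighted_tail x < weighted_tail (x + h)" by auto
    from d(2)[of "d/2"] mono[of x "x + d/2"] d(1) \<open>x > 0\<close> show False by auto
  qed
qed

text \<open>\<open>weighted_tail\<close> is continuous at 0, where its two arguments
  \<open>\<theta> * s\<close> and \<open>s\<close> merge. For \<alpha> = 0 this makes the even
  extension differentiable at the origin.\<close>

lemma f'_tendsto_0:
  assumes "\<alpha> < 1"
  shows "(f' \<longlongrightarrow> 0) (at_right 0)"
proof -
  have "continuous_on {0..} weighted_tail"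
    unfolding weighted_tail_def using continuous_on_tail[OF integrable_weighted_0[OF \<open>\<alpha> < 1\<close>]] .
  hence "(weighted_tail \<longlongrightarrow> weighted_tail 0) (at 0 within {0..})" by (simp add: continuous_on_def)
  hence lim: "(weighted_tail \<longlongrightarrow> weighted_tail 0) (at_right 0)" by (rule tendsto_within_subset) auto
  have "filterlim (\<lambda>s. \<theta> * s) (at_right 0) (at_right 0)" using \<theta> by real_asymp
  from filterlim_compose[OF lim this] have "((\<lambda>s. K * (weighted_tail (\<theta> * s) - weighted_tail s)) \<longlongrightarrow> K * (weighted_tail 0 - weighted_tail 0)) (at_right 0)"
    by (intro tendsto_intros lim)
  moreover have "eventually (\<lambda>s. K * (weighted_tail (\<theta> * s) - weighted_tail s) = f' s) (at_right 0)"
    using eventually_at_right_less[of 0] by eventually_elim (simp add: f'_weighted_tail)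
  ultimately show ?thesis by (simp add: Lim_transform_eventually)
qed

text \<open>The functional on which the one-dimensional space of half-line solutions is normalised.\<close>

definition boundary_value :: real where "boundary_value = (if \<alpha> \<ge> 1 then f 0 else weighted_tail 0)"

lemma nonneg:
  assumes "boundary_value \<ge> 0" "x > 0"
  shows "f x \<ge> 0"
  using assms nonneg_if_\<alpha>_ge_1[of x] nonneg_if_\<alpha>_less_1[of x] by (auto simp: boundary_value_def split: if_splits)

end

lemma halfline_solution_diff:
  assumes "halfline_solution K \<theta> \<alpha> f f'" "halfline_solution K \<theta> \<alpha> g g'"
  shows "halfline_solution K \<theta> \<alpha> (\<lambda>s. f s - k * g s) (\<lambda>s. f' s - k * g' s)"
proof -
  interpret f: halfline_solution K \<theta> \<alpha> f f' by fact
  interpret g: halfline_solution K \<theta> \<alpha> g g' by fact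
  show ?thesis
  proof
    show "((\<lambda>s. f' s - k * g' s) has_real_derivative
             K * s powr - \<alpha> * (f s - k * g s - \<theta> powr (1 - \<alpha>) * (f (\<theta> * s) - k * g (\<theta> * s)))) (at s)" 
      if "s > 0" for s
      using DERIV_diff[OF f.deriv2[OF that] DERIV_cmult[OF g.deriv2[OF that], of k]] 
      by (simp add: algebra_simps)
    show "set_integrable lborel {0..} (\<lambda>s. f s - k * g s)"
      by (intro set_integral_diff(1) f.integrable set_integrable_mult_right g.integrable impI)
  qed (use f.K f.\<theta> f.\<alpha> in \<open>auto intro!: DERIV_diff DERIV_cmult f.deriv1 g.deriv1 continuous_intros f.cont g.cont\<close>)
qed

text \<open>The solution \<open>f - k * g\<close> has boundary value 0, so the maximum principle
  makes both it and its negative nonnegative.\<close>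

lemma halfline_solution_unique:
  assumes f: "halfline_solution K \<theta> \<alpha> f f'" and g: "halfline_solution K \<theta> \<alpha> g g'"
    and boundary_value: "halfline_solution.boundary_value \<alpha> f = k * halfline_solution.boundary_value \<alpha> g" and "x > 0"
  shows "f x = k * g x"
proof -
  interpret f: halfline_solution K \<theta> \<alpha> f f' by fact
  interpret g: halfline_solution K \<theta> \<alpha> g g' by fact
  interpret d: halfline_solution K \<theta> \<alpha> "\<lambda>s. f s - k * g s" "\<lambda>s. f' s - k * g' s"
    by (rule halfline_solution_diff) fact+
  interpret m: halfline_solution K \<theta> \<alpha> "\<lambda>s. - (f s - k * g s)" "\<lambda>s. - (f' s - k * g' s)"
    by (rule d.uminus)
  have weighted_tail: "d.weighted_tail 0 = f.weighted_tail 0 - k * g.weighted_tail 0" if "\<alpha> < 1"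
  proof -
    have "d.weighted_tail 0 = (LBINT y:{0..}. f.weighted y - k * g.weighted y)"
      by (simp add: d.weighted_tail_def tail_def d.weighted_def f.weighted_def g.weighted_def algebra_simps)
    also have "\<dots> = f.weighted_tail 0 - (LBINT y:{0..}. k * g.weighted y)"
      unfolding f.weighted_tail_def tail_def
      by (intro set_integral_diff(2) set_integrable_mult_right f.integrable_weighted_0 g.integrable_weighted_0 impI that)
    also have "(LBINT y:{0..}. k * g.weighted y) = k * g.weighted_tail 0"
      by (simp add: g.weighted_tail_def tail_def)
    finally show ?thesis .
  qed
  have "d.boundary_value = 0" using boundary_value weighted_tail by (auto simp: d.boundary_value_def f.boundary_value_def g.boundary_value_def split: if_splits)
  moreover from this have "m.boundary_value = 0" using d.weighted_tail_uminus[of 0] unfolding d.boundary_value_def m.boundary_value_def by (auto split: if_splits)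
  ultimately show ?thesis using d.nonneg[of x] m.nonneg[of x] \<open>x > 0\<close> by auto
qed

section \<open>The rescaled Bessel function\<close>

text \<open>The function \<open>u\<close> of the introduction;
  \<open>A * (2 - \<alpha>)\<^sup>2\<close> plays the role of \<open>K\<close>.\<close>

definition bessel_base :: "real \<Rightarrow> real \<Rightarrow> real \<Rightarrow> real" where
  "bessel_base \<alpha> A s = bessel_integral (1 / (2 - \<alpha>)) (A * s powr (2 - \<alpha>)) / 2"

text \<open>The chain-rule derivative of \<open>bessel_base\<close>. For \<alpha> \<le> 1 the order
  of the integral is not positive, so the formula serves for \<open>s > 0\<close> only.\<close>

definition bessel_base' :: "real \<Rightarrow> real \<Rightarrow> real \<Rightarrow> real" where
  "bessel_base' \<alpha> A s = - (A * (2 - \<alpha>) * s powr (1 - \<alpha>) * bessel_integral (1 / (2 - \<alpha>) - 1) (A * s powr (2 - \<alpha>)) / 2)"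

text \<open>The elementary bound \<open>v * exp (- v) \<le> 1\<close> with \<open>v = x / t\<close>
  pays for the lowered order by a factor \<open>x\<close>.\<close>

lemma bessel_integral_pred_bound:
  assumes "\<mu> > 0" "x > 0"
  shows "x * bessel_integral (\<mu> - 1) x \<le> Gamma \<mu>"
proof -
  have "(LBINT t. x * bessel_integrand (\<mu> - 1) x t) \<le> (LBINT t. bessel_integrand \<mu> 0 t)"
  proof (rule integral_mono)
    fix t :: real
    show "x * bessel_integrand (\<mu> - 1) x t \<le> bessel_integrand \<mu> 0 t"
    proof (cases "t > 0")
      case True
      have "x / t * exp (- (x / t)) \<le> 1"
        using exp_ge_add_one_self[of "x / t"] True assms by (simp add: exp_minus field_simps)
      hence "t powr (\<mu> - 1) * exp (- t) * (x / t * exp (- (x / t))) \<le> t powr (\<mu> - 1) * exp (- t) * 1"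
        by (intro mult_left_mono) auto
      moreover have "t powr (\<mu> - 2) = t powr (\<mu> - 1) / t"
        using True by (simp add: powr_diff field_simps power2_eq_square)
      moreover have "exp (- t - x / t) = exp (- t) * exp (- (x / t))"
        by (simp add: exp_add[symmetric])
      ultimately show ?thesis using True by (simp add: bessel_integrand_def mult_ac)
    qed (simp add: bessel_integrand_def)
  qed (use assms in \<open>auto intro: integrable_bessel_integral_pos integrable_bessel_integral_0\<close>)
  thus ?thesis using bessel_integral_0[OF assms(1)] by (simp add: bessel_integral_def)
qed

text \<open>A vanishing integral would make \<open>g\<close> vanish almost everywhere, yet
  \<open>g\<close> is positive on the unit interval, which is not a null set.\<close>

lemma integral_pos:
  fixes g :: "real \<Rightarrow> real"
  assumes g: "integrable lborel g" and nonneg: "\<And>t. g t \<ge> 0" and pos: "\<And>t. t > 0 \<Longrightarrow> g t > 0"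
  shows "(LBINT t. g t) > 0"
proof (rule ccontr)
  assume "\<not> (LBINT t. g t) > 0"
  moreover have "(LBINT t. g t) \<ge> 0" by (intro Bochner_Integration.integral_nonneg nonneg)
  ultimately have "(LBINT t. g t) = 0" by simp
  hence "AE t in lborel. g t = 0"
    using integral_nonneg_eq_0_iff_AE[OF g] nonneg by simp
  hence "AE t in lborel. t \<notin> {0<..<1::real}"
    by eventually_elim (use pos in fastforce)
  hence "{0<..<1::real} \<in> null_sets lborel"
    by (subst (asm) AE_iff_null_sets[symmetric]) auto
  hence "emeasure lborel {0<..<1::real} = 0" by (rule null_setsD1)
  thus False by simp
qed

lemma set_integrable_atLeast_0:
  fixes g :: "real \<Rightarrow> real"
  assumes g: "set_integrable lborel {0<..} g"
  shows "set_integrable lborel {0..} g" and "(LBINT t:{0..}. g t) = (LBINT t:{0<..}. g t)"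
proof -
  have eq: "indicator {0} t *\<^sub>R g t = g 0 * indicator {0} t" for t by (simp add: indicator_def)
  have s: "set_integrable lborel {0} g" "(LBINT t:{0}. g t) = 0"
    unfolding set_integrable_def set_lebesgue_integral_def eq by auto
  have e: "{0..} = {0::real} \<union> {0<..}" by auto
  show "set_integrable lborel {0..} g"
    unfolding e using s g by (intro set_integrable_Un) auto
  show "(LBINT t:{0..}. g t) = (LBINT t:{0<..}. g t)"
    unfolding e using s g by (subst set_integral_Un) auto
qed

section \<open>Smoothness, local equation and integral of \<open>bessel_base\<close>\<close>

context
  fixes \<alpha> A :: real
  assumes \<alpha>: "0 \<le> \<alpha>" "\<alpha> < 2" and A: "A > 0"
begin

lemma \<nu>_pos: "1 / (2 - \<alpha>) > 0" using \<alpha> by simp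

lemma bessel_base_0: "bessel_base \<alpha> A 0 = Gamma (1 / (2 - \<alpha>)) / 2"
  using bessel_integral_0[OF \<nu>_pos] by (simp add: bessel_base_def)

lemma bessel_base_nonneg: "bessel_base \<alpha> A s \<ge> 0"
  by (simp add: bessel_base_def bessel_integral_nonneg)

lemma bessel_base_le: "bessel_base \<alpha> A s \<le> Gamma (1 / (2 - \<alpha>)) / 2"
  using bessel_integral_le_Gamma[OF _ \<nu>_pos, of "A * s powr (2 - \<alpha>)"] A by (simp add: bessel_base_def)

lemma bessel_base_pos: "bessel_base \<alpha> A s > 0"
proof -
  have "bessel_integral (1 / (2 - \<alpha>)) (A * s powr (2 - \<alpha>)) > 0"
    unfolding bessel_integral_def using A \<nu>_pos
    by (intro integral_pos integrable_bessel_integral bessel_integrand_nonneg) (auto simp: bessel_integrand_def)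
  thus ?thesis by (simp add: bessel_base_def)
qed

lemma continuous_on_bessel_base: "continuous_on {0..} (bessel_base \<alpha> A)"
proof -
  have "continuous_on {0..} (\<lambda>s. A * s powr (2 - \<alpha>))"
    using \<alpha> by (intro continuous_on_mult_left continuous_on_powr') (auto intro!: continuous_intros)
  hence "continuous_on {0..} (\<lambda>s. bessel_integral (1 / (2 - \<alpha>)) (A * s powr (2 - \<alpha>)) / 2)"
    using A \<nu>_pos by (intro continuous_on_divide continuous_on_compose2[OF continuous_on_bessel_integral]) auto
  thus ?thesis by (simp add: bessel_base_def[abs_def])
qed

lemma bessel_base_deriv: "(bessel_base \<alpha> A has_real_derivative bessel_base' \<alpha> A s) (at s)" if "s > 0"
proof -
  have "((\<lambda>s. A * s powr (2 - \<alpha>)) has_real_derivative A * ((2 - \<alpha>) * s powr (2 - \<alpha> - 1))) (at s)"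
    by (intro DERIV_cmult has_real_derivative_powr that)
  from DERIV_chain2[OF DERIV_bessel_integral this, of "1 / (2 - \<alpha>)"] that A
  have "((\<lambda>s. bessel_integral (1 / (2 - \<alpha>)) (A * s powr (2 - \<alpha>))) has_real_derivative
     - bessel_integral (1 / (2 - \<alpha>) - 1) (A * s powr (2 - \<alpha>)) * (A * ((2 - \<alpha>) * s powr (1 - \<alpha>)))) (at s)"
    by simp
  from DERIV_cdivide[OF this, of 2] show ?thesis
    unfolding bessel_base_def[abs_def] bessel_base'_def by (simp add: mult_ac)
qed

text \<open>This is the local equation for \<open>u\<close>. The chain rule produces integrals of
  the orders \<nu> - 1 and \<nu> - 2, and \<open>bessel_integral_recurrence\<close> removes the
  latter.\<close>

lemma bessel_base'_deriv: 
  "(bessel_base' \<alpha> A has_real_derivative A * (2 - \<alpha>)\<^sup>2 * s powr - \<alpha> * bessel_base \<alpha> A s) (at s)" if "s > 0"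
proof -
  define \<beta> \<nu> x where "\<beta> = 2 - \<alpha>" "\<nu> = 1 / \<beta>" "x = A * s powr \<beta>"
  have \<beta>: "\<beta> > 0" using \<alpha> by (simp add: \<beta>_\<nu>_x_def)
  have x: "x > 0" using A that by (simp add: \<beta>_\<nu>_x_def)
  have "((\<lambda>s. A * s powr \<beta>) has_real_derivative A * (\<beta> * s powr (\<beta> - 1))) (at s)"
    by (intro DERIV_cmult has_real_derivative_powr that)
  from DERIV_chain2[OF DERIV_bessel_integral this, of "\<nu> - 1"] x
  have dJ: "((\<lambda>s. bessel_integral (\<nu> - 1) (A * s powr \<beta>)) has_real_derivative
     - bessel_integral (\<nu> - 2) x * (A * (\<beta> * s powr (\<beta> - 1)))) (at s)"
    by (simp add: \<beta>_\<nu>_x_def(3))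
  have "((\<lambda>s. - (A * \<beta> / 2) * (s powr (\<beta> - 1) * bessel_integral (\<nu> - 1) (A * s powr \<beta>))) has_real_derivative
      - (A * \<beta> / 2) * (s powr (\<beta> - 1) * (- bessel_integral (\<nu> - 2) x * (A * (\<beta> * s powr (\<beta> - 1)))) + 
        ((\<beta> - 1) * s powr (\<beta> - 1 - 1)) * bessel_integral (\<nu> - 1) (A * s powr \<beta>))) (at s)"
    by (intro DERIV_cmult DERIV_mult' dJ has_real_derivative_powr that)
  also have "(\<lambda>s. - (A * \<beta> / 2) * (s powr (\<beta> - 1) * bessel_integral (\<nu> - 1) (A * s powr \<beta>))) = bessel_base' \<alpha> A"
    by (simp add: bessel_base'_def fun_eq_iff \<beta>_\<nu>_x_def)
  also have "- (A * \<beta> / 2) * (s powr (\<beta> - 1) * (- bessel_integral (\<nu> - 2) x * (A * (\<beta> * s powr (\<beta> - 1)))) + 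
        ((\<beta> - 1) * s powr (\<beta> - 1 - 1)) * bessel_integral (\<nu> - 1) (A * s powr \<beta>))
      = A * \<beta> / 2 * (\<beta> * (A * (s powr (\<beta> - 1) * s powr (\<beta> - 1))) * bessel_integral (\<nu> - 2) x - (\<beta> - 1) * s powr (\<beta> - 1 - 1) * bessel_integral (\<nu> - 1) x)"
    by (simp add: \<beta>_\<nu>_x_def(3) algebra_simps)
  also have "A * (s powr (\<beta> - 1) * s powr (\<beta> - 1)) = s powr - \<alpha> * x"
    by (simp add: \<beta>_\<nu>_x_def powr_add[symmetric] algebra_simps)
  also have "\<beta> - 1 - 1 = - \<alpha>" by (simp add: \<beta>_\<nu>_x_def)
  also have "\<beta> * (s powr - \<alpha> * x) * bessel_integral (\<nu> - 2) x - (\<beta> - 1) * s powr - \<alpha> * bessel_integral (\<nu> - 1) x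
      = s powr - \<alpha> * (\<beta> * (x * bessel_integral (\<nu> - 2) x) - (\<beta> - 1) * bessel_integral (\<nu> - 1) x)"
    by (simp add: algebra_simps)
  also have "x * bessel_integral (\<nu> - 2) x = bessel_integral \<nu> x - (\<nu> - 1) * bessel_integral (\<nu> - 1) x" by (rule bessel_integral_recurrence[OF x])
  also have "\<beta> * (bessel_integral \<nu> x - (\<nu> - 1) * bessel_integral (\<nu> - 1) x) - (\<beta> - 1) * bessel_integral (\<nu> - 1) x = \<beta> * bessel_integral \<nu> x"
  proof -
    \<comment> \<open>The relation \<open>\<beta> * \<nu> = 1\<close> is what cancels the terms of
      order \<nu> - 1.\<close>
    have "\<beta> * (\<nu> - 1) = 1 - \<beta>" using \<beta> by (simp add: \<beta>_\<nu>_x_def(2) algebra_simps)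
    hence "\<beta> * ((\<nu> - 1) * bessel_integral (\<nu> - 1) x) = (1 - \<beta>) * bessel_integral (\<nu> - 1) x" by (simp add: mult.assoc[symmetric])
    thus ?thesis by (simp add: algebra_simps)
  qed
  also have "A * \<beta> / 2 * (s powr - \<alpha> * (\<beta> * bessel_integral \<nu> x)) = A * (2 - \<alpha>)\<^sup>2 * s powr - \<alpha> * bessel_base \<alpha> A s"
    by (simp add: bessel_base_def \<beta>_\<nu>_x_def power2_eq_square)
  finally show ?thesis .
qed

text \<open>Since \<open>A * s powr (1 - \<alpha>)\<close> is \<open>x / s\<close>, this is
  \<open>bessel_integral_pred_bound\<close>. The bound is uniform away from 0, as the M-test for the
  differentiated series requires.\<close>

lemma bessel_base'_bound: "\<bar>bessel_base' \<alpha> A s\<bar> \<le> (2 - \<alpha>) * Gamma (1 / (2 - \<alpha>)) / (2 * s)" if "s > 0"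
proof -
  define x where "x = A * s powr (2 - \<alpha>)"
  have x: "x > 0" using A that by (simp add: x_def)
  have "s powr (2 - \<alpha>) = s powr (1 - \<alpha>) * s powr 1" by (simp only: powr_add[symmetric]) simp
  hence e: "A * s powr (1 - \<alpha>) = x / s" using that by (simp add: x_def)
  have "bessel_base' \<alpha> A s = - ((2 - \<alpha>) / 2 * (A * s powr (1 - \<alpha>)) * bessel_integral (1 / (2 - \<alpha>) - 1) x)"
    by (simp add: bessel_base'_def x_def)
  also have "\<dots> = - ((2 - \<alpha>) / (2 * s) * (x * bessel_integral (1 / (2 - \<alpha>) - 1) x))"
    unfolding e by simp
  finally have "\<bar>bessel_base' \<alpha> A s\<bar> = (2 - \<alpha>) / (2 * s) * (x * bessel_integral (1 / (2 - \<alpha>) - 1) x)"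
    using that x \<alpha> by (simp add: bessel_integral_nonneg)
  also have "\<dots> \<le> (2 - \<alpha>) / (2 * s) * Gamma (1 / (2 - \<alpha>))"
    using that \<alpha> by (intro mult_left_mono bessel_integral_pred_bound x \<nu>_pos) auto
  finally show ?thesis by simp
qed

text \<open>Tonelli: for fixed \<open>t\<close> the integral over \<open>s\<close> is
  \<open>integral_exp_powr\<close> with rate \<open>A / t\<close>. It contributes
  \<open>t powr \<nu>\<close>, so a Gamma integral of order \<open>2 * \<nu>\<close>
  remains.\<close>

lemma nn_integral_bessel_base:
  "(\<integral>\<^sup>+s. ennreal (indicator {0<..} s * bessel_base \<alpha> A s) \<partial>lborel) =
    ennreal (Gamma (1 / (2 - \<alpha>)) * Gamma (2 / (2 - \<alpha>)) * A powr - (1 / (2 - \<alpha>)) / (2 * (2 - \<alpha>)))"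
proof -
  define \<beta> \<nu> where "\<beta> = 2 - \<alpha>" "\<nu> = 1 / \<beta>"
  have \<nu>: "\<nu> > 0" "\<beta> = 1 / \<nu>" using \<alpha> by (auto simp: \<beta>_\<nu>_def)
  have [measurable]: "(\<lambda>(s, t). bessel_integrand \<nu> (A * s powr \<beta>) t) \<in> borel_measurable (lborel \<Otimes>\<^sub>M lborel)"
    unfolding bessel_integrand_def by measurable
  have "(\<integral>\<^sup>+s. ennreal (indicator {0<..} s * bessel_base \<alpha> A s) \<partial>lborel) =
      (\<integral>\<^sup>+s. \<integral>\<^sup>+t. ennreal (indicator {0<..} s * bessel_integrand \<nu> (A * s powr \<beta>) t / 2) \<partial>lborel \<partial>lborel)"
  proof (rule nn_integral_cong)
    fix s :: real
    have "has_bochner_integral lborel (\<lambda>t. indicator {0<..} s * bessel_integrand \<nu> (A * s powr \<beta>) t / 2) 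
            (indicator {0<..} s * bessel_integral \<nu> (A * s powr \<beta>) / 2)"
      unfolding bessel_integral_def using A \<nu>(1)
      by (intro has_bochner_integral_divide_zero has_bochner_integral_mult_right has_bochner_integral_integrable integrable_bessel_integral) auto
    hence "(\<integral>\<^sup>+t. ennreal (indicator {0<..} s * bessel_integrand \<nu> (A * s powr \<beta>) t / 2) \<partial>lborel) = 
            ennreal (indicator {0<..} s * bessel_integral \<nu> (A * s powr \<beta>) / 2)"
      by (subst nn_integral_eq_integral) (auto simp: has_bochner_integral_iff bessel_integrand_nonneg)
    thus "ennreal (indicator {0<..} s * bessel_base \<alpha> A s) = (\<integral>\<^sup>+t. ennreal (indicator {0<..} s * bessel_integrand \<nu> (A * s powr \<beta>) t / 2) \<partial>lborel)"
      by (simp add: bessel_base_def \<beta>_\<nu>_def)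
  qed
  also have "\<dots> = (\<integral>\<^sup>+t. \<integral>\<^sup>+s. ennreal (indicator {0<..} s * bessel_integrand \<nu> (A * s powr \<beta>) t / 2) \<partial>lborel \<partial>lborel)"
    by (rule lborel_pair.Fubini') measurable
  also have "\<dots> = (\<integral>\<^sup>+t. ennreal (\<nu> * Gamma \<nu> * A powr - \<nu> / 2) * ennreal (bessel_integrand (2 * \<nu>) 0 t) \<partial>lborel)"
  proof (rule nn_integral_cong)
    fix t :: real
    show "(\<integral>\<^sup>+s. ennreal (indicator {0<..} s * bessel_integrand \<nu> (A * s powr \<beta>) t / 2) \<partial>lborel) =
        ennreal (\<nu> * Gamma \<nu> * A powr - \<nu> / 2) * ennreal (bessel_integrand (2 * \<nu>) 0 t)"
    proof (cases "t > 0")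
      case True
      have "(\<integral>\<^sup>+s. ennreal (indicator {0<..} s * bessel_integrand \<nu> (A * s powr \<beta>) t / 2) \<partial>lborel) =
         (\<integral>\<^sup>+s. ennreal (bessel_integrand \<nu> 0 t / 2) * ennreal (indicator {0<..} s * exp (- (A / t * s powr (1 / \<nu>)))) \<partial>lborel)"
      proof (rule nn_integral_cong)
        fix s :: real
        have "exp (- t - A * s powr \<beta> / t) = exp (- t) * exp (- (A / t * s powr (1 / \<nu>)))"
          by (simp add: \<nu>(2)[symmetric] exp_add[symmetric])
        hence "indicator {0<..} s * bessel_integrand \<nu> (A * s powr \<beta>) t / 2 =
            bessel_integrand \<nu> 0 t / 2 * (indicator {0<..} s * exp (- (A / t * s powr (1 / \<nu>))))"
          using True by (simp add: bessel_integrand_def)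
        thus "ennreal (indicator {0<..} s * bessel_integrand \<nu> (A * s powr \<beta>) t / 2) =
            ennreal (bessel_integrand \<nu> 0 t / 2) * ennreal (indicator {0<..} s * exp (- (A / t * s powr (1 / \<nu>))))"
          by (simp only:) (rule ennreal_mult', simp add: bessel_integrand_nonneg)
      qed
      also have "\<dots> = ennreal (bessel_integrand \<nu> 0 t / 2) * ennreal (\<nu> * Gamma \<nu> * (A / t) powr - \<nu>)"
        using True A \<nu> integral_exp_powr[of \<nu> "A / t"] by (subst nn_integral_cmult) auto
      also have "\<dots> = ennreal (bessel_integrand \<nu> 0 t / 2 * (\<nu> * Gamma \<nu> * (A / t) powr - \<nu>))"
        by (rule ennreal_mult'[symmetric]) (simp add: bessel_integrand_nonneg)
      also have "bessel_integrand \<nu> 0 t / 2 * (\<nu> * Gamma \<nu> * (A / t) powr - \<nu>) = (\<nu> * Gamma \<nu> * A powr - \<nu> / 2) * bessel_integrand (2 * \<nu>) 0 t"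
      proof -
        have "t powr (2 * \<nu> - 1) = t powr (\<nu> - 1) * t powr \<nu>" by (simp add: powr_add[symmetric])
        thus ?thesis using True A by (simp add: bessel_integrand_def powr_divide powr_minus field_simps)
      qed
      also have "ennreal \<dots> = ennreal (\<nu> * Gamma \<nu> * A powr - \<nu> / 2) * ennreal (bessel_integrand (2 * \<nu>) 0 t)"
        using \<nu>(1) by (intro ennreal_mult') (simp add: Gamma_real_nonneg)
      finally show ?thesis .
    qed (simp add: bessel_integrand_def)
  qed
  also have "\<dots> = ennreal (\<nu> * Gamma \<nu> * A powr - \<nu> / 2) * ennreal (bessel_integral (2 * \<nu>) 0)"
    unfolding bessel_integral_def using \<nu>(1)
    by (subst nn_integral_cmult) (auto simp: bessel_integrand_nonneg integrable_bessel_integral_0 nn_integral_eq_integral)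
  also have "\<dots> = ennreal (\<nu> * Gamma \<nu> * A powr - \<nu> / 2 * Gamma (2 * \<nu>))"
    using \<nu>(1) bessel_integral_0[of "2 * \<nu>"] by (subst ennreal_mult'[symmetric]) (auto simp: Gamma_real_nonneg)
  also have "\<nu> * Gamma \<nu> * A powr - \<nu> / 2 * Gamma (2 * \<nu>) = Gamma (1 / (2 - \<alpha>)) * Gamma (2 / (2 - \<alpha>)) * A powr - (1 / (2 - \<alpha>)) / (2 * (2 - \<alpha>))"
    by (simp add: \<beta>_\<nu>_def mult_ac)
  finally show ?thesis .
qed

lemma has_bochner_integral_bessel_base:
  "has_bochner_integral lborel (\<lambda>s. indicator {0<..} s * bessel_base \<alpha> A s)
    (Gamma (1 / (2 - \<alpha>)) * Gamma (2 / (2 - \<alpha>)) * A powr - (1 / (2 - \<alpha>)) / (2 * (2 - \<alpha>)))"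
proof (rule has_bochner_integral_nn_integral)
  have "(\<lambda>s. indicator {0<..} s *\<^sub>R bessel_base \<alpha> A s) \<in> borel_measurable borel"
    by (rule borel_measurable_continuous_on_indicator) 
       (auto intro: continuous_on_subset[OF continuous_on_bessel_base])
  thus "(\<lambda>s. indicator {0<..} s * bessel_base \<alpha> A s) \<in> borel_measurable lborel" by simp
qed (use nn_integral_bessel_base \<alpha> in \<open>auto simp: bessel_base_nonneg Gamma_real_nonneg\<close>)

lemma set_integrable_bessel_base: "set_integrable lborel {0..} (bessel_base \<alpha> A)"
proof (rule set_integrable_atLeast_0(1))
  have "integrable lborel (\<lambda>s. indicator {0<..} s * bessel_base \<alpha> A s)"
    using has_bochner_integral_bessel_base by (rule integrable.intros)
  thus "set_integrable lborel {0<..} (bessel_base \<alpha> A)" by (simp add: set_integrable_def)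
qed

end

section \<open>The series\<close>

text \<open>Termwise differentiation by the M-test. It is used with \<open>a = s / 2\<close>,
  because the available bounds degenerate at the origin.\<close>

lemma has_real_derivative_suminf:
  fixes f f' :: "nat \<Rightarrow> real \<Rightarrow> real"
  assumes deriv: "\<And>n x. x > a \<Longrightarrow> (f n has_real_derivative f' n x) (at x)"
    and bound: "\<And>n x. x > a \<Longrightarrow> \<bar>f' n x\<bar> \<le> M n" and M: "summable M"
    and x: "x > a" and sm: "summable (\<lambda>n. f n x)"
  shows "((\<lambda>x. \<Sum>n. f n x) has_real_derivative (\<Sum>n. f' n x)) (at x)"
proof (rule has_field_derivative_series'(2)[of "{a<..}" _ _ x])
  show "(f n has_real_derivative f' n y) (at y within {a<..})" if "y \<in> {a<..}" for n y
    using deriv[of y n] that by (auto intro: has_field_derivative_at_within)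
  show "uniformly_convergent_on {a<..} (\<lambda>n y. \<Sum>i<n. f' i y)"
    using bound M by (intro Weierstrass_m_test'[where M = M]) auto
qed (use x sm in \<open>auto simp: interior_open\<close>)

text \<open>The series of the theorem for \<open>x \<ge> 0\<close>, without its normalising factor;
  the link is \<open>series_term_eq\<close>.\<close>

definition profile :: "real \<Rightarrow> real \<Rightarrow> real \<Rightarrow> real \<Rightarrow> real" where
  "profile \<theta> \<alpha> A s = (\<Sum>n. coeff_a \<theta> \<alpha> n / \<theta> ^ n * bessel_base \<alpha> A (\<theta> ^ n * s))"

definition profile' :: "real \<Rightarrow> real \<Rightarrow> real \<Rightarrow> real \<Rightarrow> real" where
  "profile' \<theta> \<alpha> A s = (\<Sum>n. coeff_a \<theta> \<alpha> n * bessel_base' \<alpha> A (\<theta> ^ n * s))"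

section \<open>Termwise calculus on the series\<close>

context
  fixes \<theta> \<alpha> A :: real
  assumes \<theta>: "\<theta> > 1" and \<alpha>: "0 \<le> \<alpha>" "\<alpha> < 2" and A: "A > 0"
begin

lemma \<theta>_power_ge_1: "\<theta> ^ n \<ge> 1" using \<theta> by simp

lemma profile_term_bound:
  "\<bar>coeff_a \<theta> \<alpha> n / \<theta> ^ n * bessel_base \<alpha> A s\<bar> \<le> \<bar>coeff_a \<theta> \<alpha> n\<bar> * (Gamma (1 / (2 - \<alpha>)) / 2)"
proof -
  have "\<bar>coeff_a \<theta> \<alpha> n\<bar> / \<theta> ^ n \<le> \<bar>coeff_a \<theta> \<alpha> n\<bar> / 1"
    using \<theta>_power_ge_1[of n] by (intro divide_left_mono) auto
  hence "\<bar>coeff_a \<theta> \<alpha> n\<bar> / \<theta> ^ n * bessel_base \<alpha> A s \<le> \<bar>coeff_a \<theta> \<alpha> n\<bar> / 1 * (Gamma (1 / (2 - \<alpha>)) / 2)"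
    using bessel_base_le[OF \<alpha> A] bessel_base_nonneg[OF \<alpha> A] \<theta> by (intro mult_mono) auto
  thus ?thesis using bessel_base_nonneg[OF \<alpha> A] \<theta> by (simp add: abs_mult)
qed

lemma summable_abs_coeff_a: "summable (\<lambda>n. \<bar>coeff_a \<theta> \<alpha> n\<bar> * c)"
  using summable_coeff_a[OF \<theta> \<alpha>(2), of 1] by (intro summable_mult2) simp

lemma summable_profile: "summable (\<lambda>n. coeff_a \<theta> \<alpha> n / \<theta> ^ n * bessel_base \<alpha> A (\<theta> ^ n * s))"
  by (rule summable_comparison_test'[OF summable_abs_coeff_a]) (simp only: real_norm_def, rule profile_term_bound)

lemma continuous_on_profile: "continuous_on {0..} (profile \<theta> \<alpha> A)"
  unfolding profile_def[abs_def]
proof (rule uniform_limit_theorem[where F = sequentially])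
  show "uniform_limit {0..} (\<lambda>n s. \<Sum>i<n. coeff_a \<theta> \<alpha> i / \<theta> ^ i * bessel_base \<alpha> A (\<theta> ^ i * s))
     (\<lambda>s. \<Sum>i. coeff_a \<theta> \<alpha> i / \<theta> ^ i * bessel_base \<alpha> A (\<theta> ^ i * s)) sequentially"
    by (rule Weierstrass_m_test[OF _ summable_abs_coeff_a]) (simp only: real_norm_def, rule profile_term_bound)
  show "\<forall>\<^sub>F n in sequentially. continuous_on {0..} (\<lambda>s. \<Sum>i<n. coeff_a \<theta> \<alpha> i / \<theta> ^ i * bessel_base \<alpha> A (\<theta> ^ i * s))"
    using \<theta> by (intro always_eventually allI continuous_intros continuous_on_compose2[OF continuous_on_bessel_base[OF \<alpha> A]]) auto
qed simp

lemma profile_deriv: "(profile \<theta> \<alpha> A has_real_derivative profile' \<theta> \<alpha> A s) (at s)" if "s > 0"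
  unfolding profile_def[abs_def] profile'_def
proof (rule has_real_derivative_suminf[where a = "s / 2"])
  fix n x assume "x > s / 2"
  hence x: "x > 0" using that by simp
  have "((\<lambda>s. bessel_base \<alpha> A (\<theta> ^ n * s)) has_real_derivative bessel_base' \<alpha> A (\<theta> ^ n * x) * \<theta> ^ n) (at x)"
    by (rule DERIV_chain2[OF bessel_base_deriv[OF \<alpha> A]]) (use x \<theta> in \<open>auto intro!: derivative_eq_intros\<close>)
  from DERIV_cmult[OF this, of "coeff_a \<theta> \<alpha> n / \<theta> ^ n"]
  show "((\<lambda>s. coeff_a \<theta> \<alpha> n / \<theta> ^ n * bessel_base \<alpha> A (\<theta> ^ n * s)) has_real_derivative coeff_a \<theta> \<alpha> n * bessel_base' \<alpha> A (\<theta> ^ n * x)) (at x)"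
    using \<theta> by simp
next
  fix n x assume x: "x > s / 2"
  have "\<theta> ^ n * x \<ge> 1 * (s / 2)" using x that \<theta>_power_ge_1[of n] by (intro mult_mono) auto
  hence le: "\<theta> ^ n * x \<ge> s / 2" by simp
  define G where "G = (2 - \<alpha>) * Gamma (1 / (2 - \<alpha>))"
  have G: "G \<ge> 0" using \<alpha> by (simp add: G_def Gamma_real_nonneg)
  have "\<bar>bessel_base' \<alpha> A (\<theta> ^ n * x)\<bar> \<le> G / (2 * (\<theta> ^ n * x))"
    unfolding G_def using le that by (intro bessel_base'_bound[OF \<alpha> A]) linarith
  also have "\<dots> \<le> G / s"
    using le that G by (intro divide_left_mono) auto
  finally show "\<bar>coeff_a \<theta> \<alpha> n * bessel_base' \<alpha> A (\<theta> ^ n * x)\<bar> \<le> \<bar>coeff_a \<theta> \<alpha> n\<bar> * (G / s)"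
    by (simp only: abs_mult) (rule mult_left_mono, auto)
qed (rule summable_abs_coeff_a, use that in simp, rule summable_profile)

text \<open>The left side is the second derivative stripped of \<open>K * s powr - \<alpha>\<close>.
  The recurrence of the coefficients splits its term \<open>n + 1\<close> into term
  \<open>n + 1\<close> of the profile at \<open>s\<close> and term \<open>n\<close> of the profile
  at \<open>\<theta> * s\<close>; both involve \<open>bessel_base\<close> at the same point.\<close>

lemma profile_equation:
  "(\<Sum>n. coeff_a \<theta> \<alpha> n * \<theta> powr (real n * (1 - \<alpha>)) * bessel_base \<alpha> A (\<theta> ^ n * s)) =
     profile \<theta> \<alpha> A s - \<theta> powr (1 - \<alpha>) * profile \<theta> \<alpha> A (\<theta> * s)"
proof -
  define g where "g = (\<lambda>n. coeff_a \<theta> \<alpha> n / \<theta> ^ n * bessel_base \<alpha> A (\<theta> ^ n * s))"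
  define h where "h = (\<lambda>n. coeff_a \<theta> \<alpha> n / \<theta> ^ n * bessel_base \<alpha> A (\<theta> ^ n * (\<theta> * s)))"
  define k where "k = (\<lambda>n. coeff_a \<theta> \<alpha> n * \<theta> powr (real n * (1 - \<alpha>)) * bessel_base \<alpha> A (\<theta> ^ n * s))"
  have g: "summable g" and h: "summable h" unfolding g_def h_def by (rule summable_profile)+
  have eq: "k (Suc n) = g (Suc n) - \<theta> powr (1 - \<alpha>) * h n" for n
  proof -
    define Y where "Y = \<theta> powr (real (Suc n) * (2 - \<alpha>))"
    have Y: "Y > 1" unfolding Y_def by (rule powr_gt_1[OF \<theta> \<alpha>(2)]) (use \<alpha> in auto)
    have "coeff_a \<theta> \<alpha> (Suc n) * (1 - Y) = coeff_a \<theta> \<alpha> n * \<theta> powr (2 - \<alpha>)"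
      using Y by (simp add: coeff_a_Suc[OF \<theta> \<alpha>(2)] Y_def)
    hence c: "coeff_a \<theta> \<alpha> (Suc n) * Y = coeff_a \<theta> \<alpha> (Suc n) - coeff_a \<theta> \<alpha> n * \<theta> powr (2 - \<alpha>)"
      by (simp add: algebra_simps)
    have "\<theta> powr (real (Suc n) * (1 - \<alpha>)) = \<theta> powr (real (Suc n) * (2 - \<alpha>) - real (Suc n))"
      by (simp add: algebra_simps)
    also have "\<dots> = Y / \<theta> ^ Suc n"
      unfolding powr_diff Y_def using \<theta> by (subst powr_realpow) auto
    finally have p: "\<theta> powr (real (Suc n) * (1 - \<alpha>)) = Y / \<theta> ^ Suc n" .
    have "\<theta> powr (2 - \<alpha>) = \<theta> powr (1 - \<alpha>) * \<theta> powr 1" by (simp only: powr_add[symmetric]) simp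
    hence q: "\<theta> powr (2 - \<alpha>) = \<theta> powr (1 - \<alpha>) * \<theta>" using \<theta> by simp
    have "k (Suc n) = coeff_a \<theta> \<alpha> (Suc n) * Y / \<theta> ^ Suc n * bessel_base \<alpha> A (\<theta> ^ Suc n * s)"
      unfolding k_def p by simp
    also have "\<dots> = g (Suc n) - \<theta> powr (1 - \<alpha>) * h n"
      unfolding c q g_def h_def using \<theta> by (simp add: field_simps)
    finally show ?thesis .
  qed
  have "summable (\<lambda>n. k (Suc n))"
    unfolding eq using g h by (intro summable_diff summable_mult) (auto simp: summable_Suc_iff)
  hence k: "summable k" by (subst (asm) summable_Suc_iff)
  have "(\<Sum>n. k n) = k 0 + (\<Sum>n. k (Suc n))" by (subst suminf_split_head[OF k]) simp
  also have "(\<Sum>n. k (Suc n)) = (\<Sum>n. g (Suc n)) - \<theta> powr (1 - \<alpha>) * (\<Sum>n. h n)"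
    unfolding eq using g h 
    by (subst suminf_diff[symmetric]) (auto simp: summable_Suc_iff suminf_mult intro!: summable_mult)
  also have "k 0 = g 0" using \<theta> by (simp add: k_def g_def)
  also have "g 0 + ((\<Sum>n. g (Suc n)) - \<theta> powr (1 - \<alpha>) * (\<Sum>n. h n)) = (\<Sum>n. g n) - \<theta> powr (1 - \<alpha>) * (\<Sum>n. h n)"
    by (subst suminf_split_head[OF g]) simp
  finally show ?thesis by (simp add: k_def g_def h_def profile_def)
qed

text \<open>Term \<open>n\<close> of the second derivative carries
  \<open>\<theta> ^ n * (\<theta> ^ n * s) powr - \<alpha>\<close>; factoring out
  \<open>s powr - \<alpha>\<close> leaves \<open>\<theta> powr (real n * (1 - \<alpha>))\<close>,
  and \<open>profile_equation\<close> sums the rest.\<close>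

lemma profile'_deriv: 
  "(profile' \<theta> \<alpha> A has_real_derivative A * (2 - \<alpha>)\<^sup>2 * s powr - \<alpha> * (profile \<theta> \<alpha> A s - \<theta> powr (1 - \<alpha>) * profile \<theta> \<alpha> A (\<theta> * s))) (at s)" 
  if s: "s > 0"
proof -
  define K where "K = A * (2 - \<alpha>)\<^sup>2"
  have K: "K \<ge> 0" using A by (simp add: K_def)
  have pow: "\<theta> ^ n * (K * (\<theta> ^ n * x) powr - \<alpha> * b) = K * x powr - \<alpha> * (\<theta> powr (real n * (1 - \<alpha>)) * b)"
    if "x > 0" for n x b
  proof -
    have "\<theta> powr (real n * (1 - \<alpha>)) = \<theta> powr (real n + real n * (- \<alpha>))" by (simp add: algebra_simps)
    also have "\<dots> = \<theta> ^ n * (\<theta> ^ n) powr - \<alpha>"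
      unfolding powr_add using \<theta> by (simp add: powr_realpow[symmetric] powr_powr)
    finally show ?thesis using that \<theta> by (simp add: powr_mult)
  qed
  have "((\<lambda>s. \<Sum>n. coeff_a \<theta> \<alpha> n * bessel_base' \<alpha> A (\<theta> ^ n * s)) has_real_derivative 
     (\<Sum>n. coeff_a \<theta> \<alpha> n * (\<theta> ^ n * (K * (\<theta> ^ n * s) powr - \<alpha> * bessel_base \<alpha> A (\<theta> ^ n * s))))) (at s)"
  proof (rule has_real_derivative_suminf[where a = "s / 2"])
    fix n x assume "x > s / 2"
    hence x: "x > 0" using that by simp
    have "((\<lambda>s. bessel_base' \<alpha> A (\<theta> ^ n * s)) has_real_derivative (K * (\<theta> ^ n * x) powr - \<alpha> * bessel_base \<alpha> A (\<theta> ^ n * x)) * \<theta> ^ n) (at x)"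
      unfolding K_def
      by (rule DERIV_chain2[OF bessel_base'_deriv[OF \<alpha> A]]) (use x \<theta> in \<open>auto intro!: derivative_eq_intros\<close>)
    from DERIV_cmult[OF this, of "coeff_a \<theta> \<alpha> n"]
    show "((\<lambda>s. coeff_a \<theta> \<alpha> n * bessel_base' \<alpha> A (\<theta> ^ n * s)) has_real_derivative 
       coeff_a \<theta> \<alpha> n * (\<theta> ^ n * (K * (\<theta> ^ n * x) powr - \<alpha> * bessel_base \<alpha> A (\<theta> ^ n * x)))) (at x)"
      by (simp add: mult_ac)
  next
    fix n x assume x: "x > s / 2"
    have "\<theta> ^ n * x \<ge> 1 * (s / 2)" using x that \<theta>_power_ge_1[of n] by (intro mult_mono) auto
    hence "(\<theta> ^ n * x) powr - \<alpha> \<le> (s / 2) powr - \<alpha>" using \<alpha> s by (intro powr_mono2') auto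
    hence "K * (\<theta> ^ n * x) powr - \<alpha> * bessel_base \<alpha> A (\<theta> ^ n * x) \<le> K * (s / 2) powr - \<alpha> * (Gamma (1 / (2 - \<alpha>)) / 2)"
      using K bessel_base_le[OF \<alpha> A] bessel_base_nonneg[OF \<alpha> A] by (intro mult_mono mult_nonneg_nonneg) auto
    hence "\<bar>coeff_a \<theta> \<alpha> n\<bar> * (\<theta> ^ n * (K * (\<theta> ^ n * x) powr - \<alpha> * bessel_base \<alpha> A (\<theta> ^ n * x)))
        \<le> \<bar>coeff_a \<theta> \<alpha> n\<bar> * (\<theta> ^ n * (K * (s / 2) powr - \<alpha> * (Gamma (1 / (2 - \<alpha>)) / 2)))"
      using \<theta> by (intro mult_left_mono) auto
    thus "\<bar>coeff_a \<theta> \<alpha> n * (\<theta> ^ n * (K * (\<theta> ^ n * x) powr - \<alpha> * bessel_base \<alpha> A (\<theta> ^ n * x)))\<bar>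
        \<le> (\<bar>coeff_a \<theta> \<alpha> n\<bar> * \<theta> ^ n) * (K * (s / 2) powr - \<alpha> * (Gamma (1 / (2 - \<alpha>)) / 2))"
      using \<theta> K bessel_base_nonneg[OF \<alpha> A] by (simp add: abs_mult mult_ac)
  next
    \<comment> \<open>The extra factor \<open>\<theta> ^ n\<close> is absorbed by
      \<open>summable_coeff_a\<close> with \<open>R = \<theta>\<close>.\<close>
    show "summable (\<lambda>n. (\<bar>coeff_a \<theta> \<alpha> n\<bar> * \<theta> ^ n) * (K * (s / 2) powr - \<alpha> * (Gamma (1 / (2 - \<alpha>)) / 2)))"
      using summable_coeff_a[OF \<theta> \<alpha>(2), of \<theta>] \<theta> by (intro summable_mult2) auto
    show "summable (\<lambda>n. coeff_a \<theta> \<alpha> n * bessel_base' \<alpha> A (\<theta> ^ n * s))"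
    proof (rule summable_comparison_test'[OF summable_abs_coeff_a])
      fix n
      define G where "G = (2 - \<alpha>) * Gamma (1 / (2 - \<alpha>))"
      have G: "G \<ge> 0" using \<alpha> by (simp add: G_def Gamma_real_nonneg)
      have "\<theta> ^ n * s \<ge> 1 * s" using that \<theta>_power_ge_1[of n] by (intro mult_right_mono) auto
      hence le: "\<theta> ^ n * s \<ge> s" by simp
      have "\<bar>bessel_base' \<alpha> A (\<theta> ^ n * s)\<bar> \<le> G / (2 * (\<theta> ^ n * s))"
        unfolding G_def using le that by (intro bessel_base'_bound[OF \<alpha> A]) linarith
      also have "\<dots> \<le> G / (2 * s)"
        using le that G by (intro divide_left_mono) auto
      finally show "norm (coeff_a \<theta> \<alpha> n * bessel_base' \<alpha> A (\<theta> ^ n * s)) \<le> \<bar>coeff_a \<theta> \<alpha> n\<bar> * (((2 - \<alpha>) * Gamma (1 / (2 - \<alpha>))) / (2 * s))"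
        unfolding G_def[symmetric] real_norm_def
        by (simp only: abs_mult) (rule mult_left_mono, auto)
    qed
  qed (use that in auto)
  also have "(\<lambda>s. \<Sum>n. coeff_a \<theta> \<alpha> n * bessel_base' \<alpha> A (\<theta> ^ n * s)) = profile' \<theta> \<alpha> A"
    by (simp add: profile'_def fun_eq_iff)
  also have "(\<Sum>n. coeff_a \<theta> \<alpha> n * (\<theta> ^ n * (K * (\<theta> ^ n * s) powr - \<alpha> * bessel_base \<alpha> A (\<theta> ^ n * s)))) =
      (\<Sum>n. (K * s powr - \<alpha>) * (coeff_a \<theta> \<alpha> n * \<theta> powr (real n * (1 - \<alpha>)) * bessel_base \<alpha> A (\<theta> ^ n * s)))"
    unfolding pow[OF s] by (simp add: mult_ac)
  also have "\<dots> = K * s powr - \<alpha> * (\<Sum>n. coeff_a \<theta> \<alpha> n * \<theta> powr (real n * (1 - \<alpha>)) * bessel_base \<alpha> A (\<theta> ^ n * s))"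
  proof (rule suminf_mult)
    have "\<theta> powr (1 - \<alpha>) \<le> \<theta> powr 1" using \<theta> \<alpha> by (intro powr_mono) auto
    hence t: "\<theta> powr (real n * (1 - \<alpha>)) \<le> \<theta> ^ n" for n
      using power_mono[of "\<theta> powr (1 - \<alpha>)" \<theta> n] \<theta>
      by (simp add: powr_realpow[symmetric] powr_powr mult.commute)
    show "summable (\<lambda>n. coeff_a \<theta> \<alpha> n * \<theta> powr (real n * (1 - \<alpha>)) * bessel_base \<alpha> A (\<theta> ^ n * s))"
    proof (rule summable_comparison_test'[OF summable_mult2[OF summable_coeff_a[OF \<theta> \<alpha>(2)]]])
      show "norm (coeff_a \<theta> \<alpha> n * \<theta> powr (real n * (1 - \<alpha>)) * bessel_base \<alpha> A (\<theta> ^ n * s)) \<le> 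
          \<bar>coeff_a \<theta> \<alpha> n\<bar> * \<theta> ^ n * (Gamma (1 / (2 - \<alpha>)) / 2)" for n
        unfolding real_norm_def abs_mult using t[of n] bessel_base_le[OF \<alpha> A] bessel_base_nonneg[OF \<alpha> A] \<theta>
        by (intro mult_mono) auto
    qed (use \<theta> in auto)
  qed
  finally show ?thesis unfolding profile_equation by (simp add: K_def)
qed

lemma profile_0: "profile \<theta> \<alpha> A 0 = coeff_gf \<theta> \<alpha> (1 / \<theta>) * (Gamma (1 / (2 - \<alpha>)) / 2)"
  unfolding profile_def coeff_gf_def[OF \<theta> \<alpha>(2)] using summable_coeff_a'[OF \<theta> \<alpha>(2), of "1 / \<theta>"]
  by (subst suminf_mult2) (auto simp: bessel_base_0[OF \<alpha> A] power_divide)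

text \<open>The point \<open>1 / \<theta>\<close> lies between 0 and 1, where Euler's product is
  positive.\<close>

lemma profile_0_pos: "profile \<theta> \<alpha> A 0 > 0"
  unfolding profile_0 using \<theta> \<alpha> by (intro mult_pos_pos coeff_gf_prodinf(2)) (auto intro: Gamma_real_pos)

text \<open>Rescaling by \<open>\<theta> ^ n\<close> turns each term into the same integral
  \<open>I\<close>; weight, coefficient and Jacobian combine to the n-th power of
  \<open>\<theta> powr (\<gamma> - 2)\<close>. The choice \<gamma> = 0 gives the total mass,
  \<gamma> = \<alpha> the value of \<open>weighted_tail\<close> at 0.\<close>

lemma profile_weighted_integral:
  assumes bessel_base: "has_bochner_integral lborel (\<lambda>s. indicator {0<..} s * (s powr - \<gamma> * bessel_base \<alpha> A s)) I"
    and \<gamma>: "\<gamma> < 2"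
  shows "has_bochner_integral lborel (\<lambda>s. indicator {0<..} s * (s powr - \<gamma> * profile \<theta> \<alpha> A s)) 
           (coeff_gf \<theta> \<alpha> (\<theta> powr (\<gamma> - 2)) * I)"
proof -
  define b where "b = (\<lambda>s. indicator {0<..} s * (s powr - \<gamma> * bessel_base \<alpha> A s))"
  define f where "f = (\<lambda>n s. coeff_a \<theta> \<alpha> n / \<theta> ^ n * (indicator {0<..} s * (s powr - \<gamma> * bessel_base \<alpha> A (\<theta> ^ n * s))))"
  define q where "q = \<theta> powr (\<gamma> - 2)"
  have b_nonneg: "b s \<ge> 0" for s by (simp add: b_def bessel_base_nonneg[OF \<alpha> A])
  have q: "\<theta> powr (real n * \<gamma>) * (inverse (\<theta> ^ n) * inverse (\<theta> ^ n)) = q ^ n" for n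
  proof -
    have "q ^ n = \<theta> powr (real n * \<gamma> + (- real n) + (- real n))" 
      using \<theta> by (simp add: q_def powr_realpow[symmetric] powr_powr algebra_simps)
    thus ?thesis unfolding powr_add powr_minus using \<theta> by (simp add: powr_realpow mult_ac)
  qed
  have fb: "f n s = coeff_a \<theta> \<alpha> n * (\<theta> powr (real n * \<gamma>) * inverse (\<theta> ^ n)) * b (0 + \<theta> ^ n * s)" for n s
  proof (cases "s > 0")
    case True
    have "\<theta> powr (real n * \<gamma>) * (\<theta> ^ n * s) powr - \<gamma> = s powr - \<gamma>"
      using True \<theta> by (simp add: powr_mult powr_realpow[symmetric] powr_powr powr_add[symmetric] mult.assoc[symmetric])
    thus ?thesis using True \<theta> by (simp add: f_def b_def field_simps)
  next
    case False
    thus ?thesis using \<theta> by (simp add: f_def b_def zero_less_mult_iff)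
  qed
  have bi: "has_bochner_integral lborel (\<lambda>s. b (0 + \<theta> ^ n * s)) (I * inverse (\<theta> ^ n))" for n
  proof -
    have "has_bochner_integral lborel b I" using bessel_base by (simp add: b_def)
    hence "has_bochner_integral lborel (\<lambda>s. b (0 + \<theta> ^ n * s)) (I /\<^sub>R \<bar>\<theta> ^ n\<bar>)"
      using \<theta> by (subst (asm) lborel_has_bochner_integral_real_affine_iff[of "\<theta> ^ n" _ _ 0]) auto
    thus ?thesis using \<theta> by (simp add: mult.commute)
  qed
  have fi: "has_bochner_integral lborel (f n) (coeff_a \<theta> \<alpha> n * q ^ n * I)" for n
  proof -
    have "has_bochner_integral lborel (f n) (coeff_a \<theta> \<alpha> n * (\<theta> powr (real n * \<gamma>) * inverse (\<theta> ^ n)) * (I * inverse (\<theta> ^ n)))"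
      unfolding fb[abs_def] by (intro has_bochner_integral_mult_right bi)
    thus ?thesis unfolding q[symmetric] by (simp add: mult_ac)
  qed
  have nfi: "has_bochner_integral lborel (\<lambda>s. norm (f n s)) (\<bar>coeff_a \<theta> \<alpha> n\<bar> * q ^ n * I)" for n
  proof -
    have "norm (f n s) = \<bar>coeff_a \<theta> \<alpha> n\<bar> * (\<theta> powr (real n * \<gamma>) * inverse (\<theta> ^ n)) * b (0 + \<theta> ^ n * s)" for s
      unfolding fb using \<theta> b_nonneg by (simp add: abs_mult)
    moreover have "has_bochner_integral lborel (\<lambda>s. \<bar>coeff_a \<theta> \<alpha> n\<bar> * (\<theta> powr (real n * \<gamma>) * inverse (\<theta> ^ n)) * b (0 + \<theta> ^ n * s)) 
         (\<bar>coeff_a \<theta> \<alpha> n\<bar> * (\<theta> powr (real n * \<gamma>) * inverse (\<theta> ^ n)) * (I * inverse (\<theta> ^ n)))"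
      by (intro has_bochner_integral_mult_right bi)
    ultimately show ?thesis unfolding q[symmetric] by (simp add: mult_ac)
  qed
  have sm: "summable (\<lambda>n. norm (f n s))" for s
  proof -
    have "summable (\<lambda>n. \<bar>coeff_a \<theta> \<alpha> n\<bar> * (Gamma (1 / (2 - \<alpha>)) / 2) * (indicator {0<..} s * s powr - \<gamma>))"
      by (intro summable_mult2 summable_abs_coeff_a)
    thus ?thesis
    proof (rule summable_comparison_test')
      fix n
      have "norm (norm (f n s)) = \<bar>coeff_a \<theta> \<alpha> n / \<theta> ^ n * bessel_base \<alpha> A (\<theta> ^ n * s)\<bar> * (indicator {0<..} s * s powr - \<gamma>)"
        by (simp add: f_def abs_mult)
      also have "\<dots> \<le> \<bar>coeff_a \<theta> \<alpha> n\<bar> * (Gamma (1 / (2 - \<alpha>)) / 2) * (indicator {0<..} s * s powr - \<gamma>)"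
        by (intro mult_right_mono profile_term_bound) auto
      finally show "norm (norm (f n s)) \<le> \<dots>" .
    qed
  qed
  have "0 < q" using \<theta> by (simp add: q_def)
  \<comment> \<open>Summability of the integrals of the absolute values permits integrating the
    series termwise.\<close>
  have sum_int: "summable (\<lambda>n. LBINT s. norm (f n s))"
  proof -
    have "summable (\<lambda>n. \<bar>coeff_a \<theta> \<alpha> n\<bar> * q ^ n * I)"
      using summable_coeff_a[OF \<theta> \<alpha>(2), of q] \<open>0 < q\<close> by (intro summable_mult2) auto
    thus ?thesis using nfi by (simp add: has_bochner_integral_iff)
  qed
  have int: "integrable lborel (f n)" for n using fi by (simp add: has_bochner_integral_iff)
  have "has_bochner_integral lborel (\<lambda>s. \<Sum>n. f n s) (\<Sum>n. LBINT s. f n s)"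
    unfolding has_bochner_integral_iff
    using integrable_suminf[OF int AE_I2[OF sm] sum_int] integral_suminf[OF int AE_I2[OF sm] sum_int] by blast
  also have "(\<Sum>n. LBINT s. f n s) = (\<Sum>n. coeff_a \<theta> \<alpha> n * q ^ n * I)"
    using fi by (simp add: has_bochner_integral_iff)
  also have "\<dots> = coeff_gf \<theta> \<alpha> q * I"
    unfolding coeff_gf_def[OF \<theta> \<alpha>(2)] by (rule suminf_mult2[symmetric, OF summable_coeff_a'[OF \<theta> \<alpha>(2)]])
  also have "(\<lambda>s. \<Sum>n. f n s) = (\<lambda>s. indicator {0<..} s * (s powr - \<gamma> * profile \<theta> \<alpha> A s))"
  proof
    fix s
    have "(\<Sum>n. f n s) = (\<Sum>n. indicator {0<..} s * s powr - \<gamma> * (coeff_a \<theta> \<alpha> n / \<theta> ^ n * bessel_base \<alpha> A (\<theta> ^ n * s)))"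
      by (simp add: f_def mult_ac)
    also have "\<dots> = indicator {0<..} s * s powr - \<gamma> * profile \<theta> \<alpha> A s"
      unfolding profile_def by (rule suminf_mult[OF summable_profile])
    finally show "(\<Sum>n. f n s) = indicator {0<..} s * (s powr - \<gamma> * profile \<theta> \<alpha> A s)" by simp
  qed
  finally show ?thesis by (simp add: q_def)
qed

end

section \<open>Existence and uniqueness on the line\<close>

text \<open>L'Hopital's rule for the difference quotient. It supplies both derivatives at the origin
  when \<alpha> = 0.\<close>

lemma DERIV_removable:
  fixes h h' :: "real \<Rightarrow> real"
  assumes cont: "isCont h x" and deriv: "eventually (\<lambda>y. (h has_real_derivative h' y) (at y)) (at x)"
    and lim: "(h' \<longlongrightarrow> L) (at x)"
  shows "(h has_real_derivative L) (at x)"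
  unfolding has_field_derivative_iff
proof (rule lhopital)
  have "((\<lambda>y. h y - h x) \<longlongrightarrow> h x - h x) (at x)"
    using cont by (intro tendsto_intros) (simp add: isCont_def)
  thus "((\<lambda>y. h y - h x) \<longlongrightarrow> 0) (at x)" by simp
  have "((\<lambda>y. y - x) \<longlongrightarrow> x - x) (at x)" by (intro tendsto_intros)
  thus "((\<lambda>y. y - x) \<longlongrightarrow> 0) (at x)" by simp
  show "\<forall>\<^sub>F y in at x. y - x \<noteq> 0" by (simp add: eventually_at_filter)
  show "\<forall>\<^sub>F y in at x. ((\<lambda>y. h y - h x) has_real_derivative h' y) (at y)"
    using deriv by eventually_elim (auto intro!: derivative_eq_intros)
  show "\<forall>\<^sub>F y in at x. ((\<lambda>y. y - x) has_real_derivative 1) (at y)"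
    by (intro always_eventually allI) (auto intro!: derivative_eq_intros)
qed (use lim in auto)

lemma C2_onI:
  assumes S: "open S" and d1: "\<And>x. x \<in> S \<Longrightarrow> (p has_real_derivative p1 x) (at x)"
    and d2: "\<And>x. x \<in> S \<Longrightarrow> (p1 has_real_derivative p2 x) (at x)" and cont: "continuous_on S p2"
  shows "C2_on S p" and "\<And>x. x \<in> S \<Longrightarrow> deriv (deriv p) x = p2 x"
proof -
  have e1: "deriv p x = p1 x" if "x \<in> S" for x using d1[OF that] by (rule DERIV_imp_deriv)
  have d2': "(deriv p has_real_derivative p2 x) (at x)" if "x \<in> S" for x
    by (rule has_field_derivative_transform_within_open[OF d2[OF that] S that]) (simp add: e1)
  show e2: "deriv (deriv p) x = p2 x" if "x \<in> S" for x using d2'[OF that] by (rule DERIV_imp_deriv)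
  show "C2_on S p" unfolding C2_on_def
    using d1 d2' continuous_on_cong[of S S "deriv (deriv p)" p2] cont e2
    by (auto simp: real_differentiable_def)
qed

section \<open>Passage between the line and the half-line\<close>

lemma intensity_nonzero: "x \<noteq> 0 \<Longrightarrow> intensity l \<alpha> x = l * \<bar>x\<bar> powr - \<alpha>"
  by (simp add: intensity_def powr_minus divide_inverse)

lemma open_regular_points: "open (regular_points \<alpha>)"
proof (cases "\<alpha> = 0")
  case False
  hence "regular_points \<alpha> = - {0}" by (auto simp: regular_points_def)
  thus ?thesis by (simp add: open_Compl)
qed (simp add: regular_points_def)

lemma equation_rhs:
  assumes "\<sigma> > 0" "\<theta> > 1" "x \<noteq> 0"
  shows "(2 * intensity l \<alpha> x * a - 2 * \<theta> * intensity l \<alpha> (\<theta> * x) * b) / \<sigma>\<^sup>2 =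
     2 * l / \<sigma>\<^sup>2 * \<bar>x\<bar> powr - \<alpha> * (a - \<theta> powr (1 - \<alpha>) * b)"
proof -
  have "\<theta> * intensity l \<alpha> (\<theta> * x) = l * \<bar>x\<bar> powr - \<alpha> * (\<theta> powr 1 * \<theta> powr - \<alpha>)"
    using assms by (simp add: intensity_nonzero abs_mult powr_mult)
  also have "\<theta> powr 1 * \<theta> powr - \<alpha> = \<theta> powr (1 - \<alpha>)" by (simp only: powr_add[symmetric]) simp
  finally have "\<theta> * intensity l \<alpha> (\<theta> * x) = l * \<bar>x\<bar> powr - \<alpha> * \<theta> powr (1 - \<alpha>)" .
  hence 1: "2 * \<theta> * intensity l \<alpha> (\<theta> * x) * b = 2 * (l * \<bar>x\<bar> powr - \<alpha> * \<theta> powr (1 - \<alpha>)) * b"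
    by (simp only: mult.assoc)
  show ?thesis unfolding 1 unfolding intensity_nonzero[OF assms(3)] using assms(1) by (simp add: field_simps)
qed

lemma (in halfline_solution) continuous_on_even_extension: "continuous_on UNIV (\<lambda>x. C * f \<bar>x\<bar>)"
  by (intro continuous_intros continuous_on_compose2[OF cont]) auto

text \<open>Off the origin, one side is \<open>f\<close> itself and the other its reflection. The
  origin is a regular point only for \<alpha> = 0, and there \<open>f'_tendsto_0\<close> and
  evenness make both derivatives extend.\<close>

lemma (in halfline_solution) even_extension_solves:
  assumes \<sigma>: "\<sigma> > 0" and K_eq: "K = 2 * l / \<sigma>\<^sup>2"
  shows "C2_on (regular_points \<alpha>) (\<lambda>x. C * f \<bar>x\<bar>)" and "solves_equation \<theta> l \<sigma> \<alpha> (\<lambda>x. C * f \<bar>x\<bar>)"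
proof -
  define p where "p = (\<lambda>x. C * f \<bar>x\<bar>)"
  \<comment> \<open>The value 0 at the origin is the derivative there in the case \<alpha> =
    0.\<close>
  define p1 where "p1 = (\<lambda>x. C * (if x > 0 then f' x else if x < 0 then - f' (- x) else 0))"
  \<comment> \<open>The candidate second derivative is the right-hand side of the equation, so the
    equation is immediate and continuity is inherited from \<open>p\<close>.\<close>
  define p2 where "p2 = (\<lambda>x. (2 * intensity l \<alpha> x * p x - 2 * \<theta> * intensity l \<alpha> (\<theta> * x) * p (\<theta> * x)) / \<sigma>\<^sup>2)"
  have contp: "continuous_on UNIV p" unfolding p_def by (rule continuous_on_even_extension)
  have p2: "p2 x = C * (K * \<bar>x\<bar> powr - \<alpha> * (f \<bar>x\<bar> - \<theta> powr (1 - \<alpha>) * f (\<theta> * \<bar>x\<bar>)))" if "x \<noteq> 0" for x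
  proof -
    have "k * w * (C * a - t * (C * b)) = C * (k * w * (a - t * b))" for k w a t b :: real
      by (simp add: algebra_simps)
    moreover have "\<bar>\<theta> * x\<bar> = \<theta> * \<bar>x\<bar>" using \<theta> by (simp add: abs_mult)
    ultimately show ?thesis unfolding p2_def equation_rhs[OF \<sigma> \<theta> that] K_eq p_def by simp
  qed
  have contp2: "continuous_on (regular_points \<alpha>) p2"
  proof (cases "\<alpha> = 0")
    case True
    hence "p2 = (\<lambda>x. (2 * l * p x - 2 * \<theta> * l * p (\<theta> * x)) / \<sigma>\<^sup>2)"
      by (simp add: p2_def intensity_def)
    thus ?thesis using \<sigma>
      by (auto intro!: continuous_intros continuous_on_compose2[OF contp] continuous_on_subset[OF contp])
  next
    case False
    hence reg: "regular_points \<alpha> = - {0}" by (auto simp: regular_points_def)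
    have "continuous_on (- {0}) (\<lambda>x. 2 * l / \<sigma>\<^sup>2 * \<bar>x\<bar> powr - \<alpha> * (p x - \<theta> powr (1 - \<alpha>) * p (\<theta> * x)))"
      using \<sigma> by (auto intro!: continuous_intros continuous_on_compose2[OF contp] continuous_on_subset[OF contp])
    thus ?thesis unfolding reg
      by (rule continuous_on_eq) (simp add: p2_def equation_rhs[OF \<sigma> \<theta>])
  qed
  have d1: "(p has_real_derivative p1 x) (at x)" and d2: "(p1 has_real_derivative p2 x) (at x)" if "x \<noteq> 0" for x
  proof -
    have "(p has_real_derivative p1 x) (at x) \<and> (p1 has_real_derivative p2 x) (at x)"
    proof (cases "x > 0")
      case True
      have "(p has_real_derivative C * f' x) (at x)"
        by (rule has_field_derivative_transform_within_open[OF DERIV_cmult[OF deriv1[OF True]], where S = "{0<..}"])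
           (use True in \<open>auto simp: p_def\<close>)
      moreover have "(p1 has_real_derivative p2 x) (at x)"
        unfolding p2[OF that]
        by (rule has_field_derivative_transform_within_open[of "\<lambda>x. C * f' x" _ _ "{0<..}"])
           (use True DERIV_cmult[OF deriv2[OF True], of C] in \<open>auto simp: p1_def\<close>)
      ultimately show ?thesis using True by (simp add: p1_def)
    next
      case False
      hence x: "- x > 0" using that by simp
      have m: "(uminus has_real_derivative - 1) (at x)" by (auto intro!: derivative_eq_intros)
      have "(p has_real_derivative C * (f' (- x) * (- 1))) (at x)"
        by (rule has_field_derivative_transform_within_open[OF DERIV_cmult[OF DERIV_chain2[OF deriv1[OF x] m]], where S = "{..<0}"])
           (use x in \<open>auto simp: p_def\<close>)
      moreover have "(p1 has_real_derivative p2 x) (at x)"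
        unfolding p2[OF that]
        by (rule has_field_derivative_transform_within_open[of "\<lambda>x. (- C) * f' (- x)" _ _ "{..<0}"])
           (use x DERIV_cmult[OF DERIV_chain2[OF deriv2[OF x] m], of "- C"] in \<open>auto simp: p1_def\<close>)
      ultimately show ?thesis using x by (simp add: p1_def)
    qed
    thus "(p has_real_derivative p1 x) (at x)" "(p1 has_real_derivative p2 x) (at x)" by auto
  qed
  have d0: "(p has_real_derivative p1 0) (at 0) \<and> (p1 has_real_derivative p2 0) (at 0)" if "\<alpha> = 0"
  proof -
    have nz: "eventually (\<lambda>x::real. x \<noteq> 0) (at 0)" by (simp add: eventually_at_filter)
    have "(f' \<longlongrightarrow> 0) (at_right 0)" using that by (intro f'_tendsto_0) simp
    hence "((\<lambda>x. C * f' x) \<longlongrightarrow> C * 0) (at_right 0)" by (intro tendsto_intros)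
    hence R: "((\<lambda>x. C * f' x) \<longlongrightarrow> 0) (at_right 0)" by simp
    have "eventually (\<lambda>x. C * f' x = p1 x) (at_right 0)"
      using eventually_at_right_less[of 0] by eventually_elim (simp add: p1_def)
    with R have right: "(p1 \<longlongrightarrow> 0) (at_right 0)" by (rule Lim_transform_eventually)
    have "((\<lambda>x. - p1 (- x)) \<longlongrightarrow> - 0) (at_left 0)"
      using right by (intro tendsto_minus) (simp add: filterlim_at_left_to_right)
    moreover have "- p1 (- x) = p1 x" for x by (simp add: p1_def)
    ultimately have "(p1 \<longlongrightarrow> 0) (at_left 0)" by simp
    with right have lim1: "(p1 \<longlongrightarrow> 0) (at 0)" by (simp add: filterlim_at_split)
    have p10: "p1 0 = 0" by (simp add: p1_def)
    have "(p has_real_derivative 0) (at 0)"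
      by (rule DERIV_removable[OF _ _ lim1]) 
         (use contp d1 nz in \<open>auto simp: continuous_on_eq_continuous_at elim: eventually_mono\<close>)
    moreover have "(p1 has_real_derivative p2 0) (at 0)"
    proof (rule DERIV_removable)
      show "isCont p1 0" using lim1 by (simp add: isCont_def p10)
      show "eventually (\<lambda>y. (p1 has_real_derivative p2 y) (at y)) (at 0)"
        using nz by eventually_elim (rule d2)
      have "continuous_on UNIV p2" using contp2 that by (simp add: regular_points_def)
      thus "(p2 \<longlongrightarrow> p2 0) (at 0)" by (auto simp: continuous_on_eq_continuous_at isCont_def)
    qed
    ultimately show ?thesis by (simp add: p10)
  qed
  have reg: "(p has_real_derivative p1 x) (at x)" "(p1 has_real_derivative p2 x) (at x)" if "x \<in> regular_points \<alpha>" for x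
    using that d1[of x] d2[of x] d0 by (cases "x = 0"; auto simp: regular_points_def)+
  note C2 = C2_onI[OF open_regular_points reg contp2]
  show "C2_on (regular_points \<alpha>) (\<lambda>x. C * f \<bar>x\<bar>)" using C2(1) by (simp add: p_def)
  show "solves_equation \<theta> l \<sigma> \<alpha> (\<lambda>x. C * f \<bar>x\<bar>)"
    unfolding solves_equation_def p_def[symmetric] using C2(2) \<sigma> by (simp add: p2_def p_def)
qed

lemma probability_density_iff:
  "probability_density p \<longleftrightarrow> p \<in> borel_measurable borel \<and> (\<forall>x. 0 \<le> p x) \<and> integrable lborel p \<and> (LBINT x. p x) = 1"
proof -
  have "prob_space (density lborel (\<lambda>x. ennreal (p x))) \<longleftrightarrow> integrable lborel p \<and> (LBINT x. p x) = 1"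
    if [measurable]: "p \<in> borel_measurable borel" and nonneg: "\<forall>x. 0 \<le> p x"
  proof -
    have "prob_space (density lborel (\<lambda>x. ennreal (p x))) \<longleftrightarrow> (\<integral>\<^sup>+x. ennreal (p x) \<partial>lborel) = ennreal 1"
    proof -
      have "emeasure (density lborel (\<lambda>x. ennreal (p x))) UNIV = (\<integral>\<^sup>+x. ennreal (p x) \<partial>lborel)"
        by (subst emeasure_density) auto
      thus ?thesis
        using prob_space.emeasure_space_1[of "density lborel (\<lambda>x. ennreal (p x))"]
          prob_spaceI[of "density lborel (\<lambda>x. ennreal (p x))"] by auto
    qed
    also have "\<dots> \<longleftrightarrow> integrable lborel p \<and> (LBINT x. p x) = 1"
      using nn_integral_eq_integrable[of p lborel 1] nonneg by auto
    finally show ?thesis .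
  qed
  thus ?thesis unfolding probability_density_def by blast
qed

text \<open>One half is the restriction, the other the reflection, which respects the equation
  because the intensity is even.\<close>

lemma solution_halfline:
  assumes "\<theta> > 1" "l > 0" "\<sigma> > 0" "0 \<le> \<alpha>" "\<alpha> < 2"
    and C2: "C2_density \<alpha> p" and eq: "solves_equation \<theta> l \<sigma> \<alpha> p"
  shows "halfline_solution (2 * l / \<sigma>\<^sup>2) \<theta> \<alpha> p (deriv p)"
    and "halfline_solution (2 * l / \<sigma>\<^sup>2) \<theta> \<alpha> (\<lambda>x. p (- x)) (\<lambda>x. - deriv p (- x))"
proof -
  have int: "integrable lborel p" and cont: "continuous_on UNIV p"
    using C2 by (auto simp: C2_density_def probability_density_iff)
  have d1: "(p has_real_derivative deriv p x) (at x)" if "x \<noteq> 0" for x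
    using C2 that by (auto simp: C2_density_def C2_on_def regular_points_def DERIV_deriv_iff_real_differentiable)
  have d2: "(deriv p has_real_derivative 2 * l / \<sigma>\<^sup>2 * \<bar>x\<bar> powr - \<alpha> * (p x - \<theta> powr (1 - \<alpha>) * p (\<theta> * x))) (at x)" 
    if "x \<noteq> 0" for x
  proof -
    have "x \<in> regular_points \<alpha>" using that by (simp add: regular_points_def)
    hence "deriv p differentiable at x" 
      and e: "\<sigma>\<^sup>2 * deriv (deriv p) x = 2 * intensity l \<alpha> x * p x - 2 * \<theta> * intensity l \<alpha> (\<theta> * x) * p (\<theta> * x)"
      using C2 eq by (auto simp: C2_density_def C2_on_def solves_equation_def)
    hence "(deriv p has_real_derivative deriv (deriv p) x) (at x)"
      by (simp add: DERIV_deriv_iff_real_differentiable)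
    also have "deriv (deriv p) x = (2 * intensity l \<alpha> x * p x - 2 * \<theta> * intensity l \<alpha> (\<theta> * x) * p (\<theta> * x)) / \<sigma>\<^sup>2"
      using e assms by (simp add: field_simps)
    also have "\<dots> = 2 * l / \<sigma>\<^sup>2 * \<bar>x\<bar> powr - \<alpha> * (p x - \<theta> powr (1 - \<alpha>) * p (\<theta> * x))"
      by (rule equation_rhs) fact+
    finally show ?thesis .
  qed
  show "halfline_solution (2 * l / \<sigma>\<^sup>2) \<theta> \<alpha> p (deriv p)"
  proof
    show "set_integrable lborel {0..} p"
      unfolding set_integrable_def using int by (intro integrable_mult_indicator) auto
    show "(deriv p has_real_derivative 2 * l / \<sigma>\<^sup>2 * s powr - \<alpha> * (p s - \<theta> powr (1 - \<alpha>) * p (\<theta> * s))) (at s)" 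
      if "s > 0" for s using d2[of s] that by simp
  qed (use assms d1 in \<open>auto intro: continuous_on_subset[OF cont]\<close>)
  show "halfline_solution (2 * l / \<sigma>\<^sup>2) \<theta> \<alpha> (\<lambda>x. p (- x)) (\<lambda>x. - deriv p (- x))"
  proof
    have "integrable lborel (\<lambda>x. p (0 + (- 1) * x))"
      using int by (intro lborel_integrable_real_affine) auto
    thus "set_integrable lborel {0..} (\<lambda>x. p (- x))"
      unfolding set_integrable_def by (intro integrable_mult_indicator) auto
    show "continuous_on {0..} (\<lambda>x. p (- x))"
      by (intro continuous_on_compose2[OF cont] continuous_intros) auto
    fix s :: real assume s: "s > 0"
    have m: "(uminus has_real_derivative - 1) (at s)" by (auto intro!: derivative_eq_intros)
    have "((\<lambda>x. p (- x)) has_real_derivative deriv p (- s) * (- 1)) (at s)"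
      by (rule DERIV_chain2[OF d1 m]) (use s in simp)
    thus "((\<lambda>x. p (- x)) has_real_derivative - deriv p (- s)) (at s)" by simp
    have "((\<lambda>x. deriv p (- x)) has_real_derivative 
        2 * l / \<sigma>\<^sup>2 * \<bar>- s\<bar> powr - \<alpha> * (p (- s) - \<theta> powr (1 - \<alpha>) * p (\<theta> * - s)) * (- 1)) (at s)"
      by (rule DERIV_chain2[OF d2 m]) (use s in simp)
    from DERIV_minus[OF this] s
    show "((\<lambda>x. - deriv p (- x)) has_real_derivative 2 * l / \<sigma>\<^sup>2 * s powr - \<alpha> * (p (- s) - \<theta> powr (1 - \<alpha>) * p (- (\<theta> * s)))) (at s)"
      by simp
  qed (use assms in auto)
qed

section \<open>The profile as generator of all half-line solutions\<close>

context
  fixes \<theta> \<alpha> A :: real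
  assumes \<theta>: "\<theta> > 1" and \<alpha>: "0 \<le> \<alpha>" "\<alpha> < 2" and A: "A > 0"
begin

lemma profile_integral:
  "set_integrable lborel {0..} (profile \<theta> \<alpha> A)"
  "(LBINT s:{0..}. profile \<theta> \<alpha> A s) = coeff_gf \<theta> \<alpha> (\<theta> powr - 2) *
     (Gamma (1 / (2 - \<alpha>)) * Gamma (2 / (2 - \<alpha>)) * A powr - (1 / (2 - \<alpha>)) / (2 * (2 - \<alpha>)))"
proof -
  have e: "indicator {0<..} s * (s powr - 0 * g s) = indicator {0<..} s *\<^sub>R g s" for s and g :: "real \<Rightarrow> real"
    by (simp add: indicator_def)
  note b = profile_weighted_integral[OF \<theta> \<alpha> A, of 0, unfolded e, simplified real_scaleR_def, OF has_bochner_integral_bessel_base[OF \<alpha> A]]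
  have s: "set_integrable lborel {0<..} (profile \<theta> \<alpha> A)"
    using b by (simp add: set_integrable_def has_bochner_integral_iff)
  show "set_integrable lborel {0..} (profile \<theta> \<alpha> A)" by (rule set_integrable_atLeast_0(1)[OF s])
  show "(LBINT s:{0..}. profile \<theta> \<alpha> A s) = coeff_gf \<theta> \<alpha> (\<theta> powr - 2) *
     (Gamma (1 / (2 - \<alpha>)) * Gamma (2 / (2 - \<alpha>)) * A powr - (1 / (2 - \<alpha>)) / (2 * (2 - \<alpha>)))"
    using b by (subst set_integrable_atLeast_0(2)[OF s]) (simp add: set_lebesgue_integral_def has_bochner_integral_iff)
qed

lemma halfline_solution_profile:
  "halfline_solution (A * (2 - \<alpha>)\<^sup>2) \<theta> \<alpha> (profile \<theta> \<alpha> A) (profile' \<theta> \<alpha> A)"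
  by standard (use \<theta> \<alpha> A profile_integral(1) continuous_on_profile[OF \<theta> \<alpha> A] profile_deriv[OF \<theta> \<alpha> A] 
      profile'_deriv[OF \<theta> \<alpha> A] in auto)

text \<open>For \<alpha> \<ge> 1 this is the generating function at \<open>1 / \<theta>\<close>, for
  \<alpha> < 1 the one at \<open>\<theta> powr (\<alpha> - 2)\<close>, each times a positive
  constant; both points lie between 0 and 1.\<close>

lemma profile_boundary_value_pos: "halfline_solution.boundary_value \<alpha> (profile \<theta> \<alpha> A) > 0"
proof -
  interpret P: halfline_solution "A * (2 - \<alpha>)\<^sup>2" \<theta> \<alpha> "profile \<theta> \<alpha> A" "profile' \<theta> \<alpha> A"
    by (rule halfline_solution_profile)
  show ?thesis
  proof (cases "\<alpha> \<ge> 1")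
    case True
    thus ?thesis using profile_0_pos[OF \<theta> \<alpha> A] by (simp add: P.boundary_value_def)
  next
    case False
    define b where "b = (\<lambda>s. indicator {0<..} s * (s powr - \<alpha> * bessel_base \<alpha> A s))"
    have b: "indicator {0..} s *\<^sub>R (s powr - \<alpha> * g s) = indicator {0<..} s * (s powr - \<alpha> * g s)" 
      for s and g :: "real \<Rightarrow> real" by (auto simp: indicator_def)
    have "set_integrable lborel {0..} (\<lambda>s. s powr - \<alpha> * bessel_base \<alpha> A s)"
      by (intro set_integrable_powr_weight set_integrable_bessel_base continuous_on_bessel_base) (use \<alpha> A False in auto)
    hence int: "integrable lborel b" unfolding set_integrable_def b b_def .
    \<comment> \<open>Taking \<open>max 0\<close> leaves the nonnegative \<open>b\<close> unchanged
      and discharges the sign premise of \<open>integral_pos\<close>.\<close>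
    have "(LBINT s. max 0 (b s)) > 0"
    proof (rule integral_pos)
      show "integrable lborel (\<lambda>s. max 0 (b s))" using int by auto
      show "max 0 (b s) > 0" if "s > 0" for s
        using that bessel_base_pos[OF \<alpha> A, of s] by (auto simp: b_def less_max_iff_disj)
    qed auto
    hence pos: "(LBINT s. b s) > 0" using bessel_base_nonneg[OF \<alpha> A] by (simp add: b_def max_def)
    have "has_bochner_integral lborel (\<lambda>s. indicator {0<..} s * (s powr - \<alpha> * profile \<theta> \<alpha> A s)) 
           (coeff_gf \<theta> \<alpha> (\<theta> powr (\<alpha> - 2)) * (LBINT s. b s))"
      using int \<alpha> by (intro profile_weighted_integral[OF \<theta> \<alpha> A]) (auto simp: b_def has_bochner_integral_iff)
    hence "P.weighted_tail 0 = coeff_gf \<theta> \<alpha> (\<theta> powr (\<alpha> - 2)) * (LBINT s. b s)"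
      by (simp add: P.weighted_tail_def tail_def P.weighted_def set_lebesgue_integral_def b has_bochner_integral_iff del: real_scaleR_def)
    also have "\<dots> > 0"
      using \<theta> \<alpha> powr_less_mono[of "\<alpha> - 2" 0 \<theta>] pos by (intro mult_pos_pos coeff_gf_prodinf(2)) auto
    finally show ?thesis using False by (simp add: P.boundary_value_def)
  qed
qed

text \<open>The coefficients alternate in sign, so this cannot be seen termwise; it is the maximum
  principle applied to the profile.\<close>

lemma profile_nonneg: "s \<ge> 0 \<Longrightarrow> profile \<theta> \<alpha> A s \<ge> 0"
  using halfline_solution.nonneg[OF halfline_solution_profile _, of s] profile_boundary_value_pos profile_0_pos[OF \<theta> \<alpha> A]
  by (cases "s = 0") auto

lemma even_profile_integral:
  "integrable lborel (\<lambda>x. C * profile \<theta> \<alpha> A \<bar>x\<bar>)"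
  "(LBINT x. C * profile \<theta> \<alpha> A \<bar>x\<bar>) = 2 * C * (LBINT s:{0..}. profile \<theta> \<alpha> A s)"
proof -
  let ?f = "\<lambda>x. indicator {0..} x *\<^sub>R profile \<theta> \<alpha> A x"
  have f: "integrable lborel ?f" using profile_integral(1) by (simp add: set_integrable_def)
  have g: "integrable lborel (\<lambda>x. ?f (0 + (- 1) * x))"
    using f by (intro lborel_integrable_real_affine) auto
  \<comment> \<open>Off the origin one of the two functions is 0 and the other nonnegative, and at
    the origin they agree, so the maximum is the even extension.\<close>
  have "integrable lborel (\<lambda>x. max (?f x) (?f (0 + (- 1) * x)))"
    using f g by (rule integrable_max)
  also have "(\<lambda>x. max (?f x) (?f (0 + (- 1) * x))) = (\<lambda>x. profile \<theta> \<alpha> A \<bar>x\<bar>)"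
    by (auto simp: fun_eq_iff indicator_def max_def profile_nonneg antisym)
  finally have i: "integrable lborel (\<lambda>x. profile \<theta> \<alpha> A \<bar>x\<bar>)" .
  thus "integrable lborel (\<lambda>x. C * profile \<theta> \<alpha> A \<bar>x\<bar>)" by simp
  have "(LBINT x. profile \<theta> \<alpha> A \<bar>x\<bar>) = 2 * (LBINT x:{0..}. profile \<theta> \<alpha> A \<bar>x\<bar>)"
    by (rule even_integral[OF i]) simp
  also have "(LBINT x:{0..}. profile \<theta> \<alpha> A \<bar>x\<bar>) = (LBINT s:{0..}. profile \<theta> \<alpha> A s)"
    by (rule set_lebesgue_integral_cong) auto
  finally show "(LBINT x. C * profile \<theta> \<alpha> A \<bar>x\<bar>) = 2 * C * (LBINT s:{0..}. profile \<theta> \<alpha> A s)" by simp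
qed

text \<open>The factor is the quotient of the boundary values; equality for \<open>s > 0\<close> is
  \<open>halfline_solution_unique\<close>, and continuity carries it to 0.\<close>

lemma solution_unique:
  assumes f: "halfline_solution (A * (2 - \<alpha>)\<^sup>2) \<theta> \<alpha> f f'"
  shows "\<exists>k. \<forall>s\<ge>0. f s = k * profile \<theta> \<alpha> A s"
proof -
  define P where "P = profile \<theta> \<alpha> A"
  interpret f: halfline_solution "A * (2 - \<alpha>)\<^sup>2" \<theta> \<alpha> f f' by fact
  define k where "k = f.boundary_value / halfline_solution.boundary_value \<alpha> P"
  have "f.boundary_value = k * halfline_solution.boundary_value \<alpha> P" using profile_boundary_value_pos by (simp add: k_def P_def)
  hence pos: "f s = k * P s" if "s > 0" for s
    unfolding P_def using that by (intro halfline_solution_unique[OF f halfline_solution_profile]) auto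
  have lim: "(g \<longlongrightarrow> g 0) (at_right 0)" if "continuous_on {0..} g" for g :: "real \<Rightarrow> real"
    using that by (intro tendsto_within_subset[of g _ 0 "{0..}" "{0<..}"]) (auto simp: continuous_on_def)
  have "((\<lambda>s. k * P s) \<longlongrightarrow> k * P 0) (at_right 0)"
    using continuous_on_profile[OF \<theta> \<alpha> A] by (intro tendsto_intros lim) (simp add: P_def)
  moreover have "((\<lambda>s. k * P s) \<longlongrightarrow> f 0) (at_right 0)"
    by (rule Lim_transform_eventually[OF lim[OF f.cont]])
       (use eventually_at_right_less[of "0::real"] in \<open>eventually_elim\<close>, simp add: pos)
  ultimately have "f 0 = k * P 0" using tendsto_unique[of "at_right (0::real)"] by force
  with pos have "\<forall>s\<ge>0. f s = k * P s" by (metis le_less)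
  thus ?thesis unfolding P_def by blast
qed

end

text \<open>With \<open>Y = A * (\<theta> ^ n * \<bar>x\<bar>) powr (2 - \<alpha>)\<close>, the
  argument of \<open>BesselK\<close> is \<open>2 * sqrt Y\<close> and the square root in front is
  \<open>Y powr (\<nu> / 2)\<close>, which cancels the prefactor in
  \<open>BesselK_eq_bessel_integral\<close>.\<close>

lemma bessel_term_eq:
  fixes \<theta> l \<sigma> \<alpha> :: real
  assumes "\<theta> > 1" "l > 0" "\<sigma> > 0" "0 \<le> \<alpha>" "\<alpha> < 2" and A: "A = 2 * l / (\<sigma>\<^sup>2 * (2 - \<alpha>)\<^sup>2)" and "x \<noteq> 0"
  shows "bessel_term \<theta> l \<sigma> \<alpha> n x = coeff_a \<theta> \<alpha> n / \<theta> ^ n * bessel_base \<alpha> A (\<theta> ^ n * \<bar>x\<bar>)"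
proof -
  define \<beta> \<nu> s Y where "\<beta> = 2 - \<alpha>" "\<nu> = 1 / \<beta>" "s = \<theta> ^ n * \<bar>x\<bar>" "Y = A * s powr \<beta>"
  note defs = \<beta>_\<nu>_s_Y_def
  have \<beta>: "\<beta> > 0" "\<beta> \<le> 2" using assms by (auto simp: defs)
  have \<nu>: "\<nu> \<ge> 1 / 2" using \<beta> by (simp add: defs(2) field_simps)
  have "A > 0" using assms by (simp add: A)
  have s: "s > 0" using assms by (simp add: defs)
  have Y: "Y > 0" using s \<open>A > 0\<close> by (simp add: defs(4))
  have "(\<theta> ^ n) powr \<beta> = (\<theta> powr real n) powr \<beta>" using assms by (simp add: powr_realpow)
  hence "\<theta> powr (real n * \<beta>) * \<bar>x\<bar> powr \<beta> = s powr \<beta>"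
    using assms by (simp add: defs(3) powr_mult powr_powr)
  hence arg: "2 * l * \<theta> powr (real n * (2 - \<alpha>)) * \<bar>x\<bar> powr (2 - \<alpha>) / (\<sigma>\<^sup>2 * (2 - \<alpha>)\<^sup>2) = Y"
    by (simp add: defs(1,4) A mult.assoc)
  have Y\<nu>: "Y powr \<nu> = A powr \<nu> * s" using s \<open>A > 0\<close> \<beta> by (simp add: defs(2,4) powr_mult powr_powr)
  have "scale_c l \<sigma> \<alpha> * \<theta> ^ n * \<bar>x\<bar> = Y powr \<nu>"
    unfolding Y\<nu> by (simp add: scale_c_def A[symmetric] defs(1-3))
  hence sq: "sqrt (scale_c l \<sigma> \<alpha> * \<theta> ^ n * \<bar>x\<bar>) = Y powr (\<nu> / 2)"
    by (simp add: powr_half_sqrt[symmetric] powr_powr)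
  have "BesselK \<nu> (2 * sqrt Y) = (sqrt Y) powr - \<nu> * bessel_integral \<nu> Y / 2"
    using BesselK_eq_bessel_integral[OF \<nu>, of "2 * sqrt Y"] Y by (simp add: power_mult_distrib)
  also have "(sqrt Y) powr - \<nu> = Y powr - (\<nu> / 2)"
    using Y by (simp add: powr_half_sqrt[symmetric] powr_powr)
  finally have "Y powr (\<nu> / 2) * BesselK \<nu> (2 * sqrt Y) = bessel_integral \<nu> Y / 2"
    using Y by (simp add: powr_minus field_simps)
  moreover have "bessel_base \<alpha> A s = bessel_integral \<nu> Y / 2" by (simp add: bessel_base_def defs(1,2,4))
  ultimately show ?thesis unfolding bessel_term_def arg sq by (simp add: defs(1-3) mult.assoc)
qed

text \<open>At 0 the limit defining the term exists because \<open>bessel_base\<close> is continuous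
  there from the right and enters through \<open>\<bar>x\<bar>\<close>.\<close>

lemma series_term_eq:
  fixes \<theta> l \<sigma> \<alpha> :: real
  assumes par: "\<theta> > 1" "l > 0" "\<sigma> > 0" "0 \<le> \<alpha>" "\<alpha> < 2" and A: "A = 2 * l / (\<sigma>\<^sup>2 * (2 - \<alpha>)\<^sup>2)"
  shows "series_term \<theta> l \<sigma> \<alpha> n x = coeff_a \<theta> \<alpha> n / \<theta> ^ n * bessel_base \<alpha> A (\<theta> ^ n * \<bar>x\<bar>)"
proof (cases "x = 0")
  case True
  let ?g = "\<lambda>x. coeff_a \<theta> \<alpha> n / \<theta> ^ n * bessel_base \<alpha> A (\<theta> ^ n * \<bar>x\<bar>)"
  have "A > 0" using par by (simp add: A)
  have "continuous_on UNIV ?g"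
    using par \<open>A > 0\<close> by (intro continuous_intros continuous_on_compose2[OF continuous_on_bessel_base[of \<alpha> A]]) auto
  hence "isCont ?g 0" using continuous_on_eq_continuous_at[of UNIV ?g] by blast
  hence "(?g \<longlongrightarrow> ?g 0) (at 0)" by (rule isContD)
  hence "(bessel_term \<theta> l \<sigma> \<alpha> n \<longlongrightarrow> ?g 0) (at 0)"
  proof (rule Lim_transform_eventually)
    show "eventually (\<lambda>x. ?g x = bessel_term \<theta> l \<sigma> \<alpha> n x) (at 0)"
      using bessel_term_eq[OF par A] by (auto simp: eventually_at_filter)
  qed
  hence "Lim (at 0) (bessel_term \<theta> l \<sigma> \<alpha> n) = ?g 0" by (intro tendsto_Lim) auto
  thus ?thesis using True by (simp add: series_term_def)
qed (simp add: series_term_def bessel_term_eq[OF par A])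

text \<open>The equivalence expresses existence and uniqueness at once. Summability is stated as
  well, so that the infinite sum in \<open>stationary_density\<close> is a genuine limit.\<close>

theorem theorem3p11:
  fixes \<theta> l \<sigma> \<alpha> :: real
  assumes "\<theta> > 1" and "l > 0" and "\<sigma> > 0" and "0 \<le> \<alpha>" and "\<alpha> < 2"
  shows "(\<forall>x. summable (\<lambda>n. series_term \<theta> l \<sigma> \<alpha> n x)) \<and>
    (\<forall>p. C2_density \<alpha> p \<and> solves_equation \<theta> l \<sigma> \<alpha> p \<longleftrightarrow> p = stationary_density \<theta> l \<sigma> \<alpha>)"
proof -
  define A where "A = 2 * l / (\<sigma>\<^sup>2 * (2 - \<alpha>)\<^sup>2)"
  define P where "P = profile \<theta> \<alpha> A"
  define C where "C = 2 * const_phi \<theta> l \<sigma> \<alpha> * (2 - \<alpha>)"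
  note \<theta> = assms(1) and \<alpha> = assms(4,5)
  have A: "A > 0" using assms by (simp add: A_def)
  have K: "A * (2 - \<alpha>)\<^sup>2 = 2 * l / \<sigma>\<^sup>2" using assms by (simp add: A_def)
  note terms = series_term_eq[OF assms A_def]
  interpret P: halfline_solution "2 * l / \<sigma>\<^sup>2" \<theta> \<alpha> P "profile' \<theta> \<alpha> A"
    using halfline_solution_profile[OF \<theta> \<alpha> A] by (simp add: K P_def)
  have stat: "stationary_density \<theta> l \<sigma> \<alpha> = (\<lambda>x. C * P \<bar>x\<bar>)"
    by (simp add: fun_eq_iff stationary_density_def C_def terms P_def profile_def)
  \<comment> \<open>The infinite product in \<open>const_phi\<close> is Euler's product at
    \<open>\<theta> powr - 2\<close>, the factor that enters the total mass.\<close>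
  have gf: "coeff_gf \<theta> \<alpha> (\<theta> powr - 2) = (\<Prod>k. 1 - 1 / \<theta> powr (2 + real k * (2 - \<alpha>)))"
      "coeff_gf \<theta> \<alpha> (\<theta> powr - 2) > 0"
  proof -
    have z: "0 < \<theta> powr - 2" "\<theta> powr - 2 < 1" using \<theta> powr_less_mono[of "- 2" 0 \<theta>] by auto
    have "\<theta> powr - 2 * \<theta> powr - (real k * (2 - \<alpha>)) = 1 / \<theta> powr (2 + real k * (2 - \<alpha>))" for k
      by (simp add: powr_add[symmetric] powr_minus_divide[symmetric])
    thus "coeff_gf \<theta> \<alpha> (\<theta> powr - 2) = (\<Prod>k. 1 - 1 / \<theta> powr (2 + real k * (2 - \<alpha>)))"
      using coeff_gf_prodinf(1)[OF \<theta> \<alpha>(2) z] by simp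
    show "coeff_gf \<theta> \<alpha> (\<theta> powr - 2) > 0" by (rule coeff_gf_prodinf(2)[OF \<theta> \<alpha>(2) z])
  qed
  define I where "I = (LBINT s:{0..}. P s)"
  have pos: "Gamma (1 / (2 - \<alpha>)) > 0" "Gamma (2 / (2 - \<alpha>)) > 0" "A powr (1 / (2 - \<alpha>)) > 0" "2 - \<alpha> > 0"
    using \<alpha> A by (auto intro: Gamma_real_pos)
  have C_eq: "C = A powr (1 / (2 - \<alpha>)) * (2 - \<alpha>) / (Gamma (1 / (2 - \<alpha>)) * Gamma (2 / (2 - \<alpha>)) * coeff_gf \<theta> \<alpha> (\<theta> powr - 2))"
    unfolding C_def const_phi_def gf(1)[symmetric] scale_c_def A_def[symmetric] by (simp add: field_simps)
  have "C > 0" unfolding C_eq using pos gf(2) by auto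
  have I_eq: "I = coeff_gf \<theta> \<alpha> (\<theta> powr - 2) * (Gamma (1 / (2 - \<alpha>)) * Gamma (2 / (2 - \<alpha>)) * inverse (A powr (1 / (2 - \<alpha>))) / (2 * (2 - \<alpha>)))"
    unfolding I_def P_def by (simp only: profile_integral(2)[OF \<theta> \<alpha> A] powr_minus)
  have "I > 0" unfolding I_eq using pos gf(2) by auto
  \<comment> \<open>The constant of the theorem is the reciprocal of the mass of the even extension
    of \<open>P\<close>.\<close>
  have one: "2 * C * I = 1" 
  proof -
    have "2 * (a * b / (g * h * e)) * (e * (g * h * inverse a / (2 * b))) = 1"
      if "a > 0" "b > 0" "g > 0" "h > 0" "e > 0" for a b g h e :: real
      using that by (simp add: field_simps)
    from this[OF pos(3,4,1,2) gf(2)] show ?thesis unfolding C_eq I_eq .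
  qed
  have integral: "(LBINT x. k * P \<bar>x\<bar>) = 2 * k * I" for k
    unfolding P_def I_def by (rule even_profile_integral(2)[OF \<theta> \<alpha> A])
  have fwd: "C2_density \<alpha> (\<lambda>x. C * P \<bar>x\<bar>) \<and> solves_equation \<theta> l \<sigma> \<alpha> (\<lambda>x. C * P \<bar>x\<bar>)"
  proof -
    have "(\<lambda>x. C * P \<bar>x\<bar>) \<in> borel_measurable borel"
      by (rule borel_measurable_continuous_onI[OF P.continuous_on_even_extension])
    moreover have "0 \<le> C * P \<bar>x\<bar>" for x
      using \<open>C > 0\<close> profile_nonneg[OF \<theta> \<alpha> A, of "\<bar>x\<bar>"] by (simp add: P_def)
    moreover have "integrable lborel (\<lambda>x. C * P \<bar>x\<bar>)"
      unfolding P_def by (rule even_profile_integral(1)[OF \<theta> \<alpha> A])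
    ultimately have "probability_density (\<lambda>x. C * P \<bar>x\<bar>)"
      unfolding probability_density_iff integral one by blast
    thus ?thesis
      using P.even_extension_solves[OF assms(3) refl] P.continuous_on_even_extension by (simp add: C2_density_def)
  qed
  have bwd: "p = (\<lambda>x. C * P \<bar>x\<bar>)" if C2: "C2_density \<alpha> p" and eq: "solves_equation \<theta> l \<sigma> \<alpha> p" for p
  proof -
    note sol = solution_halfline[OF assms C2 eq, folded K]
    obtain k where k: "\<And>s. s \<ge> 0 \<Longrightarrow> p s = k * P s"
      using solution_unique[OF \<theta> \<alpha> A sol(1)] by (auto simp: P_def)
    obtain k' where k': "\<And>s. s \<ge> 0 \<Longrightarrow> p (- s) = k' * P s"
      using solution_unique[OF \<theta> \<alpha> A sol(2)] by (auto simp: P_def)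
    \<comment> \<open>Both half-line factors are read off at 0, where the profile is positive; the
      common value of \<open>p\<close> there couples the two sides.\<close>
    have "P 0 > 0" unfolding P_def by (rule profile_0_pos[OF \<theta> \<alpha> A])
    with k[of 0] k'[of 0] have "k' = k" by simp
    hence p: "p = (\<lambda>x. k * P \<bar>x\<bar>)" using k k'[of "- x" for x] by (force simp: fun_eq_iff abs_if)
    have "(LBINT x. p x) = 1" using C2 by (simp add: C2_density_def probability_density_iff)
    hence "2 * k * I = 2 * C * I" unfolding p integral one .
    hence "k = C" using \<open>I > 0\<close> by simp
    thus ?thesis by (simp add: p)
  qed
  have "summable (\<lambda>n. series_term \<theta> l \<sigma> \<alpha> n x)" for x
    unfolding terms by (rule summable_profile[OF \<theta> \<alpha> A])
  thus ?thesis unfolding stat using fwd bwd by blast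
qed

end
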